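(* Let $X$ be a path-connected space, $x_0\in X$, and $H\leq \pi_1(X,x_0)$ a subgroup. If $p_H:\widetilde{X}_H\to X$ has the unique path lifting property, then $H$ is $(D,d_{\infty})$-closed. The converse holds if the path space $P(X)$ is first countable (for instance, if $X$ is metrizable): in that case, if $H$ is $(D,d_\infty)$-closed, then $p_H$ has the unique path lifting property.
   Context: A map is a continuous function; $f_{\#}$ denotes the homomorphism induced on fundamental groups. For paths, $\alpha\cdot\beta$ is concatenation and $\alpha^{-}(t)=\alpha(1-t)$. $P(X)$ is the space of paths $[0,1]\to X$ with the compact-open topology. The space $\widetilde{X}_H$: it is the set of equivalence classes $H[\alpha]$ of paths $\alpha:[0,1]\to X$ with $\alpha(0)=x_0$, where $\alpha\sim\beta$ iff $\alpha(1)=\beta(1)$ and $[\alpha\cdot\beta^{-}]\in H$. Its topology is generated by the sets $B(H[\alpha],U)=\{H[\alpha\cdot\epsilon]\mid \epsilon:[0,1]\to U \text{ a path},\ \epsilon(0)=\alpha(1)\}$, where $U$ is an open neighborhood of $\alpha(1)$ in $X$. The map $p_H:\widetilde{X}_H\to X$ is $p_H(H[\alpha])=\alpha(1)$. A map $f:Y\to X$ has the unique path lifting property if whenever $\alpha,\beta:[0,1]\to Y$ are paths with $\alpha(0)=\beta(0)$ and $f\circ\alpha=f\circ\beta$, then $\alpha=\beta$. Closed subgroups: for a based space $(\mathbb{T},t_0)$, a subgroup $T\leq\pi_1(\mathbb{T},t_0)$ and $g\in\pi_1(\mathbb{T},t_0)$, a subgroup $H\leq\pi_1(X,x_0)$ is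 $(T,g)$-closed if for every map $f:(\mathbb{T},t_0)\to(X,x_0)$ with $f_{\#}(T)\leq H$ we have $f_{\#}(g)\in H$. The test space $\mathbb{D}$: for integers $n\geq1$, $1\leq j\leq 2^{n-1}$ let $\mathbb{D}(n,j)=\{(x,y)\in\mathbb{R}^2\mid (x-\frac{2j-1}{2^n})^2+y^2=(\frac1{2^n})^2,\ y\geq0\}$, let $B=[0,1]\times\{0\}$, and let $\mathbb{D}=B\cup\bigcup_{n,j}\mathbb{D}(n,j)\subseteq\mathbb{R}^2$ with the subspace topology and basepoint $d_0=(0,0)$. Let $\ell_{n,j}:[0,1]\to\mathbb{D}(n,j)$, $\ell_{n,j}(t)=\left(\frac{t+j-1}{2^{n-1}},\frac{1}{2^{n-1}}\sqrt{t-t^2}\right)$; the paths $\ell_{n,j}$ and $\ell_{n,j}^{-}$ are called standard. Let $\lambda_1=\ell_{1,1}$ and $\lambda_\infty(t)=(t,0)$. $D\leq\pi_1(\mathbb{D},d_0)$ is the subgroup of homotopy classes of loops at $d_0$ that are finite concatenations of standard paths, and $d_\infty=[\lambda_1\cdot\lambda_\infty^{-}]$. *)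

theory Defs
  imports "HOL-Analysis.Analysis" "HOL-Algebra.Group"
begin

text \<open>
  A space is a subset of an arbitrary topological space, carrying the subspace topology.
\<close>

section \<open>Fundamental groups\<close>

definition path_class :: "'a::topological_space set \<Rightarrow> (real \<Rightarrow> 'a) \<Rightarrow> (real \<Rightarrow> 'a) set" where
  "path_class X p = {q. homotopic_paths X p q}"

definition fundamental_group :: "'a::topological_space set \<Rightarrow> 'a \<Rightarrow> (real \<Rightarrow> 'a) set monoid" where
  "fundamental_group X x0 =
    \<lparr> carrier = {path_class X p | p.
        path p \<and> path_image p \<subseteq> X \<and> pathstart p = x0 \<and> pathfinish p = x0},
      mult = (\<lambda>a b. {r. \<exists>p\<in>a. \<exists>q\<in>b. homotopic_paths X (p +++ q) r}),
      one = path_class X (\<lambda>_. x0) \<rparr>"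

definition induced_hom ::
    "'b::topological_space set \<Rightarrow> ('a::topological_space \<Rightarrow> 'b) \<Rightarrow> (real \<Rightarrow> 'a) set \<Rightarrow> (real \<Rightarrow> 'b) set" where
  "induced_hom Y f c = {r. \<exists>p\<in>c. homotopic_paths Y (f \<circ> p) r}"

lemma path_class_cong:
  assumes "homotopic_paths X p q"
  shows "path_class X p = path_class X q"
proof -
  have "homotopic_paths X p r \<longleftrightarrow> homotopic_paths X q r" for r
    using assms homotopic_paths_sym homotopic_paths_trans by metis
  then show ?thesis
    by (simp add: path_class_def)
qed

lemma fundamental_group_mult:
  assumes "path p" "path_image p \<subseteq> X" "path q" "path_image q \<subseteq> X" "pathfinish p = pathstart q"
  shows "path_class X p \<otimes>\<^bsub>fundamental_group X x0\<^esub> path_class X q = path_class X (p +++ q)"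
proof -
  have "(\<exists>p'. homotopic_paths X p p' \<and> (\<exists>q'. homotopic_paths X q q' \<and> homotopic_paths X (p' +++ q') r))
      \<longleftrightarrow> homotopic_paths X (p +++ q) r" for r
  proof
    assume "\<exists>p'. homotopic_paths X p p' \<and> (\<exists>q'. homotopic_paths X q q' \<and> homotopic_paths X (p' +++ q') r)"
    then obtain p' q' where *: "homotopic_paths X p p'" "homotopic_paths X q q'"
        "homotopic_paths X (p' +++ q') r"
      by blast
    have "homotopic_paths X (p +++ q) (p' +++ q')"
      using *(1,2) assms(5) by (rule homotopic_paths_join)
    from this *(3) show "homotopic_paths X (p +++ q) r"
      by (rule homotopic_paths_trans)
  next
    assume "homotopic_paths X (p +++ q) r"
    then show "\<exists>p'. homotopic_paths X p p' \<and> (\<exists>q'. homotopic_paths X q q' \<and> homotopic_paths X (p' +++ q') r)"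
      using assms by (intro exI[of _ p] exI[of _ q] conjI) simp_all
  qed
  then show ?thesis
    by (simp add: fundamental_group_def path_class_def)
qed

lemma induced_hom_path_class:
  assumes "continuous_on X f" "f ` X \<subseteq> Y" "path p" "path_image p \<subseteq> X"
  shows "induced_hom Y f (path_class X p) = path_class Y (f \<circ> p)"
proof -
  have "homotopic_paths Y (f \<circ> p) (f \<circ> q)" if "homotopic_paths X p q" for q
    using homotopic_paths_continuous_image[OF that assms(1)] assms(2) by blast
  moreover have "homotopic_paths X p p"
    using assms by simp
  ultimately have "(\<exists>q. homotopic_paths X p q \<and> homotopic_paths Y (f \<circ> q) r)
      \<longleftrightarrow> homotopic_paths Y (f \<circ> p) r" for r
    by (meson homotopic_paths_trans)
  then show ?thesis
    by (simp add: induced_hom_def path_class_def)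
qed

lemma group_fundamental_group:
  assumes x0: "x0 \<in> X"
  shows "group (fundamental_group X x0)"
proof -
  let ?G = "fundamental_group X x0"
  let ?c = "(\<lambda>_. x0) :: real \<Rightarrow> 'a"
  let ?L = "\<lambda>p. path p \<and> path_image p \<subseteq> X \<and> pathstart p = x0 \<and> pathfinish p = x0"
  have carr: "carrier ?G = {path_class X p | p. ?L p}" and one: "\<one>\<^bsub>?G\<^esub> = path_class X ?c"
    by (simp_all add: fundamental_group_def)
  have c: "?L ?c"
    using x0 by (auto simp: path_def path_image_def pathstart_def pathfinish_def)
  have mult: "path_class X p \<otimes>\<^bsub>?G\<^esub> path_class X q = path_class X (p +++ q)" if "?L p" "?L q" for p q
    using that by (simp add: fundamental_group_mult)
  have join: "?L (p +++ q)" if "?L p" "?L q" for p q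
    using that by (auto simp: path_image_join)
  have lid: "homotopic_paths X p (?c +++ p)" if p: "?L p" for p
  proof (rule homotopic_paths_reparametrize[where f = "\<lambda>t. if t \<le> 1/2 then 0 else 2 * t - 1"])
    show "continuous_on {0..1} (\<lambda>t::real. if t \<le> 1/2 then 0 else 2 * t - 1)"
      unfolding split_01
      by (intro continuous_on_cases continuous_intros) auto
  qed (use p in \<open>auto simp: joinpaths_def pathstart_def\<close>)
  have linv: "homotopic_paths X (reversepath p +++ p) ?c" if p: "?L p" for p
  proof -
    have pc: "continuous_on {0..1} p" using p by (simp add: path_def)
    let ?g = "\<lambda>z. if snd z \<le> 1/2 then 1 - (1 - fst z) * (2 * snd z)
                  else 1 - (1 - fst z) * (2 - 2 * snd z) :: real"
    have g: "continuous_on ({0..1} \<times> {0..1}) ?g"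
    proof -
      have "continuous_on ({0..1} \<times> {0..1}) (\<lambda>z::real \<times> real. 1 - (1 - fst z) * min (2 * snd z) (2 - 2 * snd z))"
        by (intro continuous_intros)
      moreover have "(\<lambda>z::real \<times> real. 1 - (1 - fst z) * min (2 * snd z) (2 - 2 * snd z)) = ?g"
        by (auto simp: fun_eq_iff min_def)
      ultimately show ?thesis by (simp only:)
    qed
    have gi: "?g z \<in> {0..1}" if "z \<in> {0..1} \<times> {0..1}" for z
    proof -
      have a: "0 \<le> 1 - fst z" "1 - fst z \<le> 1" "0 \<le> snd z" "snd z \<le> 1" using that by auto
      show ?thesis
      proof (cases "snd z \<le> 1/2")
        case True
        then have "0 \<le> 2 * snd z" "2 * snd z \<le> 1" using a by auto
        then have "(1 - fst z) * (2 * snd z) \<le> 1" "0 \<le> (1 - fst z) * (2 * snd z)"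
          using a by (metis mult_le_one, metis mult_nonneg_nonneg)
        then show ?thesis using True by simp
      next
        case False
        then have "0 \<le> 2 - 2 * snd z" "2 - 2 * snd z \<le> 1" using a by auto
        then have "(1 - fst z) * (2 - 2 * snd z) \<le> 1" "0 \<le> (1 - fst z) * (2 - 2 * snd z)"
          using a by (metis mult_le_one, metis mult_nonneg_nonneg)
        then show ?thesis using False by simp
      qed
    qed
    have "continuous_on ({0..1} \<times> {0..1}) (\<lambda>z. p (?g z))"
      by (rule continuous_on_compose2[OF pc g]) (use gi in blast)
    moreover have "p (?g z) \<in> X" if "z \<in> {0..1} \<times> {0..1}" for z
      using gi[OF that] p unfolding path_image_def by blast
    ultimately show ?thesis
      unfolding homotopic_paths
      using p
      by (intro exI[of _ "\<lambda>z. p (?g z)"])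
        (auto simp: joinpaths_def reversepath_def pathstart_def pathfinish_def image_subset_iff algebra_simps)
  qed
  show ?thesis
  proof (rule groupI)
    show "x \<otimes>\<^bsub>?G\<^esub> y \<in> carrier ?G" if xy: "x \<in> carrier ?G" "y \<in> carrier ?G" for x y
    proof -
      obtain p q where pq: "?L p" "?L q" "x = path_class X p" "y = path_class X q"
        using xy unfolding carr by blast
      show ?thesis
        unfolding pq(3,4) mult[OF pq(1,2)] carr using join[OF pq(1,2)] by blast
    qed
    show "\<one>\<^bsub>?G\<^esub> \<in> carrier ?G" using c one carr by blast
    show "x \<otimes>\<^bsub>?G\<^esub> y \<otimes>\<^bsub>?G\<^esub> z = x \<otimes>\<^bsub>?G\<^esub> (y \<otimes>\<^bsub>?G\<^esub> z)"
      if xyz: "x \<in> carrier ?G" "y \<in> carrier ?G" "z \<in> carrier ?G" for x y z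
    proof -
      obtain p q r where pqr: "?L p" "?L q" "?L r"
        "x = path_class X p" "y = path_class X q" "z = path_class X r"
        using xyz unfolding carr by blast
      have "homotopic_paths X (p +++ (q +++ r)) ((p +++ q) +++ r)"
        using pqr by (intro homotopic_paths_assoc) auto
      from path_class_cong[OF this] show ?thesis
        unfolding pqr(4-6) mult[OF pqr(1,2)] mult[OF pqr(2,3)]
          mult[OF join[OF pqr(1,2)] pqr(3)] mult[OF pqr(1) join[OF pqr(2,3)]] by (rule sym)
    qed
    show "\<one>\<^bsub>?G\<^esub> \<otimes>\<^bsub>?G\<^esub> x = x" if x: "x \<in> carrier ?G" for x
    proof -
      obtain p where p: "?L p" "x = path_class X p" using x unfolding carr by blast
      show ?thesis
        unfolding one p(2) mult[OF c p(1)] by (rule path_class_cong[OF lid[OF p(1)], symmetric])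
    qed
    show "\<exists>y\<in>carrier ?G. y \<otimes>\<^bsub>?G\<^esub> x = \<one>\<^bsub>?G\<^esub>" if x: "x \<in> carrier ?G" for x
    proof -
      obtain p where p: "?L p" "x = path_class X p" using x unfolding carr by blast
      have r: "?L (reversepath p)" using p by auto
      show ?thesis
      proof (rule bexI)
        show "path_class X (reversepath p) \<otimes>\<^bsub>?G\<^esub> x = \<one>\<^bsub>?G\<^esub>"
          unfolding p(2) one mult[OF r p(1)] by (rule path_class_cong[OF linv[OF p(1)]])
        show "path_class X (reversepath p) \<in> carrier ?G"
          unfolding carr using r by blast
      qed
    qed
  qed
qed

text \<open>\<open>H\<close> is \<open>(T, g)\<close>-closed, where \<open>T\<close> and \<open>g\<close> live in the fundamental group of \<open>(S, s0)\<close>.\<close>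

definition closed_for ::
    "'b::topological_space set \<Rightarrow> 'b \<Rightarrow> (real \<Rightarrow> 'b) set set \<Rightarrow> (real \<Rightarrow> 'b) set
      \<Rightarrow> 'a::topological_space set \<Rightarrow> 'a \<Rightarrow> (real \<Rightarrow> 'a) set set \<Rightarrow> bool" where
  "closed_for S s0 T g X x0 H \<longleftrightarrow>
    (\<forall>f. continuous_on S f \<and> f ` S \<subseteq> X \<and> f s0 = x0 \<and> induced_hom X f ` T \<subseteq> H
      \<longrightarrow> induced_hom X f g \<in> H)"

section \<open>The space of path classes modulo a subgroup\<close>

definition based_paths :: "'a::topological_space set \<Rightarrow> 'a \<Rightarrow> (real \<Rightarrow> 'a) set" where
  "based_paths X x0 = {p. path p \<and> path_image p \<subseteq> X \<and> pathstart p = x0}"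

text \<open>The class \<open>H[\<alpha>]\<close>.\<close>

definition subgroup_class ::
    "'a::topological_space set \<Rightarrow> 'a \<Rightarrow> (real \<Rightarrow> 'a) set set \<Rightarrow> (real \<Rightarrow> 'a) \<Rightarrow> (real \<Rightarrow> 'a) set" where
  "subgroup_class X x0 H \<alpha> =
    {\<beta> \<in> based_paths X x0. pathfinish \<alpha> = pathfinish \<beta> \<and> path_class X (\<alpha> +++ reversepath \<beta>) \<in> H}"

definition class_nbhd ::
    "'a::topological_space set \<Rightarrow> 'a \<Rightarrow> (real \<Rightarrow> 'a) set set \<Rightarrow> (real \<Rightarrow> 'a) \<Rightarrow> 'a set
      \<Rightarrow> (real \<Rightarrow> 'a) set set" where
  "class_nbhd X x0 H \<alpha> U =
    {subgroup_class X x0 H (\<alpha> +++ \<epsilon>) | \<epsilon>. path \<epsilon> \<and> path_image \<epsilon> \<subseteq> U \<and> pathstart \<epsilon> = pathfinish \<alpha>}"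

text \<open>
  The sets with \<open>U = X\<close> make the underlying set consist of the classes of all paths in \<open>X\<close>
  starting at \<open>x0\<close>.
\<close>

definition cover_space ::
    "'a::topological_space set \<Rightarrow> 'a \<Rightarrow> (real \<Rightarrow> 'a) set set \<Rightarrow> (real \<Rightarrow> 'a) set topology" where
  "cover_space X x0 H = topology_generated_by
    {class_nbhd X x0 H \<alpha> U | \<alpha> U.
      \<alpha> \<in> based_paths X x0 \<and> openin (top_of_set X) U \<and> pathfinish \<alpha> \<in> U}"

definition cover_proj :: "(real \<Rightarrow> 'a::topological_space) set \<Rightarrow> 'a" where
  "cover_proj c = (THE x. \<exists>\<alpha>\<in>c. x = pathfinish \<alpha>)"

definition unique_path_lifting :: "'b topology \<Rightarrow> ('b \<Rightarrow> 'a) \<Rightarrow> bool" where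
  "unique_path_lifting Y f \<longleftrightarrow>
    (\<forall>\<alpha> \<beta>. pathin Y \<alpha> \<and> pathin Y \<beta> \<and> \<alpha> 0 = \<beta> 0 \<and> (\<forall>t\<in>{0..1}. f (\<alpha> t) = f (\<beta> t))
      \<longrightarrow> (\<forall>t\<in>{0..1}. \<alpha> t = \<beta> t))"

section \<open>The path space\<close>

text \<open>
  Paths are made extensional outside the unit interval, so that distinct points of the path space
  are distinct maps on the unit interval.
\<close>

definition path_space :: "'a::topological_space set \<Rightarrow> (real \<Rightarrow> 'a) topology" where
  "path_space X = topology_generated_by
    {{p \<in> extensional {0..1}. path p \<and> path_image p \<subseteq> X \<and> p ` K \<subseteq> U} | K U.
      compact K \<and> K \<subseteq> {0..1} \<and> openin (top_of_set X) U}"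

section \<open>The test space\<close>

definition dyadic_arc :: "nat \<Rightarrow> nat \<Rightarrow> (real \<times> real) set" where
  "dyadic_arc n j = {(x, y). (x - (2 * real j - 1) / 2 ^ n)\<^sup>2 + y\<^sup>2 = (1 / 2 ^ n)\<^sup>2 \<and> y \<ge> 0}"

definition dyadic_arc_space :: "(real \<times> real) set" where
  "dyadic_arc_space =
    {0..1} \<times> {0} \<union> (\<Union>n\<in>{1..}. \<Union>j\<in>{1..2 ^ (n - 1)}. dyadic_arc n j)"

definition arc_path :: "nat \<Rightarrow> nat \<Rightarrow> real \<Rightarrow> real \<times> real" where
  "arc_path n j t =
    ((t + real j - 1) / 2 ^ (n - 1), 1 / 2 ^ (n - 1) * sqrt (t - t\<^sup>2))"

definition base_path :: "real \<Rightarrow> real \<times> real" where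
  "base_path t = (t, 0)"

inductive standard_path :: "(real \<Rightarrow> real \<times> real) \<Rightarrow> bool" where
  "n \<ge> 1 \<Longrightarrow> 1 \<le> j \<Longrightarrow> j \<le> 2 ^ (n - 1) \<Longrightarrow> standard_path (arc_path n j)"
| "n \<ge> 1 \<Longrightarrow> 1 \<le> j \<Longrightarrow> j \<le> 2 ^ (n - 1) \<Longrightarrow> standard_path (reversepath (arc_path n j))"

text \<open>
  Finite concatenations, bracketed to the right; the bracketing does not affect homotopy classes.
\<close>

inductive standard_concat :: "(real \<Rightarrow> real \<times> real) \<Rightarrow> bool" where
  "standard_path p \<Longrightarrow> standard_concat p"
| "standard_path p \<Longrightarrow> standard_concat q \<Longrightarrow> pathfinish p = pathstart q \<Longrightarrow> standard_concat (p +++ q)"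

definition D_subgroup :: "(real \<Rightarrow> real \<times> real) set set" where
  "D_subgroup = {path_class dyadic_arc_space p | p.
    standard_concat p \<and> pathstart p = (0, 0) \<and> pathfinish p = (0, 0)}"

definition d_infinity :: "(real \<Rightarrow> real \<times> real) set" where
  "d_infinity = path_class dyadic_arc_space (arc_path 1 1 +++ reversepath base_path)"

end

theory Submission
  imports Defs
begin

text \<open>
  Write \<open>cl p\<close> for the point of the cover space that a path \<open>p\<close> from \<open>x0\<close> represents. A map \<open>f\<close> of the
  dyadic arc space into \<open>X\<close> is a path \<open>\<gamma>\<close> (its values on the base) together with, for each dyadic
  interval, a second path between the same two points of \<open>\<gamma>\<close>, and the second paths on short intervals
  stay close to \<open>\<gamma>\<close>. The hypothesis that \<open>f\<close> sends \<open>D\<close> into \<open>H\<close> says that travelling over arcs from \<open>0\<close>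
  to a dyadic point \<open>k / 2 ^ n\<close> ends at a point of the cover space that depends on \<open>k / 2 ^ n\<close> only. So
  the arcs define a second lift of \<open>\<gamma>\<close>, at first over dyadic points, besides the standard lift by
  initial segments of \<open>\<gamma>\<close>; the conclusion that \<open>f\<close> sends \<open>d_infinity\<close> into \<open>H\<close> says that the two lifts
  agree over \<open>1\<close>. The theorem compares lifts of \<open>\<gamma>\<close> with such maps \<open>f\<close>.
  
  Unique path lifting implies closedness. The lift over dyadic points has to be extended to all
  \<open>t \<in> [0, 1]\<close>. For this, \<open>t\<close> is approached from the left through its binary digits, and the arcs over
  the successive steps are joined into one path in the dyadic arc space (\<open>greedy_path\<close>) that ends at
  \<open>(t, 0)\<close>. The end of this path lies near \<open>(t, 0)\<close>, and its beginning is a finite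
  concatenation of arcs and may be replaced by any other one. This gives continuity at \<open>t\<close>
  (\<open>pathin_greedy_lift\<close>). Uniqueness of lifts now yields the claim at \<open>t = 1\<close>, where the
  greedy path is the largest arc (\<open>closed_if_unique_path_lifting\<close>).
  
  Closedness implies unique path lifting. It suffices that a lift \<open>c\<close> of \<open>\<gamma>\<close> that starts at the class
  of the constant path ends at \<open>cl \<gamma>\<close> (\<open>lift_from_base\<close>), because any lift can be prolonged backwards
  to one of this kind. By continuity of \<open>c\<close>, points \<open>c r\<close> and \<open>c s\<close> over nearby parameters are related
  by short paths of \<open>X\<close> (the elements of \<open>transporters c r s\<close>). Choosing such paths over all intervals
  of the \<open>n\<close>-th dyadic subdivision gives a path with the same values as \<open>\<gamma>\<close> at the
  subdivision points, and every neighbourhood of \<open>\<gamma>\<close> in \<open>P(X)\<close> contains such a path for all large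
  \<open>n\<close> (\<open>transporters_approximation\<close>). First countability of \<open>P(X)\<close> allows a choice for each \<open>n\<close> such
  that the chosen paths converge to \<open>\<gamma>\<close>, which is exactly what makes \<open>\<gamma>\<close> and the chosen
  paths into a continuous map \<open>f\<close> on the dyadic arc space (\<open>continuous_arc_extension\<close>). This \<open>f\<close> maps
  \<open>D\<close> into \<open>H\<close>, as a concatenation of arcs moves along \<open>c\<close>, and closedness compares \<open>c 1\<close> with \<open>cl \<gamma>\<close>.
  
  For a metrizable \<open>X\<close>, the compact-open topology is that of uniform convergence, so the paths
  uniformly close to a given one form a countable basis at it (\<open>first_countable_path_space\<close>).
\<close>

section \<open>Homotopies of paths with fixed endpoints\<close>

definition paths_between :: "'a::topological_space set \<Rightarrow> 'a \<Rightarrow> 'a \<Rightarrow> (real \<Rightarrow> 'a) set" where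
  "paths_between X a b = {p. path p \<and> path_image p \<subseteq> X \<and> pathstart p = a \<and> pathfinish p = b}"

lemma paths_betweenI:
  "path p \<Longrightarrow> path_image p \<subseteq> X \<Longrightarrow> pathstart p = a \<Longrightarrow> pathfinish p = b \<Longrightarrow> p \<in> paths_between X a b"
  by (simp add: paths_between_def)

lemma paths_betweenD:
  assumes "p \<in> paths_between X a b"
  shows "path p" "path_image p \<subseteq> X" "pathstart p = a" "pathfinish p = b"
  using assms by (simp_all add: paths_between_def)

lemma paths_between_endpoints:
  assumes "p \<in> paths_between X a b"
  shows "a \<in> X" "b \<in> X"
  using assms pathstart_in_path_image[of p] pathfinish_in_path_image[of p]
  by (auto simp: paths_between_def)

lemma paths_between_subset: "p \<in> paths_between X a b \<Longrightarrow> X \<subseteq> Y \<Longrightarrow> p \<in> paths_between Y a b"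
  by (auto simp: paths_between_def)

lemma paths_between_join:
  "p \<in> paths_between X a b \<Longrightarrow> q \<in> paths_between X b c \<Longrightarrow> p +++ q \<in> paths_between X a c"
  by (auto simp: paths_between_def path_image_join)

lemma paths_between_reverse: "p \<in> paths_between X a b \<Longrightarrow> reversepath p \<in> paths_between X b a"
  by (auto simp: paths_between_def)

lemma paths_between_const: "a \<in> X \<Longrightarrow> (\<lambda>_. a) \<in> paths_between X a a"
  by (auto simp: paths_between_def path_def path_image_def pathstart_def pathfinish_def)

lemma paths_between_compose:
  assumes "p \<in> paths_between X a b" "continuous_on X f" "f ` X \<subseteq> Y" "a' = f a" "b' = f b"
  shows "f \<circ> p \<in> paths_between Y a' b'"
  using assms
  by (auto simp: paths_between_def path_image_compose pathstart_compose pathfinish_compose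
      intro: path_continuous_image continuous_on_subset)

lemma homotopic_paths_between:
  assumes pq: "homotopic_paths X p q" and p: "p \<in> paths_between X a b"
  shows "q \<in> paths_between X a b"
  using p homotopic_paths_imp_path[OF pq] homotopic_paths_imp_subset[OF pq]
    homotopic_paths_imp_pathstart[OF pq] homotopic_paths_imp_pathfinish[OF pq]
  by (simp add: paths_between_def)

lemma paths_between_cong:
  assumes "p \<in> paths_between X a b" "\<And>t. t \<in> {0..1} \<Longrightarrow> q t = p t"
  shows "q \<in> paths_between X a b"
proof (rule homotopic_paths_between[OF _ assms(1)])
  show "homotopic_paths X p q"
    using assms by (intro homotopic_paths_eq) (simp_all add: paths_between_def)
qed

lemma homotopic_refl: "p \<in> paths_between X a b \<Longrightarrow> homotopic_paths X p p"
  by (simp add: paths_between_def)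

lemma homotopic_assoc:
  assumes "p \<in> paths_between X a b" "q \<in> paths_between X b c" "r \<in> paths_between X c d"
  shows "homotopic_paths X (p +++ (q +++ r)) ((p +++ q) +++ r)"
  using assms by (intro homotopic_paths_assoc) (auto simp: paths_between_def)

lemma homotopic_join_cong:
  assumes "homotopic_paths X p p'" "homotopic_paths X q q'"
    "p \<in> paths_between X a b" "q \<in> paths_between X b c"
  shows "homotopic_paths X (p +++ q) (p' +++ q')"
  using assms by (intro homotopic_paths_join) (auto simp: paths_between_def)

text \<open>
  Reparametrizing a path, or inserting a detour along it and back, takes place inside the image of the
  unit interval, where any two parametrizations with the same ends are homotopic by convexity. All
  groupoid laws needed below, other than associativity, are instances of this lemma, without any linear
  structure on the space.
\<close>

lemma homotopic_within_path:
  assumes p: "path p" "path_image p \<subseteq> X"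
    and u: "u \<in> paths_between {0..1} a b" and v: "v \<in> paths_between {0..1} a b"
  shows "homotopic_paths X (p \<circ> u) (p \<circ> v)"
proof (rule homotopic_paths_continuous_image)
  show "homotopic_paths {0..1} u v"
  proof (rule homotopic_paths_linear)
    show "closed_segment (u t) (v t) \<subseteq> {0..1}" if "t \<in> {0..1}" for t
      using u v that unfolding paths_between_def path_image_def
      by (intro closed_segment_subset) (auto simp: image_subset_iff)
  qed (use u v in \<open>auto simp: paths_between_def\<close>)
  show "continuous_on {0..1} p" "p \<in> {0..1} \<rightarrow> X"
    using p by (auto simp: path_def path_image_def)
qed

text \<open>
  The segment of \<open>p\<close> from parameter \<open>a\<close> to \<open>b\<close> is written \<open>p \<circ> linepath a b\<close>: here \<open>linepath\<close> is used in
  the real parameter line only, so the target space is arbitrary, and \<open>b < a\<close> reverses the direction.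
\<close>

lemma linepath_between:
  fixes a b :: real
  assumes "a \<in> S" "b \<in> S" "convex S"
  shows "linepath a b \<in> paths_between S a b"
  using assms by (simp add: paths_between_def closed_segment_subset)

lemma segment_between:
  assumes "path p" "path_image p \<subseteq> X" "a \<in> {0..1}" "b \<in> {0..1}"
  shows "p \<circ> linepath a b \<in> paths_between X (p a) (p b)"
proof (rule paths_between_compose[OF linepath_between[of a "{0..1}" b]])
  show "continuous_on {0..1} p" "p ` {0..1} \<subseteq> X"
    using assms by (auto simp: path_def path_image_def)
qed (use assms in auto)

lemma path_as_segment: "p \<circ> linepath 0 (1::real) = p"
  by (auto simp: linepath_def)

lemma reversepath_as_segment: "p \<circ> linepath 1 (0::real) = reversepath p"
  by (auto simp: linepath_def reversepath_def)

lemma const_as_segment: "p \<circ> linepath a (a::real) = (\<lambda>_. p a)"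
  by (auto simp: linepath_def algebra_simps)

lemma segment_join:
  assumes "path p" "path_image p \<subseteq> X" "a \<in> {0..1}" "b \<in> {0..1}" "c \<in> {0..1}"
  shows "homotopic_paths X ((p \<circ> linepath a b) +++ (p \<circ> linepath b c)) (p \<circ> linepath a c)"
  unfolding path_compose_join[symmetric]
  using assms
  by (intro homotopic_within_path[where a = a and b = c] paths_between_join[where b = b] linepath_between) auto

lemma homotopic_rinv:
  assumes "p \<in> paths_between X a b"
  shows "homotopic_paths X (p +++ reversepath p) (\<lambda>_. a)"
  using segment_join[of p X 0 1 0] assms
  by (simp add: path_as_segment reversepath_as_segment const_as_segment paths_between_def pathstart_def)

lemma homotopic_linv:
  assumes "p \<in> paths_between X a b"
  shows "homotopic_paths X (reversepath p +++ p) (\<lambda>_. b)"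
  using homotopic_rinv[OF paths_between_reverse[OF assms]] by simp

lemma homotopic_rid:
  assumes "p \<in> paths_between X a b"
  shows "homotopic_paths X (p +++ (\<lambda>_. b)) p"
  using segment_join[of p X 0 1 1] assms
  by (simp add: path_as_segment const_as_segment paths_between_def pathfinish_def)

lemma homotopic_lid:
  assumes "p \<in> paths_between X a b"
  shows "homotopic_paths X ((\<lambda>_. a) +++ p) p"
  using segment_join[of p X 0 0 1] assms
  by (simp add: path_as_segment const_as_segment paths_between_def pathstart_def)

lemma homotopic_cancel_middle:
  assumes p: "p \<in> paths_between X a b" and r: "r \<in> paths_between X b c" and q: "q \<in> paths_between X b d"
  shows "homotopic_paths X ((p +++ r) +++ (reversepath r +++ q)) (p +++ q)"
proof -
  have r': "reversepath r \<in> paths_between X c b" by (rule paths_between_reverse[OF r])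
  have b: "b \<in> X" by (rule paths_between_endpoints(2)[OF p])
  have "homotopic_paths X ((p +++ r) +++ (reversepath r +++ q)) (((p +++ r) +++ reversepath r) +++ q)"
    by (rule homotopic_assoc[OF paths_between_join[OF p r] r' q])
  also have "homotopic_paths X \<dots> ((p +++ (r +++ reversepath r)) +++ q)"
    by (rule homotopic_join_cong[OF homotopic_paths_sym[OF homotopic_assoc[OF p r r']] homotopic_refl[OF q]
          paths_between_join[OF paths_between_join[OF p r] r'] q])
  also have "homotopic_paths X \<dots> ((p +++ (\<lambda>_. b)) +++ q)"
    by (rule homotopic_join_cong[OF homotopic_join_cong[OF homotopic_refl[OF p] homotopic_rinv[OF r] p
            paths_between_join[OF r r']]
          homotopic_refl[OF q] paths_between_join[OF p paths_between_join[OF r r']] q])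
  also have "homotopic_paths X \<dots> (p +++ q)"
    by (rule homotopic_join_cong[OF homotopic_rid[OF p] homotopic_refl[OF q]
          paths_between_join[OF p paths_between_const[OF b]] q])
  finally show ?thesis .
qed

lemma homotopic_cancel_right:
  assumes p: "p \<in> paths_between X a b" and r: "r \<in> paths_between X b c"
  shows "homotopic_paths X ((p +++ r) +++ reversepath r) p"
proof -
  have r': "reversepath r \<in> paths_between X c b" by (rule paths_between_reverse[OF r])
  have "homotopic_paths X ((p +++ r) +++ reversepath r) (p +++ (r +++ reversepath r))"
    by (rule homotopic_paths_sym[OF homotopic_assoc[OF p r r']])
  also have "homotopic_paths X \<dots> (p +++ (\<lambda>_. b))"
    by (rule homotopic_join_cong[OF homotopic_refl[OF p] homotopic_rinv[OF r] p paths_between_join[OF r r']])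
  also have "homotopic_paths X \<dots> p" by (rule homotopic_rid[OF p])
  finally show ?thesis .
qed

lemma based_paths_iff: "p \<in> based_paths X x0 \<longleftrightarrow> p \<in> paths_between X x0 (pathfinish p)"
  by (auto simp: based_paths_def paths_between_def)

section \<open>Path classes modulo a subgroup\<close>

locale subgroup_of_loops =
  fixes X :: "'a::topological_space set" and x0 :: 'a and H :: "(real \<Rightarrow> 'a) set set"
  assumes base: "x0 \<in> X" and sub: "subgroup H (fundamental_group X x0)"
begin

abbreviation cl :: "(real \<Rightarrow> 'a) \<Rightarrow> (real \<Rightarrow> 'a) set" where
  "cl \<equiv> subgroup_class X x0 H"

lemma const_in: "path_class X (\<lambda>_. x0) \<in> H"
  using subgroup.one_closed[OF sub] by (simp add: fundamental_group_def)

lemma mult_in: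
  assumes "p \<in> paths_between X x0 x0" "q \<in> paths_between X x0 x0"
    "path_class X p \<in> H" "path_class X q \<in> H"
  shows "path_class X (p +++ q) \<in> H"
proof -
  have "path_class X p \<otimes>\<^bsub>fundamental_group X x0\<^esub> path_class X q = path_class X (p +++ q)"
    using assms by (intro fundamental_group_mult) (auto simp: paths_between_def)
  then show ?thesis using subgroup.m_closed[OF sub assms(3,4)] by simp
qed

lemma inv_in:
  assumes p: "p \<in> paths_between X x0 x0" "path_class X p \<in> H"
  shows "path_class X (reversepath p) \<in> H"
proof -
  interpret G: group "fundamental_group X x0" by (rule group_fundamental_group[OF base])
  have r: "reversepath p \<in> paths_between X x0 x0" by (rule paths_between_reverse[OF p(1)])
  have carr: "path_class X q \<in> carrier (fundamental_group X x0)" if "q \<in> paths_between X x0 x0" for q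
    using that by (auto simp: fundamental_group_def paths_between_def)
  have "path_class X (reversepath p) \<otimes>\<^bsub>fundamental_group X x0\<^esub> path_class X p
      = path_class X (reversepath p +++ p)"
    using p r by (intro fundamental_group_mult) (auto simp: paths_between_def)
  also have "\<dots> = \<one>\<^bsub>fundamental_group X x0\<^esub>"
    using path_class_cong[OF homotopic_linv[OF p(1)]] by (simp add: fundamental_group_def)
  finally have "inv\<^bsub>fundamental_group X x0\<^esub> (path_class X p) = path_class X (reversepath p)"
    using carr p r by (intro G.inv_equality) auto
  then show ?thesis using subgroup.m_inv_closed[OF sub p(2)] by simp
qed

text \<open>
  Membership of \<open>q\<close> in \<open>cl p\<close> is an equivalence relation because \<open>H\<close> contains the trivial class and is
  closed under inverses and products; equality of classes is therefore membership.
\<close>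

lemma class_eq_iff:
  assumes p: "p \<in> paths_between X x0 a" and q: "q \<in> paths_between X x0 a"
  shows "cl p = cl q \<longleftrightarrow> path_class X (p +++ reversepath q) \<in> H"
proof -
  have diff: "r +++ reversepath s \<in> paths_between X x0 x0"
    if "r \<in> paths_between X x0 b" "s \<in> paths_between X x0 b" for r s b
    using that by (intro paths_between_join[of _ _ _ b] paths_between_reverse)
  have refl: "path_class X (r +++ reversepath r) \<in> H" if "r \<in> paths_between X x0 b" for r b
    using const_in path_class_cong[OF homotopic_rinv[OF that]] by simp
  have sym: "path_class X (s +++ reversepath r) \<in> H"
    if "r \<in> paths_between X x0 b" "s \<in> paths_between X x0 b" "path_class X (r +++ reversepath s) \<in> H" for r s b
    using inv_in[OF diff[OF that(1,2)] that(3)] that(1,2)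
    by (simp add: reversepath_joinpaths paths_between_def)
  have trans: "path_class X (r +++ reversepath t) \<in> H"
    if rst: "r \<in> paths_between X x0 b" "s \<in> paths_between X x0 b" "t \<in> paths_between X x0 b"
      and "path_class X (r +++ reversepath s) \<in> H" "path_class X (s +++ reversepath t) \<in> H" for r s t b
  proof -
    have "homotopic_paths X ((r +++ reversepath s) +++ (s +++ reversepath t)) (r +++ reversepath t)"
      using homotopic_cancel_middle[OF rst(1) paths_between_reverse[OF rst(2)] paths_between_reverse[OF rst(3)]]
      by simp
    from path_class_cong[OF this] show ?thesis
      using mult_in[OF diff[OF rst(1,2)] diff[OF rst(2,3)] that(4,5)] by simp
  qed
  have mem: "r \<in> cl s \<longleftrightarrow> r \<in> paths_between X x0 a \<and> path_class X (s +++ reversepath r) \<in> H"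
    if "s \<in> paths_between X x0 a" for r s
    using that by (auto simp: subgroup_class_def based_paths_def paths_between_def)
  show ?thesis
  proof
    assume "cl p = cl q"
    then show "path_class X (p +++ reversepath q) \<in> H"
      using mem[OF q] mem[OF p] refl[OF q] q by blast
  next
    assume pq: "path_class X (p +++ reversepath q) \<in> H"
    show "cl p = cl q"
      using mem[OF p] mem[OF q] trans[OF p q _ pq] trans[OF q p _ sym[OF p q pq]] by blast
  qed
qed

lemma class_homotopic:
  assumes pq: "homotopic_paths X p q" and p: "p \<in> paths_between X x0 a"
  shows "cl p = cl q"
proof -
  have q: "q \<in> paths_between X x0 a" using homotopic_paths_between[OF pq p] .
  have "homotopic_paths X (p +++ reversepath q) (q +++ reversepath q)"
    by (rule homotopic_join_cong[OF pq homotopic_refl p]) (rule paths_between_reverse[OF q])+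
  also have "homotopic_paths X \<dots> (\<lambda>_. x0)" by (rule homotopic_rinv[OF q])
  finally show ?thesis
    using class_eq_iff[OF p q] const_in path_class_cong[of X "p +++ reversepath q"] by simp
qed

text \<open>
  Appending the same path \<open>r\<close> to \<open>p\<close> and \<open>q\<close> leaves the loop \<open>p q\<^sup>-\<^sup>1\<close> unchanged up to homotopy. This makes
  the right action of paths on the cover space well defined.
\<close>

lemma class_append:
  assumes p: "p \<in> paths_between X x0 a" and q: "q \<in> paths_between X x0 a" and r: "r \<in> paths_between X a b"
    and eq: "cl p = cl q"
  shows "cl (p +++ r) = cl (q +++ r)"
proof -
  have "homotopic_paths X ((p +++ r) +++ (reversepath r +++ reversepath q)) (p +++ reversepath q)"
    by (rule homotopic_cancel_middle[OF p r paths_between_reverse[OF q]])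
  moreover have "reversepath (q +++ r) = reversepath r +++ reversepath q"
    using q r by (simp add: reversepath_joinpaths paths_between_def)
  ultimately have "path_class X ((p +++ r) +++ reversepath (q +++ r)) = path_class X (p +++ reversepath q)"
    by (simp add: path_class_cong)
  then show ?thesis
    using class_eq_iff[OF p q] class_eq_iff[OF paths_between_join[OF p r] paths_between_join[OF q r]] eq
    by simp
qed

lemma class_assoc:
  assumes "p \<in> paths_between X x0 a" "q \<in> paths_between X a b" "r \<in> paths_between X b c"
  shows "cl ((p +++ q) +++ r) = cl (p +++ (q +++ r))"
  by (rule class_homotopic[OF homotopic_assoc[OF assms]
        paths_between_join[OF assms(1) paths_between_join[OF assms(2,3)]], symmetric])

lemma class_append_reverse:
  assumes "p \<in> paths_between X x0 a" "r \<in> paths_between X a b"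
  shows "cl ((p +++ r) +++ reversepath r) = cl p"
  using class_homotopic[OF homotopic_paths_sym[OF homotopic_cancel_right[OF assms]] assms(1)] by simp

lemma class_append_const:
  assumes "p \<in> paths_between X x0 a"
  shows "cl (p +++ (\<lambda>_. a)) = cl p"
  using class_homotopic[OF homotopic_paths_sym[OF homotopic_rid[OF assms]] assms] by simp

lemma class_append_homotopic:
  assumes p: "p \<in> paths_between X x0 a" and q: "q \<in> paths_between X a b" and "homotopic_paths X q r"
  shows "cl (p +++ q) = cl (p +++ r)"
  by (rule class_homotopic[OF homotopic_join_cong[OF homotopic_refl[OF p] assms(3) p q] paths_between_join[OF p q]])

lemma cover_proj_class:
  assumes p: "p \<in> paths_between X x0 a"
  shows "cover_proj (cl p) = a"
proof -
  have "p \<in> cl p"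
    using p const_in path_class_cong[OF homotopic_rinv[OF p]]
    by (simp add: subgroup_class_def based_paths_def paths_between_def)
  moreover have "pathfinish q = a" if "q \<in> cl p" for q
    using that p by (auto simp: subgroup_class_def paths_between_def)
  ultimately show ?thesis
    unfolding cover_proj_def by (intro the_equality) (use p paths_betweenD(4) in blast)+
qed

end


section \<open>Paths in the cover space\<close>

lemma path_near:
  assumes g: "path g" and im: "path_image g \<subseteq> X" and t: "t \<in> {0..1}"
    and U: "openin (top_of_set X) U" "g t \<in> U"
  obtains d where "d > 0" "\<And>s. s \<in> {0..1} \<Longrightarrow> dist s t < d \<Longrightarrow> g s \<in> U"
proof -
  obtain V where V: "open V" "U = X \<inter> V" using U(1) by (auto simp: openin_open)
  obtain A where A: "open A" "t \<in> A" "\<forall>s\<in>{0..1}. s \<in> A \<longrightarrow> g s \<in> V"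
    using g t V U(2) unfolding path_def continuous_on_topological by blast
  obtain d where d: "d > 0" "\<And>s. dist s t < d \<Longrightarrow> s \<in> A"
    using A(1,2) unfolding open_dist by blast
  show thesis
  proof
    show "g s \<in> U" if s: "s \<in> {0..1}" "dist s t < d" for s
      using A(3) d(2)[OF s(2)] s(1) im V(2) by (auto simp: path_image_def)
  qed (rule d(1))
qed

lemma segment_near:
  assumes g: "path g" and t: "t \<in> {0..1}" and s: "s \<in> {0..1}" "dist s t < d"
    and near: "\<And>r. r \<in> {0..1} \<Longrightarrow> dist r t < d \<Longrightarrow> g r \<in> U"
  shows "g \<circ> linepath t s \<in> paths_between U (g t) (g s)"
proof (rule paths_between_compose[where X = "closed_segment t s"])
  have sub: "closed_segment t s \<subseteq> {0..1}" using t s by (simp add: closed_segment_subset)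
  show "linepath t s \<in> paths_between (closed_segment t s) t s" by (intro linepath_between) auto
  show "continuous_on (closed_segment t s) g" using g sub unfolding path_def by (rule continuous_on_subset)
  show "g ` closed_segment t s \<subseteq> U"
  proof safe
    fix r assume r: "r \<in> closed_segment t s"
    then have "dist r t \<le> dist s t" using dist_in_closed_segment[OF r] by (simp add: dist_commute)
    then show "g r \<in> U" using near[of r] r sub s by auto
  qed
qed auto

context subgroup_of_loops
begin

text \<open>
  A family of points is a path in the cover space as soon as each point is related to the
  nearby ones by appending a small path. The generating sets are indexed by representatives \<open>\<alpha>\<close> other
  than \<open>\<Gamma> t\<close>; associativity of appending moves the small path from one representative to the other.
\<close>

lemma pathin_class:
  assumes \<Gamma>: "\<And>t. t \<in> {0..1} \<Longrightarrow> \<Gamma> t \<in> paths_between X x0 (\<gamma> t)"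
    and loc: "\<And>t U. t \<in> {0..1} \<Longrightarrow> openin (top_of_set X) U \<Longrightarrow> \<gamma> t \<in> U \<Longrightarrow>
      \<exists>d>0. \<forall>s\<in>{0..1}. dist s t < d \<longrightarrow> (\<exists>\<epsilon>\<in>paths_between U (\<gamma> t) (\<gamma> s). cl (\<Gamma> s) = cl (\<Gamma> t +++ \<epsilon>))"
  shows "pathin (cover_space X x0 H) (\<lambda>t. cl (\<Gamma> t))"
  unfolding pathin_def cover_space_def
proof (rule continuous_on_generated_topo)
  fix N assume "N \<in> {class_nbhd X x0 H \<alpha> U |\<alpha> U. \<alpha> \<in> based_paths X x0 \<and> openin (top_of_set X) U \<and> pathfinish \<alpha> \<in> U}"
  then obtain \<alpha> U where N: "N = class_nbhd X x0 H \<alpha> U" and \<alpha>: "\<alpha> \<in> paths_between X x0 (pathfinish \<alpha>)"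
    and U: "openin (top_of_set X) U" "pathfinish \<alpha> \<in> U"
    by (auto simp: based_paths_iff)
  have UX: "U \<subseteq> X" using U(1) openin_imp_subset by blast
  show "openin (top_of_set {0..1}) ((\<lambda>t. cl (\<Gamma> t)) -` N \<inter> topspace (top_of_set {0..1}))"
    unfolding openin_euclidean_subtopology_iff
  proof (intro conjI ballI)
    fix t assume "t \<in> (\<lambda>t. cl (\<Gamma> t)) -` N \<inter> topspace (top_of_set {0..1})"
    then have t: "t \<in> {0..1}" and "cl (\<Gamma> t) \<in> N" by auto
    then obtain \<epsilon>0 where eq: "cl (\<Gamma> t) = cl (\<alpha> +++ \<epsilon>0)" and \<epsilon>0: "\<epsilon>0 \<in> paths_between U (pathfinish \<alpha>) (pathfinish \<epsilon>0)"
      unfolding N class_nbhd_def paths_between_def by auto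
    have e0: "\<epsilon>0 \<in> paths_between X (pathfinish \<alpha>) (pathfinish \<epsilon>0)" by (rule paths_between_subset[OF \<epsilon>0 UX])
    have fin: "pathfinish \<epsilon>0 = \<gamma> t"
      using cover_proj_class[OF \<Gamma>[OF t]] cover_proj_class[OF paths_between_join[OF \<alpha> e0]] eq by simp
    have "\<gamma> t \<in> U" using paths_between_endpoints(2)[OF \<epsilon>0] fin by simp
    from loc[OF t U(1) this] obtain d where d: "d > 0"
      "\<forall>s\<in>{0..1}. dist s t < d \<longrightarrow> (\<exists>\<epsilon>\<in>paths_between U (\<gamma> t) (\<gamma> s). cl (\<Gamma> s) = cl (\<Gamma> t +++ \<epsilon>))" by blast
    have "cl (\<Gamma> s) \<in> N" if s: "s \<in> {0..1}" "dist s t < d" for s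
    proof -
      obtain \<epsilon> where \<epsilon>: "\<epsilon> \<in> paths_between U (\<gamma> t) (\<gamma> s)" "cl (\<Gamma> s) = cl (\<Gamma> t +++ \<epsilon>)"
        using d(2) s by blast
      have e: "\<epsilon> \<in> paths_between X (\<gamma> t) (\<gamma> s)" by (rule paths_between_subset[OF \<epsilon>(1) UX])
      have "cl (\<Gamma> s) = cl ((\<alpha> +++ \<epsilon>0) +++ \<epsilon>)"
        unfolding \<epsilon>(2) using \<Gamma>[OF t] paths_between_join[OF \<alpha> e0, unfolded fin] e eq by (rule class_append)
      also have "\<dots> = cl (\<alpha> +++ (\<epsilon>0 +++ \<epsilon>))" using \<alpha> e0[unfolded fin] e by (rule class_assoc)
      finally have "cl (\<Gamma> s) = cl (\<alpha> +++ (\<epsilon>0 +++ \<epsilon>))" .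
      moreover have "\<epsilon>0 +++ \<epsilon> \<in> paths_between U (pathfinish \<alpha>) (\<gamma> s)"
        using \<epsilon>0[unfolded fin] \<epsilon>(1) by (rule paths_between_join)
      ultimately show ?thesis unfolding N class_nbhd_def paths_between_def by blast
    qed
    then show "\<exists>e>0. \<forall>s\<in>{0..1}. dist s t < e \<longrightarrow> s \<in> (\<lambda>t. cl (\<Gamma> t)) -` N \<inter> topspace (top_of_set {0..1})"
      using d(1) by auto
  qed auto
next
  have "cl (\<Gamma> t) \<in> class_nbhd X x0 H (\<Gamma> t) X" if t: "t \<in> {0..1}" for t
    unfolding class_nbhd_def mem_Collect_eq
  proof (intro exI conjI)
    show "cl (\<Gamma> t) = cl (\<Gamma> t +++ (\<lambda>_. \<gamma> t))" using class_append_const[OF \<Gamma>[OF t]] by simp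
  qed (use paths_betweenD[OF paths_between_const[OF paths_between_endpoints(2)[OF \<Gamma>[OF t]]]]
      paths_betweenD(4)[OF \<Gamma>[OF t]] in simp_all)
  moreover have "\<Gamma> t \<in> based_paths X x0 \<and> pathfinish (\<Gamma> t) \<in> X" if "t \<in> {0..1}" for t
    using \<Gamma>[OF that] paths_between_endpoints(2)[OF \<Gamma>[OF that]]
    by (auto simp: based_paths_def paths_between_def)
  moreover have "openin (top_of_set X) X" by simp
  ultimately have "\<exists>\<alpha> U. cl (\<Gamma> t) \<in> class_nbhd X x0 H \<alpha> U \<and> \<alpha> \<in> based_paths X x0
      \<and> openin (top_of_set X) U \<and> pathfinish \<alpha> \<in> U" if "t \<in> {0..1}" for t
    using that by blast
  then show "(\<lambda>t. cl (\<Gamma> t)) ` topspace (top_of_set {0..1})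
      \<subseteq> \<Union> {class_nbhd X x0 H \<alpha> U |\<alpha> U. \<alpha> \<in> based_paths X x0 \<and> openin (top_of_set X) U \<and> pathfinish \<alpha> \<in> U}"
    by fastforce
qed

lemma pathin_standard_lift:
  assumes \<gamma>: "path \<gamma>" "path_image \<gamma> \<subseteq> X" and \<eta>: "\<eta> \<in> paths_between X x0 (\<gamma> 0)"
  shows "pathin (cover_space X x0 H) (\<lambda>t. cl (\<eta> +++ (\<gamma> \<circ> linepath 0 t)))"
proof (rule pathin_class)
  show "\<eta> +++ (\<gamma> \<circ> linepath 0 t) \<in> paths_between X x0 (\<gamma> t)" if "t \<in> {0..1}" for t
    using that by (intro paths_between_join[OF \<eta>] segment_between \<gamma>) auto
  fix t U assume t: "t \<in> {0..1}" and U: "openin (top_of_set X) U" "\<gamma> t \<in> U"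
  obtain d where d: "d > 0" "\<And>s. s \<in> {0..1} \<Longrightarrow> dist s t < d \<Longrightarrow> \<gamma> s \<in> U"
    using path_near[OF \<gamma> t U] by blast
  have "\<exists>\<epsilon>\<in>paths_between U (\<gamma> t) (\<gamma> s).
      cl (\<eta> +++ (\<gamma> \<circ> linepath 0 s)) = cl ((\<eta> +++ (\<gamma> \<circ> linepath 0 t)) +++ \<epsilon>)"
    if s: "s \<in> {0..1}" "dist s t < d" for s
  proof (rule bexI)
    show "\<gamma> \<circ> linepath t s \<in> paths_between U (\<gamma> t) (\<gamma> s)"
      using \<gamma>(1) t s d(2) by (rule segment_near)
    have 0: "\<gamma> \<circ> linepath 0 t \<in> paths_between X (\<gamma> 0) (\<gamma> t)" "\<gamma> \<circ> linepath t s \<in> paths_between X (\<gamma> t) (\<gamma> s)"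
      using \<gamma> t s by (intro segment_between; simp)+
    have "cl ((\<eta> +++ (\<gamma> \<circ> linepath 0 t)) +++ (\<gamma> \<circ> linepath t s))
        = cl (\<eta> +++ ((\<gamma> \<circ> linepath 0 t) +++ (\<gamma> \<circ> linepath t s)))"
      by (rule class_assoc[OF \<eta> 0])
    also have "\<dots> = cl (\<eta> +++ (\<gamma> \<circ> linepath 0 s))"
      using \<gamma> t s by (intro class_append_homotopic[OF \<eta> paths_between_join[OF 0]] segment_join) auto
    finally show "cl (\<eta> +++ (\<gamma> \<circ> linepath 0 s)) = cl ((\<eta> +++ (\<gamma> \<circ> linepath 0 t)) +++ (\<gamma> \<circ> linepath t s))" ..
  qed
  then show "\<exists>d>0. \<forall>s\<in>{0..1}. dist s t < d \<longrightarrow> (\<exists>\<epsilon>\<in>paths_between U (\<gamma> t) (\<gamma> s).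
      cl (\<eta> +++ (\<gamma> \<circ> linepath 0 s)) = cl ((\<eta> +++ (\<gamma> \<circ> linepath 0 t)) +++ \<epsilon>))"
    using d(1) by blast
qed

lemma lift_value:
  assumes c: "pathin (cover_space X x0 H) c" and t: "t \<in> {0..1}"
  obtains p where "p \<in> paths_between X x0 (cover_proj (c t))" "c t = cl p"
proof -
  have "c t \<in> topspace (cover_space X x0 H)"
    using c t unfolding pathin_def continuous_map_def by auto
  then obtain \<alpha> U where \<alpha>: "\<alpha> \<in> based_paths X x0" "openin (top_of_set X) U" "c t \<in> class_nbhd X x0 H \<alpha> U"
    unfolding cover_space_def by auto
  then obtain \<epsilon> where \<epsilon>: "path \<epsilon>" "path_image \<epsilon> \<subseteq> U" "pathstart \<epsilon> = pathfinish \<alpha>" "c t = cl (\<alpha> +++ \<epsilon>)"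
    unfolding class_nbhd_def by auto
  have p: "\<alpha> +++ \<epsilon> \<in> paths_between X x0 (pathfinish \<epsilon>)"
  proof (rule paths_between_join)
    show "\<alpha> \<in> paths_between X x0 (pathfinish \<alpha>)" using \<alpha>(1) by (simp add: based_paths_iff)
    show "\<epsilon> \<in> paths_between X (pathfinish \<alpha>) (pathfinish \<epsilon>)"
      using \<epsilon> openin_imp_subset[OF \<alpha>(2)] by (auto simp: paths_between_def)
  qed
  show thesis
    using that[of "\<alpha> +++ \<epsilon>"] p cover_proj_class[OF p] \<epsilon>(4) by simp
qed

text \<open>
  The converse of the preceding criterion, for an arbitrary representative \<open>p\<close> of the point \<open>c t\<close>.
\<close>

lemma lift_near:
  assumes c: "pathin (cover_space X x0 H) c" and t: "t \<in> {0..1}"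
    and p: "p \<in> paths_between X x0 a" and ct: "c t = cl p"
    and U: "openin (top_of_set X) U" "a \<in> U"
  obtains d where "d > 0" "\<And>s. s \<in> {0..1} \<Longrightarrow> dist s t < d \<Longrightarrow>
    \<exists>\<epsilon>\<in>paths_between U a (cover_proj (c s)). c s = cl (p +++ \<epsilon>)"
proof -
  let ?N = "class_nbhd X x0 H p U"
  have UX: "U \<subseteq> X" using U(1) openin_imp_subset by blast
  have "openin (cover_space X x0 H) ?N"
    unfolding cover_space_def
    using p U by (intro topology_generated_by_Basis) (auto simp: paths_between_def based_paths_def)
  then have "openin (top_of_set {0..1}) {s \<in> {0..1}. c s \<in> ?N}"
    using c unfolding pathin_def continuous_map_def by fastforce
  moreover have "c t \<in> ?N"
    using ct class_append_const[OF p] paths_between_const[OF U(2)] p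
    unfolding class_nbhd_def paths_between_def by (auto intro!: exI[of _ "\<lambda>_. a"])
  ultimately obtain d where d: "d > 0" "\<And>s. s \<in> {0..1} \<Longrightarrow> dist s t < d \<Longrightarrow> c s \<in> ?N"
    using t unfolding openin_euclidean_subtopology_iff by auto
  show thesis
  proof
    fix s :: real assume s: "s \<in> {0..1}" "dist s t < d"
    obtain \<epsilon> where \<epsilon>: "path \<epsilon>" "path_image \<epsilon> \<subseteq> U" "pathstart \<epsilon> = pathfinish p" "c s = cl (p +++ \<epsilon>)"
      using d(2)[OF s] unfolding class_nbhd_def by auto
    have e: "\<epsilon> \<in> paths_between U a (pathfinish \<epsilon>)"
      using \<epsilon> p by (simp add: paths_between_def)
    have "cover_proj (c s) = pathfinish \<epsilon>"
      unfolding \<epsilon>(4) by (rule cover_proj_class[OF paths_between_join[OF p paths_between_subset[OF e UX]]])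
    then show "\<exists>\<epsilon>\<in>paths_between U a (cover_proj (c s)). c s = cl (p +++ \<epsilon>)"
      using e \<epsilon>(4) by metis
  qed (rule d(1))
qed

lemma path_cover_proj_lift:
  assumes c: "pathin (cover_space X x0 H) c"
  shows "path (cover_proj \<circ> c)" "path_image (cover_proj \<circ> c) \<subseteq> X"
proof -
  have inX: "cover_proj (c t) \<in> X" if t: "t \<in> {0..1}" for t
  proof -
    obtain p where p: "p \<in> paths_between X x0 (cover_proj (c t))" "c t = cl p"
      using lift_value[OF c t] .
    show ?thesis by (rule paths_between_endpoints(2)[OF p(1)])
  qed
  then show "path_image (cover_proj \<circ> c) \<subseteq> X" by (auto simp: path_image_def)
  show "path (cover_proj \<circ> c)"
    unfolding path_def continuous_on_topological
  proof (intro ballI allI impI)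
    fix t :: real and V :: "'a set" assume t: "t \<in> {0..1}" and V: "open V" "(cover_proj \<circ> c) t \<in> V"
    obtain p where p: "p \<in> paths_between X x0 (cover_proj (c t))" "c t = cl p"
      using lift_value[OF c t] .
    have U: "openin (top_of_set X) (X \<inter> V)" "cover_proj (c t) \<in> X \<inter> V"
      using V inX[OF t] by (auto simp: openin_open)
    obtain d where d: "d > 0" "\<And>s. s \<in> {0..1} \<Longrightarrow> dist s t < d \<Longrightarrow>
      \<exists>\<epsilon>\<in>paths_between (X \<inter> V) (cover_proj (c t)) (cover_proj (c s)). c s = cl (p +++ \<epsilon>)"
      using lift_near[OF c t p U] by blast
    have "(cover_proj \<circ> c) s \<in> V" if s: "s \<in> {0..1}" "s \<in> ball t d" for s
    proof -
      obtain \<epsilon> where \<epsilon>: "\<epsilon> \<in> paths_between (X \<inter> V) (cover_proj (c t)) (cover_proj (c s))"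
        using d(2)[OF s(1)] s(2) by (auto simp: dist_commute)
      show ?thesis using paths_between_endpoints(2)[OF \<epsilon>] by simp
    qed
    then have "\<forall>s\<in>{0..1}. s \<in> ball t d \<longrightarrow> (cover_proj \<circ> c) s \<in> V" by blast
    then show "\<exists>A. open A \<and> t \<in> A \<and> (\<forall>s\<in>{0..1}. s \<in> A \<longrightarrow> (cover_proj \<circ> c) s \<in> V)"
      using d(1) by (intro exI[of _ "ball t d"]) auto
  qed
qed

end


section \<open>Neighbourhoods in the path space\<close>

lemma topspace_path_space:
  "topspace (path_space X) = {p \<in> extensional {0..1}. path p \<and> path_image p \<subseteq> X}"
proof -
  have "{p \<in> extensional {0..1}. path p \<and> path_image p \<subseteq> X \<and> p ` {} \<subseteq> X}
      \<in> {{p \<in> extensional {0..1}. path p \<and> path_image p \<subseteq> X \<and> p ` K \<subseteq> U} | K U.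
      compact K \<and> K \<subseteq> {0..1} \<and> openin (top_of_set X) U}"
    by (rule CollectI, intro exI[of _ "{}"] exI[of _ X]) simp
  then show ?thesis
    unfolding path_space_def topology_generated_by_topspace by (auto simp: extensional_def)
qed

lemma restrict_in_path_space:
  assumes "path p" "path_image p \<subseteq> X"
  shows "restrict p {0..1} \<in> topspace (path_space X)"
proof -
  have "restrict p {0..1} \<in> paths_between X (p 0) (p 1)"
    by (rule paths_between_cong[of p]) (use assms in \<open>auto simp: paths_between_def pathstart_def pathfinish_def\<close>)
  then show ?thesis by (simp add: topspace_path_space paths_between_def)
qed

lemma openin_path_space_subbasic:
  assumes "compact K" "K \<subseteq> {0..1}" "openin (top_of_set X) U"
  shows "openin (path_space X) {p \<in> topspace (path_space X). p ` K \<subseteq> U}"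
  unfolding topspace_path_space unfolding path_space_def
  using assms by (intro topology_generated_by_Basis) auto

text \<open>
  A subbasic condition \<open>p ` K \<subseteq> U\<close> says that the graph of \<open>p\<close> lies in the union of \<open>(- K) \<times> UNIV\<close> and
  \<open>UNIV \<times> U\<close>, which is open because compact sets of reals are closed. Unlike membership in
  neighbourhoods of \<open>\<gamma>\<close>, conditions on the graph can be checked one parameter at a time, which is what
  the compactness arguments below need.
\<close>

lemma path_space_graph_nbhd:
  assumes W: "openin (path_space X) W" and g: "\<gamma> \<in> W"
  obtains G where "open G" "\<And>t. t \<in> {0..1} \<Longrightarrow> (t, \<gamma> t) \<in> G"
    "\<And>p. p \<in> topspace (path_space X) \<Longrightarrow> (\<And>t. t \<in> {0..1} \<Longrightarrow> (t, p t) \<in> G) \<Longrightarrow> p \<in> W"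
proof -
  have "\<exists>G. open G \<and> (\<forall>t\<in>{0..1}. (t, \<gamma> t) \<in> G) \<and>
      (\<forall>p\<in>topspace (path_space X). (\<forall>t\<in>{0..1}. (t, p t) \<in> G) \<longrightarrow> p \<in> W)"
    using W[unfolded path_space_def openin_topology_generated_by_iff] g
  proof (induction rule: generate_topology_on.induct)
    case Empty
    then show ?case by simp
  next
    case (Int a b)
    then obtain G1 G2 where
      "open G1" "\<forall>t\<in>{0..1}. (t, \<gamma> t) \<in> G1" "\<forall>p\<in>topspace (path_space X). (\<forall>t\<in>{0..1}. (t, p t) \<in> G1) \<longrightarrow> p \<in> a"
      "open G2" "\<forall>t\<in>{0..1}. (t, \<gamma> t) \<in> G2" "\<forall>p\<in>topspace (path_space X). (\<forall>t\<in>{0..1}. (t, p t) \<in> G2) \<longrightarrow> p \<in> b"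
      by auto
    then show ?case by (intro exI[of _ "G1 \<inter> G2"]) (simp add: open_Int)
  next
    case (UN K)
    then obtain k where "k \<in> K" "\<gamma> \<in> k" by blast
    with UN.IH obtain G where "open G" "\<forall>t\<in>{0..1}. (t, \<gamma> t) \<in> G"
      "\<forall>p\<in>topspace (path_space X). (\<forall>t\<in>{0..1}. (t, p t) \<in> G) \<longrightarrow> p \<in> k" by meson
    with \<open>k \<in> K\<close> show ?case by (intro exI[of _ G]) blast
  next
    case (Basis s)
    then obtain K U where s: "s = {p \<in> extensional {0..1}. path p \<and> path_image p \<subseteq> X \<and> p ` K \<subseteq> U}"
      and K: "compact K" "K \<subseteq> {0..1}" and "openin (top_of_set X) U" by blast
    then obtain V where V: "open V" "U = X \<inter> V" by (auto simp: openin_open)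
    let ?G = "((- K) \<times> UNIV) \<union> (UNIV \<times> V)"
    have "open ?G" using V(1) compact_imp_closed[OF K(1)] by (intro open_Un open_Times) auto
    moreover have "\<forall>t\<in>{0..1}. (t, \<gamma> t) \<in> ?G" using Basis(2) s V(2) by auto
    moreover have "p \<in> s" if p: "p \<in> topspace (path_space X)" "\<forall>t\<in>{0..1}. (t, p t) \<in> ?G" for p
    proof -
      have "p t \<in> U" if "t \<in> K" for t
        using that K(2) p unfolding topspace_path_space V(2) path_image_def by auto
      then show ?thesis using p(1) unfolding s topspace_path_space by auto
    qed
    ultimately show ?case by blast
  qed
  then show thesis by (elim exE conjE) (rule that; blast)
qed

text \<open>
  A decreasing neighbourhood basis \<open>W\<close> combines choices that exist eventually in each neighbourhood into one
  convergent sequence: \<open>z n\<close> is chosen in the smallest \<open>W i\<close> with \<open>i \<le> n\<close> that admits a choice. The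
  bound \<open>i \<le> n\<close> keeps the set of candidates finite, and \<open>W 0\<close> is the whole space, so that it is
  nonempty.
\<close>

lemma first_countable_sequence:
  fixes P :: "nat \<Rightarrow> 'a \<Rightarrow> bool"
  assumes fc: "first_countable Y" and y: "y \<in> topspace Y"
    and all: "\<And>n. \<exists>z\<in>topspace Y. P n z"
    and near: "\<And>W. openin Y W \<Longrightarrow> y \<in> W \<Longrightarrow> \<exists>N. \<forall>n\<ge>N. \<exists>z\<in>W. P n z"
  obtains z where "\<And>n. P n (z n)" "\<And>n. z n \<in> topspace Y"
    "\<And>W. openin Y W \<Longrightarrow> y \<in> W \<Longrightarrow> \<exists>N. \<forall>n\<ge>N. z n \<in> W"
proof -
  obtain B where B: "countable B" "\<forall>V\<in>B. openin Y V" "\<forall>U. openin Y U \<and> y \<in> U \<longrightarrow> (\<exists>V\<in>B. y \<in> V \<and> V \<subseteq> U)"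
    using bspec[OF fc[unfolded first_countable_def] y] by (elim exE conjE) (rule that)
  let ?B = "{V \<in> B. y \<in> V}"
  have "?B \<noteq> {}" using B(3) openin_topspace y by fast
  moreover have "countable ?B" by (rule countable_subset[OF _ B(1)]) auto
  ultimately obtain b :: "nat \<Rightarrow> 'a set" where b: "range b = ?B"
    using range_from_nat_into by metis
  have b_open: "openin Y (b k)" "y \<in> b k" for k using b B(2) by auto
  define W where "W i = (\<Inter>k<i. b k) \<inter> topspace Y" for i
  have W_open: "openin Y (W i)" "y \<in> W i" for i
    unfolding W_def using b_open y by (auto intro!: openin_INT)
  have W_mono: "W i \<subseteq> W j" if "j \<le> i" for i j using that unfolding W_def by auto
  define I where "I n = {i. i \<le> n \<and> (\<exists>z\<in>W i. P n z)}" for n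
  have I: "finite (I n)" "0 \<in> I n" for n
    using all[of n] unfolding I_def by (auto simp: W_def)
  have "\<exists>z\<in>W (Max (I n)). P n z" for n
    using Max_in[OF I(1)[of n]] I(2)[of n] unfolding I_def by auto
  then obtain z where z: "z n \<in> W (Max (I n))" "P n (z n)" for n by metis
  show thesis
  proof (rule that)
    show "z n \<in> topspace Y" for n using z(1)[of n] unfolding W_def by blast
    show "\<exists>N. \<forall>n\<ge>N. z n \<in> V" if V: "openin Y V" "y \<in> V" for V
    proof -
      obtain k where k: "b k \<subseteq> V" using B(3) V b by (metis (mono_tags, lifting) mem_Collect_eq rangeE)
      obtain N where N: "\<forall>n\<ge>N. \<exists>z\<in>W (Suc k). P n z" using near[OF W_open] by blast
      have "z n \<in> V" if "n \<ge> max N (Suc k)" for n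
      proof -
        have "Suc k \<in> I n" using that N unfolding I_def by auto
        then have "Suc k \<le> Max (I n)" using I(1) by simp
        then have "z n \<in> W (Suc k)" using z(1) W_mono by blast
        then show ?thesis using k unfolding W_def by blast
      qed
      then show ?thesis by blast
    qed
  qed (rule z(2))
qed

text \<open>
  The concatenation of \<open>m\<close> paths with equal speed. The minimum assigns the parameter \<open>s = 1\<close> to the last
  path instead of a path with index \<open>m\<close>.
\<close>

definition glue :: "nat \<Rightarrow> (nat \<Rightarrow> real \<Rightarrow> 'a) \<Rightarrow> real \<Rightarrow> 'a" where
  "glue m \<epsilon> s = (let j = min (nat \<lfloor>real m * s\<rfloor>) (m - 1) in \<epsilon> j (real m * s - real j))"

lemma subdivision_point:
  assumes "m > 0" "s \<in> {0..1::real}"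
  obtains j u where "j < m" "u \<in> {0..1}" "s = (real j + u) / real m"
proof
  let ?j = "min (nat \<lfloor>real m * s\<rfloor>) (m - 1)"
  have ms: "0 \<le> real m * s" "real m * s \<le> real m" using assms by (auto intro: mult_left_le)
  show "?j < m" using assms(1) by linarith
  show "s = (real ?j + (real m * s - real ?j)) / real m" using assms(1) by simp
  show "real m * s - real ?j \<in> {0..1}"
  proof (cases "real m * s < real m")
    case True
    then have "nat \<lfloor>real m * s\<rfloor> \<le> m - 1" using ms by linarith
    then have "?j = nat \<lfloor>real m * s\<rfloor>" by simp
    then show ?thesis using ms by (simp; linarith)
  next
    case False
    then have "real m * s = real m" using ms by simp
    then show ?thesis using assms(1) by (simp add: min_def of_nat_diff)
  qed
qed

lemma glue_at:
  assumes \<epsilon>: "\<And>j. j < m \<Longrightarrow> \<epsilon> j \<in> paths_between X (v j) (v (Suc j))" and j: "j < m" and u: "u \<in> {0..1}"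
  shows "glue m \<epsilon> ((real j + u) / real m) = \<epsilon> j u"
proof (cases "u < 1 \<or> Suc j = m")
  case True
  have e: "real m * ((real j + u) / real m) = real j + u" using j by simp
  have "min (nat \<lfloor>real j + u\<rfloor>) (m - 1) = j"
  proof (cases "u < 1")
    case True
    then have "\<lfloor>real j + u\<rfloor> = int j" using u by (auto simp: floor_eq_iff)
    then show ?thesis using j by simp
  next
    case False
    then have "real j + u = real (Suc j)" using u by simp
    then have "nat \<lfloor>real j + u\<rfloor> = Suc j" by (metis floor_of_nat nat_int)
    then show ?thesis using \<open>u < 1 \<or> Suc j = m\<close> False by auto
  qed
  then show ?thesis unfolding glue_def e by (simp add: Let_def)
next
  case False
  then have u1: "u = 1" and sj: "Suc j < m" using u j by auto
  have e: "real m * ((real j + u) / real m) = real (Suc j)" using j u1 by simp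
  have "min (nat \<lfloor>real (Suc j)\<rfloor>) (m - 1) = Suc j" using sj by (simp only: floor_of_nat nat_int)
  then have "glue m \<epsilon> ((real j + u) / real m) = \<epsilon> (Suc j) 0" unfolding glue_def e by (simp add: Let_def)
  also have "\<dots> = \<epsilon> j 1"
    using paths_betweenD(3)[OF \<epsilon>[OF sj]] paths_betweenD(4)[OF \<epsilon>[OF j]] by (simp add: pathstart_def pathfinish_def)
  finally show ?thesis using u1 by simp
qed

lemma path_glue:
  assumes m: "m > 0" and \<epsilon>: "\<And>j. j < m \<Longrightarrow> \<epsilon> j \<in> paths_between X (v j) (v (Suc j))"
  shows "path (glue m \<epsilon>)" "path_image (glue m \<epsilon>) \<subseteq> X"
proof -
  have at: "glue m \<epsilon> ((real j + u) / real m) = \<epsilon> j u" if "j < m" "u \<in> {0..1}" for j u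
    by (rule glue_at[where v = v, OF \<epsilon> that])
  show "path_image (glue m \<epsilon>) \<subseteq> X"
  proof (clarsimp simp: path_image_def)
    fix s :: real assume "0 \<le> s" "s \<le> 1"
    then obtain j u where "j < m" "u \<in> {0..1}" "s = (real j + u) / real m"
      using subdivision_point[OF m, of s] by auto
    then show "glue m \<epsilon> s \<in> X" using at \<epsilon>[of j] by (auto simp: paths_between_def path_image_def)
  qed
  let ?J = "\<lambda>j. {real j / real m .. (real j + 1) / real m}"
  have cover: "{0..1} = (\<Union>j\<in>{..<m}. ?J j)"
  proof
    show "{0..1} \<subseteq> (\<Union>j\<in>{..<m}. ?J j)"
    proof
      fix s :: real assume "s \<in> {0..1}"
      then obtain j u where "j < m" "u \<in> {0..1}" "s = (real j + u) / real m"
        using subdivision_point[OF m] by blast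
      then show "s \<in> (\<Union>j\<in>{..<m}. ?J j)"
        using m by (intro UN_I[of j]) (auto simp: divide_right_mono)
    qed
    show "(\<Union>j\<in>{..<m}. ?J j) \<subseteq> {0..1}"
    proof safe
      fix j s assume "j < m" "s \<in> ?J j"
      then have "real j / real m \<ge> 0" "(real j + 1) / real m \<le> 1" using m by (auto simp: divide_simps)
      then show "s \<in> {0..1}" using \<open>s \<in> ?J j\<close> order_trans unfolding atLeastAtMost_iff by blast
    qed
  qed
  show "path (glue m \<epsilon>)"
    unfolding path_def cover
  proof (rule continuous_on_closed_Union)
    fix j assume "j \<in> {..<m}"
    then have j: "j < m" by simp
    have in01: "real m * s - real j \<in> {0..1}" if "s \<in> ?J j" for s
      using that m by (auto simp: field_simps)
    have "continuous_on (?J j) (\<lambda>s. \<epsilon> j (real m * s - real j))"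
    proof (rule continuous_on_compose2[of "{0..1}" "\<epsilon> j" _ "\<lambda>s. real m * s - real j"])
      show "continuous_on {0..1} (\<epsilon> j)" using paths_betweenD(1)[OF \<epsilon>[OF j]] by (simp add: path_def)
      show "continuous_on (?J j) (\<lambda>s. real m * s - real j)" by (intro continuous_intros)
      show "(\<lambda>s. real m * s - real j) ` ?J j \<subseteq> {0..1}" using in01 by blast
    qed
    moreover have "glue m \<epsilon> s = \<epsilon> j (real m * s - real j)" if "s \<in> ?J j" for s
      using at[OF j in01[OF that]] m by simp
    ultimately show "continuous_on (?J j) (glue m \<epsilon>)" using continuous_on_eq by (metis (no_types, lifting))
  qed auto
qed

section \<open>Transport along a lift\<close>

context subgroup_of_loops
begin

text \<open>
  Paths over which the lift \<open>c\<close> moves from \<open>c r\<close> to \<open>c s\<close>. Quantifying over all representatives of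
  \<open>c r\<close> makes these sets closed under concatenation directly; by \<open>transportersI\<close> one representative
  is enough.
\<close>

definition transporters :: "(real \<Rightarrow> (real \<Rightarrow> 'a) set) \<Rightarrow> real \<Rightarrow> real \<Rightarrow> (real \<Rightarrow> 'a) set" where
  "transporters c r s = {\<epsilon> \<in> paths_between X (cover_proj (c r)) (cover_proj (c s)).
    \<forall>p\<in>paths_between X x0 (cover_proj (c r)). c r = cl p \<longrightarrow> c s = cl (p +++ \<epsilon>)}"

lemma transportersD:
  assumes "\<epsilon> \<in> transporters c r s"
  shows "\<epsilon> \<in> paths_between X (cover_proj (c r)) (cover_proj (c s))"
    "p \<in> paths_between X x0 (cover_proj (c r)) \<Longrightarrow> c r = cl p \<Longrightarrow> c s = cl (p +++ \<epsilon>)"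
  using assms by (auto simp: transporters_def)

lemma transportersI:
  assumes c: "pathin (cover_space X x0 H) c" and r: "r \<in> {0..1}"
    and \<epsilon>: "\<epsilon> \<in> paths_between X (cover_proj (c r)) (cover_proj (c s))"
    and p: "p \<in> paths_between X x0 (cover_proj (c r))" "c r = cl p" "c s = cl (p +++ \<epsilon>)"
  shows "\<epsilon> \<in> transporters c r s"
  unfolding transporters_def
proof (intro CollectI conjI ballI impI \<epsilon>)
  fix q assume "q \<in> paths_between X x0 (cover_proj (c r))" "c r = cl q"
  then show "c s = cl (q +++ \<epsilon>)" using class_append[OF p(1) _ \<epsilon>] p(2,3) by simp
qed

lemma transporters_homotopic:
  assumes \<epsilon>: "\<epsilon> \<in> transporters c r s" and h: "homotopic_paths X \<epsilon> \<delta>"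
  shows "\<delta> \<in> transporters c r s"
  unfolding transporters_def
proof (intro CollectI conjI ballI impI)
  show "\<delta> \<in> paths_between X (cover_proj (c r)) (cover_proj (c s))"
    using homotopic_paths_between[OF h transportersD(1)[OF \<epsilon>]] .
  fix q assume q: "q \<in> paths_between X x0 (cover_proj (c r))" "c r = cl q"
  then show "c s = cl (q +++ \<delta>)"
    using class_append_homotopic[OF q(1) transportersD(1)[OF \<epsilon>] h] transportersD(2)[OF \<epsilon> q] by simp
qed

lemma transporters_join:
  assumes \<epsilon>: "\<epsilon> \<in> transporters c r s" and \<delta>: "\<delta> \<in> transporters c s t"
  shows "\<epsilon> +++ \<delta> \<in> transporters c r t"
  unfolding transporters_def
proof (intro CollectI conjI ballI impI)
  note e = transportersD(1)[OF \<epsilon>] and d = transportersD(1)[OF \<delta>]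
  show "\<epsilon> +++ \<delta> \<in> paths_between X (cover_proj (c r)) (cover_proj (c t))"
    by (rule paths_between_join[OF e d])
  fix q assume q: "q \<in> paths_between X x0 (cover_proj (c r))" "c r = cl q"
  show "c t = cl (q +++ (\<epsilon> +++ \<delta>))"
    using transportersD(2)[OF \<delta> paths_between_join[OF q(1) e] transportersD(2)[OF \<epsilon> q]] class_assoc[OF q(1) e d]
    by simp
qed

lemma transporters_reverse:
  assumes c: "pathin (cover_space X x0 H) c" and r: "r \<in> {0..1}" "s \<in> {0..1}" and \<epsilon>: "\<epsilon> \<in> transporters c r s"
  shows "reversepath \<epsilon> \<in> transporters c s r"
proof -
  note e = transportersD(1)[OF \<epsilon>]
  obtain p where p: "p \<in> paths_between X x0 (cover_proj (c r))" "c r = cl p" using lift_value[OF c r(1)] .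
  show ?thesis
  proof (rule transportersI[OF c r(2)])
    show "p +++ \<epsilon> \<in> paths_between X x0 (cover_proj (c s))" by (rule paths_between_join[OF p(1) e])
    show "c s = cl (p +++ \<epsilon>)" by (rule transportersD(2)[OF \<epsilon> p])
    show "c r = cl ((p +++ \<epsilon>) +++ reversepath \<epsilon>)" using class_append_reverse[OF p(1) e] p(2) by simp
  qed (rule paths_between_reverse[OF e])
qed

text \<open>
  From \<open>c t\<close> both \<open>c r\<close> and \<open>c s\<close> are reached by small paths in \<open>V\<close>; going back along the first and
  out along the second stays in \<open>V\<close>.
\<close>

lemma transporters_near:
  assumes c: "pathin (cover_space X x0 H) c" and t: "t \<in> {0..1}" and V: "open V" "cover_proj (c t) \<in> V"
  obtains d where "d > 0" "\<And>r s. r \<in> {0..1} \<Longrightarrow> s \<in> {0..1} \<Longrightarrow> dist r t < d \<Longrightarrow> dist s t < d \<Longrightarrow>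
    \<exists>\<epsilon>\<in>transporters c r s. path_image \<epsilon> \<subseteq> V"
proof -
  obtain p where p: "p \<in> paths_between X x0 (cover_proj (c t))" "c t = cl p" using lift_value[OF c t] .
  have U: "openin (top_of_set X) (X \<inter> V)" "cover_proj (c t) \<in> X \<inter> V"
    using V paths_between_endpoints(2)[OF p(1)] by (auto simp: openin_open)
  obtain d where d: "d > 0" "\<And>s. s \<in> {0..1} \<Longrightarrow> dist s t < d \<Longrightarrow>
      \<exists>\<epsilon>\<in>paths_between (X \<inter> V) (cover_proj (c t)) (cover_proj (c s)). c s = cl (p +++ \<epsilon>)"
    using lift_near[OF c t p U] by blast
  have from_t: "\<exists>\<epsilon>\<in>transporters c t s. \<epsilon> \<in> paths_between (X \<inter> V) (cover_proj (c t)) (cover_proj (c s))"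
    if s: "s \<in> {0..1}" "dist s t < d" for s
  proof -
    obtain \<epsilon> where \<epsilon>: "\<epsilon> \<in> paths_between (X \<inter> V) (cover_proj (c t)) (cover_proj (c s))" "c s = cl (p +++ \<epsilon>)"
      using d(2)[OF s] by blast
    then show ?thesis
      using transportersI[OF c t paths_between_subset[OF \<epsilon>(1)] p \<epsilon>(2)] by blast
  qed
  show thesis
  proof
    fix r s assume rs: "r \<in> {0..1::real}" "s \<in> {0..1}" "dist r t < d" "dist s t < d"
    obtain \<epsilon> where \<epsilon>: "\<epsilon> \<in> transporters c t r" "\<epsilon> \<in> paths_between (X \<inter> V) (cover_proj (c t)) (cover_proj (c r))"
      using from_t rs by blast
    obtain \<delta> where \<delta>: "\<delta> \<in> transporters c t s" "\<delta> \<in> paths_between (X \<inter> V) (cover_proj (c t)) (cover_proj (c s))"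
      using from_t rs by blast
    have "reversepath \<epsilon> +++ \<delta> \<in> transporters c r s"
      by (rule transporters_join[OF transporters_reverse[OF c t rs(1) \<epsilon>(1)] \<delta>(1)])
    moreover have "path_image (reversepath \<epsilon> +++ \<delta>) \<subseteq> V"
      using paths_betweenD(2)[OF paths_between_join[OF paths_between_reverse[OF \<epsilon>(2)] \<delta>(2)]] by simp
    ultimately show "\<exists>\<epsilon>\<in>transporters c r s. path_image \<epsilon> \<subseteq> V" by blast
  qed (rule d(1))
qed

lemma transporters_nonempty:
  assumes c: "pathin (cover_space X x0 H) c" and r: "r \<in> {0..1}" and s: "s \<in> {0..1}"
  shows "\<exists>\<epsilon>. \<epsilon> \<in> transporters c r s"
proof -
  obtain p where p: "p \<in> paths_between X x0 (cover_proj (c r))" "c r = cl p" using lift_value[OF c r] .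
  obtain q where q: "q \<in> paths_between X x0 (cover_proj (c s))" "c s = cl q" using lift_value[OF c s] .
  note p' = paths_between_reverse[OF p(1)]
  have "homotopic_paths X (p +++ (reversepath p +++ q)) ((p +++ reversepath p) +++ q)"
    by (rule homotopic_assoc[OF p(1) p' q(1)])
  also have "homotopic_paths X \<dots> ((\<lambda>_. x0) +++ q)"
    by (rule homotopic_join_cong[OF homotopic_rinv[OF p(1)] homotopic_refl[OF q(1)] paths_between_join[OF p(1) p'] q(1)])
  also have "homotopic_paths X \<dots> q" by (rule homotopic_lid[OF q(1)])
  finally have "cl (p +++ (reversepath p +++ q)) = cl q"
    using class_homotopic[OF _ paths_between_join[OF p(1) paths_between_join[OF p' q(1)]]] by blast
  then have "reversepath p +++ q \<in> transporters c r s"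
    by (intro transportersI[OF c r paths_between_join[OF p' q(1)] p]) (simp add: q(2))
  then show ?thesis by blast
qed

text \<open>
  Around each \<open>t\<close> the graph condition that defines \<open>W\<close> contains a box \<open>ball t d \<times> V\<close> over which
  transport is possible inside \<open>V\<close>. As soon as \<open>1 / 2 ^ n\<close> is below the Lebesgue number of these
  balls, each interval of the subdivision lies in one of them, so that the transporting path over
  it can be taken inside the corresponding \<open>V\<close>.
\<close>

lemma transporters_approximation:
  assumes c: "pathin (cover_space X x0 H) c"
    and W: "openin (path_space X) W" "restrict (cover_proj \<circ> c) {0..1} \<in> W"
  shows "\<exists>N. \<forall>n\<ge>N. \<exists>\<epsilon>. (\<forall>j<2 ^ n. \<epsilon> j \<in> transporters c (real j / 2 ^ n) (real (Suc j) / 2 ^ n)) \<and>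
    restrict (glue (2 ^ n) \<epsilon>) {0..1} \<in> W"
proof -
  obtain G where G: "open G" "\<And>t. t \<in> {0..1} \<Longrightarrow> (t, restrict (cover_proj \<circ> c) {0..1} t) \<in> G"
    "\<And>p. p \<in> topspace (path_space X) \<Longrightarrow> (\<And>t. t \<in> {0..1} \<Longrightarrow> (t, p t) \<in> G) \<Longrightarrow> p \<in> W"
    using path_space_graph_nbhd[OF W] by blast
  have "\<exists>d>0. \<exists>V. ball t d \<times> V \<subseteq> G \<and> (\<forall>r\<in>{0..1}. \<forall>s\<in>{0..1}. dist r t < d \<longrightarrow> dist s t < d \<longrightarrow>
      (\<exists>\<epsilon>\<in>transporters c r s. path_image \<epsilon> \<subseteq> V))" if t: "t \<in> {0..1}" for t
  proof -
    have "(t, cover_proj (c t)) \<in> G" using G(2)[OF t] t by simp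
    then obtain A V where AV: "open A" "open V" "t \<in> A" "cover_proj (c t) \<in> V" "A \<times> V \<subseteq> G"
      using open_prod_elim[OF G(1)] by (metis mem_Times_iff fst_conv snd_conv)
    obtain d1 where d1: "d1 > 0" "ball t d1 \<subseteq> A" using AV(1,3) open_contains_ball by blast
    obtain d2 where d2: "d2 > 0" "\<And>r s. r \<in> {0..1} \<Longrightarrow> s \<in> {0..1} \<Longrightarrow> dist r t < d2 \<Longrightarrow> dist s t < d2 \<Longrightarrow>
      \<exists>\<epsilon>\<in>transporters c r s. path_image \<epsilon> \<subseteq> V"
      using transporters_near[OF c t AV(2,4)] by blast
    have "ball t (min d1 d2) \<times> V \<subseteq> G" using d1(2) AV(5) by auto
    then show ?thesis using d1(1) d2 by (intro exI[of _ "min d1 d2"] conjI exI[of _ V]) auto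
  qed
  then obtain d V where dV: "\<And>t. t \<in> {0..1} \<Longrightarrow> d t > 0" "\<And>t. t \<in> {0..1} \<Longrightarrow> ball t (d t) \<times> V t \<subseteq> G"
    "\<And>t r s. t \<in> {0..1} \<Longrightarrow> r \<in> {0..1} \<Longrightarrow> s \<in> {0..1} \<Longrightarrow> dist r t < d t \<Longrightarrow> dist s t < d t \<Longrightarrow>
      \<exists>\<epsilon>\<in>transporters c r s. path_image \<epsilon> \<subseteq> V t" by metis
  obtain e where e: "e > 0" "\<And>x. x \<in> {0..1} \<Longrightarrow> \<exists>t\<in>{0..1}. ball x e \<subseteq> ball t (d t)"
  proof (rule Heine_Borel_lemma[of "{0..1::real}" "(\<lambda>t. ball t (d t)) ` {0..1}"])
    show "{0..1} \<subseteq> \<Union> ((\<lambda>t. ball t (d t)) ` {0..1})" using dV(1) by fastforce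
  qed auto
  obtain N where N: "(1 / 2) ^ N < e" using real_arch_pow_inv[OF e(1), of "1/2"] by auto
  show ?thesis
  proof (rule exI[of _ N], intro allI impI)
    fix n assume n: "n \<ge> N"
    have small: "1 / 2 ^ n < e"
      using power_decreasing[OF n, of "1 / 2 :: real"] N by (simp add: power_one_over)
    have "\<exists>\<epsilon>\<in>transporters c (real j / 2 ^ n) (real (Suc j) / 2 ^ n). \<forall>u\<in>{0..1}. ((real j + u) / 2 ^ n, \<epsilon> u) \<in> G"
      if j: "j < 2 ^ n" for j
    proof -
      have "real j < 2 ^ n" using j by (metis of_nat_less_iff of_nat_numeral of_nat_power)
      moreover have "real (Suc j) \<le> 2 ^ n" using j by (metis Suc_leI of_nat_le_iff of_nat_numeral of_nat_power)
      ultimately have I: "real j / 2 ^ n \<in> {0..1}" "real (Suc j) / 2 ^ n \<in> {0..1}" by auto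
      obtain t where t: "t \<in> {0..1}" "ball (real j / 2 ^ n) e \<subseteq> ball t (d t)" using e(2)[OF I(1)] by blast
      have near: "(real j + u) / 2 ^ n \<in> ball t (d t)" if "u \<in> {0..1}" for u
      proof -
        have "u / 2 ^ n \<le> 1 / 2 ^ n" using that by (simp add: divide_right_mono)
        then have "dist (real j / 2 ^ n) ((real j + u) / 2 ^ n) < e"
          using small that by (simp add: dist_real_def add_divide_distrib)
        then show ?thesis using t(2) by auto
      qed
      obtain \<epsilon> where \<epsilon>: "\<epsilon> \<in> transporters c (real j / 2 ^ n) (real (Suc j) / 2 ^ n)" "path_image \<epsilon> \<subseteq> V t"
        using dV(3)[OF t(1) I] near[of 0] near[of 1] by (auto simp: dist_commute add.commute)
      have "((real j + u) / 2 ^ n, \<epsilon> u) \<in> G" if u: "u \<in> {0..1}" for u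
      proof (rule subsetD[OF dV(2)[OF t(1)] SigmaI[OF near[OF u]]])
        show "\<epsilon> u \<in> V t" using \<epsilon>(2) u unfolding path_image_def by blast
      qed
      then show ?thesis using \<epsilon>(1) by blast
    qed
    then obtain \<epsilon> where \<epsilon>: "\<And>j. j < 2 ^ n \<Longrightarrow> \<epsilon> j \<in> transporters c (real j / 2 ^ n) (real (Suc j) / 2 ^ n)"
      "\<And>j u. j < 2 ^ n \<Longrightarrow> u \<in> {0..1} \<Longrightarrow> ((real j + u) / 2 ^ n, \<epsilon> j u) \<in> G" by metis
    have between: "\<epsilon> j \<in> paths_between X (cover_proj (c (real j / 2 ^ n))) (cover_proj (c (real (Suc j) / 2 ^ n)))"
      if "j < 2 ^ n" for j by (rule transportersD(1)[OF \<epsilon>(1)[OF that]])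
    have "restrict (glue (2 ^ n) \<epsilon>) {0..1} \<in> W"
    proof (rule G(3))
      show "restrict (glue (2 ^ n) \<epsilon>) {0..1} \<in> topspace (path_space X)"
        by (intro restrict_in_path_space path_glue[where X = X and v = "\<lambda>j. cover_proj (c (real j / 2 ^ n))"] between) auto
      fix t :: real assume t: "t \<in> {0..1}"
      obtain j u where ju: "j < 2 ^ n" "u \<in> {0..1}" "t = (real j + u) / real (2 ^ n)"
        using subdivision_point[OF _ t, of "2 ^ n"] by auto
      have "glue (2 ^ n) \<epsilon> t = \<epsilon> j u"
        unfolding ju(3) by (rule glue_at[where v = "\<lambda>j. cover_proj (c (real j / 2 ^ n))", OF between ju(1,2)])
      then show "(t, restrict (glue (2 ^ n) \<epsilon>) {0..1} t) \<in> G"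
        using \<epsilon>(2)[OF ju(1,2)] ju(3) t by simp
    qed
    then show "\<exists>\<epsilon>. (\<forall>j<2 ^ n. \<epsilon> j \<in> transporters c (real j / 2 ^ n) (real (Suc j) / 2 ^ n)) \<and>
      restrict (glue (2 ^ n) \<epsilon>) {0..1} \<in> W" using \<epsilon>(1) by blast
  qed
qed

end


section \<open>The dyadic arc space\<close>

definition arc_level :: "nat \<Rightarrow> (real \<times> real) set" where
  "arc_level N = (\<Union>j\<in>{1..2 ^ N}. dyadic_arc (Suc N) j)"

lemma dyadic_arc_space_levels: "dyadic_arc_space = {0..1} \<times> {0} \<union> (\<Union>N. arc_level N)"
proof -
  have "(\<Union>n\<in>{1..}. \<Union>j\<in>{1..2 ^ (n - 1)}. dyadic_arc n j) = (\<Union>n\<in>range Suc. \<Union>j\<in>{1..2 ^ (n - 1)}. dyadic_arc n j)"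
    using greaterThan_0 atLeast_Suc_greaterThan[of 0] by simp
  also have "\<dots> = (\<Union>N. arc_level N)" by (simp add: arc_level_def)
  finally show ?thesis unfolding dyadic_arc_space_def by simp
qed

text \<open>
  Levels are numbered from \<open>0\<close>, and so are the arcs of a level: the arc with parameters \<open>Suc N\<close> and
  \<open>Suc j\<close> stands over \<open>[j / 2 ^ N, (j + 1) / 2 ^ N]\<close>, and the height over \<open>x\<close> is the geometric mean of
  the distances from \<open>x\<close> to the two ends.
\<close>

lemma dyadic_arc_iff:
  "(x, y) \<in> dyadic_arc (Suc N) (Suc j) \<longleftrightarrow>
    y \<ge> 0 \<and> y\<^sup>2 = (x - real j / 2 ^ N) * (real (Suc j) / 2 ^ N - x)"
proof -
  define a b :: real where "a = real j / 2 ^ N" and "b = real (Suc j) / 2 ^ N"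
  have mid: "(2 * real (Suc j) - 1) / 2 ^ Suc N = (a + b) / 2" and rad: "1 / 2 ^ Suc N = (b - a) / 2"
    unfolding a_def b_def by (simp_all add: field_simps)
  have "(x - (a + b) / 2)\<^sup>2 + y\<^sup>2 = ((b - a) / 2)\<^sup>2 \<longleftrightarrow> y\<^sup>2 = (x - a) * (b - x)"
    by (auto simp: power2_eq_square field_simps)
  then show ?thesis unfolding dyadic_arc_def mem_Collect_eq case_prod_conv mid rad by (simp add: a_def b_def conj_commute)
qed

lemma arc_path_eq:
  "arc_path (Suc N) (Suc j) t = ((real j + t) / 2 ^ N, sqrt (t - t\<^sup>2) / 2 ^ N)"
  by (simp add: arc_path_def add.commute)

lemma arc_path_in_level:
  assumes "j < 2 ^ N" "u \<in> {0..1}"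
  shows "arc_path (Suc N) (Suc j) u \<in> arc_level N"
proof -
  have "0 \<le> u * (1 - u)" using assms(2) by simp
  then have "0 \<le> u - u\<^sup>2" by (simp add: power2_eq_square algebra_simps)
  then have "(sqrt (u - u\<^sup>2) / 2 ^ N)\<^sup>2 = ((real j + u) / 2 ^ N - real j / 2 ^ N) * (real (Suc j) / 2 ^ N - (real j + u) / 2 ^ N)"
    "0 \<le> sqrt (u - u\<^sup>2) / 2 ^ N"
    by (simp_all add: power_divide diff_divide_distrib[symmetric] power2_eq_square algebra_simps)
  then have "arc_path (Suc N) (Suc j) u \<in> dyadic_arc (Suc N) (Suc j)"
    unfolding arc_path_eq dyadic_arc_iff by simp
  then show ?thesis unfolding arc_level_def using assms(1) by (intro UN_I[of "Suc j"]) auto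
qed

lemma arc_level_point:
  assumes "z \<in> arc_level N"
  obtains j u where "j < 2 ^ N" "u \<in> {0..1}" "z = arc_path (Suc N) (Suc j) u"
proof -
  obtain x y where z: "z = (x, y)" by (cases z)
  obtain i where "i \<in> {1..2 ^ N}" "(x, y) \<in> dyadic_arc (Suc N) i"
    using assms unfolding arc_level_def z by blast
  then obtain j where j: "j < 2 ^ N" "(x, y) \<in> dyadic_arc (Suc N) (Suc j)"
    by (cases i) (auto simp: Suc_le_eq)
  define u where "u = 2 ^ N * x - real j"
  have x: "x = (real j + u) / 2 ^ N" unfolding u_def by simp
  have y: "0 \<le> y" "y\<^sup>2 = (x - real j / 2 ^ N) * (real (Suc j) / 2 ^ N - x)"
    using j(2) dyadic_arc_iff by blast+
  have xa: "x - real j / 2 ^ N = u / 2 ^ N" "real (Suc j) / 2 ^ N - x = (1 - u) / 2 ^ N"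
    unfolding x by (simp_all add: field_simps)
  have y2: "y\<^sup>2 = (u - u\<^sup>2) / (2 ^ N)\<^sup>2"
    unfolding y(2) xa by (simp add: power2_eq_square algebra_simps)
  then have "y = sqrt ((u - u\<^sup>2) / (2 ^ N)\<^sup>2)" using y(1) by (metis real_sqrt_unique)
  then have y': "y = sqrt (u - u\<^sup>2) / 2 ^ N" by (simp add: real_sqrt_divide)
  have "u * (1 - u) = u - u\<^sup>2" by (simp add: power2_eq_square algebra_simps)
  also have "\<dots> = (2 ^ N * y)\<^sup>2" unfolding power_mult_distrib y2 by simp
  finally have "u * (1 - u) \<ge> 0" by simp
  then have "u \<in> {0..1}" by (auto simp: zero_le_mult_iff)
  then show thesis using that[OF j(1)] x y' z by (simp add: arc_path_eq)
qed

lemma arc_level_bounds: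
  assumes "z \<in> arc_level N"
  shows "fst z \<in> {0..1}" "0 \<le> snd z" "snd z \<le> 1 / 2 ^ N"
proof -
  obtain j u where ju: "j < 2 ^ N" "u \<in> {0..1}" and z: "z = arc_path (Suc N) (Suc j) u"
    using arc_level_point[OF assms] .
  have "real (Suc j) \<le> 2 ^ N" using ju(1) by (metis Suc_leI of_nat_le_iff of_nat_numeral of_nat_power)
  then show "fst z \<in> {0..1}" using ju(2) unfolding z arc_path_eq by (auto simp: divide_simps)
  have u: "0 \<le> u - u\<^sup>2" "u - u\<^sup>2 \<le> 1"
    using ju(2) mult_left_le[of u u] by (auto simp: power2_eq_square intro: order_trans[of _ u 1])
  then show "0 \<le> snd z" "snd z \<le> 1 / 2 ^ N"
    unfolding z arc_path_eq by (auto simp: divide_right_mono)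
qed

lemma dyadic_arc_space_bounds:
  assumes "z \<in> dyadic_arc_space"
  shows "fst z \<in> {0..1}" "0 \<le> snd z"
proof -
  consider "z \<in> {0..1} \<times> {0}" | N where "z \<in> arc_level N"
    using assms unfolding dyadic_arc_space_levels by blast
  then have "fst z \<in> {0..1} \<and> 0 \<le> snd z"
    by cases (use arc_level_bounds in auto)
  then show "fst z \<in> {0..1}" "0 \<le> snd z" by blast+
qed

lemma arc_level_base_point:
  assumes "z \<in> arc_level N" "snd z = 0"
  obtains j where "j \<le> 2 ^ N" "z = (real j / 2 ^ N, 0)"
proof -
  obtain j u where ju: "j < 2 ^ N" "u \<in> {0..1}" and z: "z = arc_path (Suc N) (Suc j) u"
    using arc_level_point[OF assms(1)] .
  have "u - u\<^sup>2 = 0" using assms(2) unfolding z arc_path_eq by simp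
  then have "u * (1 - u) = 0" by (simp add: power2_eq_square algebra_simps)
  then consider "u = 0" | "u = 1" by auto
  then show thesis
  proof cases
    case 1 then show thesis using that[of j] ju(1) z by (simp add: arc_path_eq)
  next
    case 2 then show thesis using that[of "Suc j"] ju(1) z by (simp add: arc_path_eq add.commute)
  qed
qed

lemma closed_arc_level: "closed (arc_level N)"
  unfolding arc_level_def
proof (intro closed_UN ballI)
  fix j
  have "dyadic_arc (Suc N) j
      = {z. (fst z - (2 * real j - 1) / 2 ^ Suc N)\<^sup>2 + (snd z)\<^sup>2 = (1 / 2 ^ Suc N)\<^sup>2} \<inter> {z. 0 \<le> snd z}"
    unfolding dyadic_arc_def by auto
  also have "closed \<dots>"
    by (intro closed_Int closed_Collect_eq closed_Collect_le continuous_intros)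
  finally show "closed (dyadic_arc (Suc N) j)" .
qed auto

text \<open>
  Dyadic intervals of different levels that share an interior point are nested, with at least
  one end moved strictly inwards. This strictly decreases the product of the distances to the ends, so
  arcs of different levels meet on the base only.
\<close>

lemma arc_level_unique:
  assumes "z \<in> arc_level N" "z \<in> arc_level M" "snd z > 0"
  shows "N = M"
proof -
  have False if zN: "z \<in> arc_level N" and zM: "z \<in> arc_level M" and less: "N < M" for N M
  proof -
    obtain x y where z: "z = (x, y)" by (cases z)
    have data: "\<exists>j::nat. real j / 2 ^ K < x \<and> x < real (Suc j) / 2 ^ K \<and> y\<^sup>2 = (x - real j / 2 ^ K) * (real (Suc j) / 2 ^ K - x)"
      if zK: "z \<in> arc_level K" for K
    proof -
      obtain j where "(x, y) \<in> dyadic_arc (Suc K) (Suc j)"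
        using zK unfolding arc_level_def z by (metis UN_E atLeastAtMost_iff not0_implies_Suc not_one_le_zero)
      then have y: "y\<^sup>2 = (x - real j / 2 ^ K) * (real (Suc j) / 2 ^ K - x)" by (simp add: dyadic_arc_iff)
      have "y\<^sup>2 > 0" using assms(3) z by simp
      moreover have "real j / 2 ^ K < real (Suc j) / 2 ^ K" by (simp add: divide_strict_right_mono)
      ultimately show ?thesis using y unfolding y zero_less_mult_iff by (intro exI[of _ j]) auto
    qed
    obtain j k :: nat where j: "real j / 2 ^ N < x" "x < real (Suc j) / 2 ^ N" "y\<^sup>2 = (x - real j / 2 ^ N) * (real (Suc j) / 2 ^ N - x)"
      and k: "real k / 2 ^ M < x" "x < real (Suc k) / 2 ^ M" "y\<^sup>2 = (x - real k / 2 ^ M) * (real (Suc k) / 2 ^ M - x)"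
      using data[OF zN] data[OF zM] by blast
    \<comment> \<open>One interval of level \<open>N\<close> consists of \<open>w\<close> intervals of level \<open>M\<close>.\<close>
    define w :: nat where "w = 2 ^ (M - N)"
    have w: "(2::real) ^ M = 2 ^ N * real w" "w \<ge> 2"
    proof -
      show "(2::real) ^ M = 2 ^ N * real w" using less by (simp add: w_def power_add[symmetric])
      have "(2::nat) ^ 1 \<le> 2 ^ (M - N)" using less by (intro power_increasing) auto
      then show "w \<ge> 2" by (simp add: w_def)
    qed
    have rescale: "real i / 2 ^ N = real (i * w) / 2 ^ M" for i using w by simp
    have "real (j * w) / 2 ^ M < real (Suc k) / 2 ^ M" "real k / 2 ^ M < real (Suc j * w) / 2 ^ M"
      using j k unfolding rescale by linarith+
    then have "j * w < Suc k" "k < Suc j * w" by (simp_all only: divide_less_cancel of_nat_less_iff) auto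
    then have le: "j * w \<le> k" "Suc k \<le> Suc j * w" by simp_all
    then have a: "real j / 2 ^ N \<le> real k / 2 ^ M" and b: "real (Suc k) / 2 ^ M \<le> real (Suc j) / 2 ^ N"
      unfolding rescale by (simp_all only: divide_right_mono of_nat_le_iff zero_le_power zero_le_numeral)
    have "real j / 2 ^ N < real k / 2 ^ M \<or> real (Suc k) / 2 ^ M < real (Suc j) / 2 ^ N"
    proof (rule ccontr)
      assume "\<not> ?thesis"
      then have "real j / 2 ^ N = real k / 2 ^ M" "real (Suc k) / 2 ^ M = real (Suc j) / 2 ^ N" using a b by auto
      then have "real (Suc j) / 2 ^ N - real j / 2 ^ N = real (Suc k) / 2 ^ M - real k / 2 ^ M" by simp
      then have "1 / 2 ^ N = (1 / 2 ^ M :: real)" by (simp add: diff_divide_distrib[symmetric])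
      then show False using less by simp
    qed
    then have "(x - real k / 2 ^ M) * (real (Suc k) / 2 ^ M - x) < (x - real j / 2 ^ N) * (real (Suc j) / 2 ^ N - x)"
    proof
      assume "real j / 2 ^ N < real k / 2 ^ M"
      then show ?thesis using a b j k by (intro mult_less_le_imp_less) auto
    next
      assume "real (Suc k) / 2 ^ M < real (Suc j) / 2 ^ N"
      then show ?thesis using a b j k by (intro mult_le_less_imp_less) auto
    qed
    then show False using j(3) k(3) by simp
  qed
  then show ?thesis using assms by (meson linorder_neqE_nat)
qed

lemma dyadic_in_unit: "j \<le> 2 ^ N \<Longrightarrow> real j / 2 ^ N \<in> {0..1}"
  by (metis atLeastAtMost_iff divide_le_eq_1_pos divide_nonneg_nonneg of_nat_0_le_iff of_nat_le_iff
      of_nat_numeral of_nat_power zero_le_numeral zero_le_power zero_less_numeral zero_less_power)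

lemma arc_path_between:
  assumes "j < 2 ^ N"
  shows "arc_path (Suc N) (Suc j) \<in> paths_between dyadic_arc_space (real j / 2 ^ N, 0) (real (Suc j) / 2 ^ N, 0)"
proof (rule paths_betweenI)
  show "path (arc_path (Suc N) (Suc j))"
    unfolding path_def arc_path_eq by (intro continuous_intros) auto
  show "path_image (arc_path (Suc N) (Suc j)) \<subseteq> dyadic_arc_space"
    using arc_path_in_level[OF assms] unfolding path_image_def dyadic_arc_space_levels by blast
qed (simp_all add: arc_path_eq pathstart_def pathfinish_def add.commute)

lemma base_path_between: "base_path \<in> paths_between dyadic_arc_space (0, 0) (1, 0)"
  by (rule paths_betweenI)
    (auto simp: base_path_def path_def path_image_def dyadic_arc_space_def pathstart_def pathfinish_def
      intro!: continuous_intros)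

lemma standard_path_cases:
  assumes "standard_path p"
  obtains N j where "j < 2 ^ N" "p = arc_path (Suc N) (Suc j)"
  | N j where "j < 2 ^ N" "p = reversepath (arc_path (Suc N) (Suc j))"
  using assms
proof cases
  case (1 n j)
  then show thesis using that(1)[of "j - 1" "n - 1"] by auto
next
  case (2 n j)
  then show thesis using that(2)[of "j - 1" "n - 1"] by auto
qed

lemma standard_path_between:
  assumes "standard_path p"
  obtains u v where "u \<in> {0..1}" "v \<in> {0..1}" "p \<in> paths_between dyadic_arc_space (u, 0) (v, 0)"
  using assms
proof (cases rule: standard_path_cases)
  case (1 N j)
  then show thesis
    using that[OF dyadic_in_unit dyadic_in_unit, of j N "Suc j" N] arc_path_between[OF 1(1)] by simp
next
  case (2 N j)
  then show thesis
    using that[OF dyadic_in_unit dyadic_in_unit, of "Suc j" N j N] paths_between_reverse[OF arc_path_between[OF 2(1)]]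
    by simp
qed

lemma standard_concat_between:
  assumes "standard_concat p"
  shows "\<exists>u\<in>{0..1}. \<exists>v\<in>{0..1}. p \<in> paths_between dyadic_arc_space (u, 0) (v, 0)"
  using assms
proof induction
  case (1 p)
  then show ?case using standard_path_between by metis
next
  case (2 p q)
  obtain u v where u: "u \<in> {0..1}" "v \<in> {0..1}" "p \<in> paths_between dyadic_arc_space (u, 0) (v, 0)"
    using standard_path_between[OF 2(1)] .
  obtain v' w where w: "w \<in> {0..1}" "q \<in> paths_between dyadic_arc_space (v', 0) (w, 0)" using 2(4) by blast
  have "(v', 0) = (v, 0)" using 2(3) paths_betweenD(4)[OF u(3)] paths_betweenD(3)[OF w(2)] by simp
  then show ?case using paths_between_join[OF u(3)] u(1) w by metis
qed


section \<open>Closedness implies unique path lifting\<close>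

text \<open>
  The map is \<open>\<gamma>\<close> on the base and, on level \<open>N\<close>, the glued path of level \<open>N\<close> at the first coordinate.
  Away from the base only finitely many closed levels come close to a point. At a
  base point, finitely many levels are treated one by one, and all others at once by
  convergence in the compact-open topology, applied to a small closed interval around the point.
\<close>

lemma continuous_arc_extension:
  fixes \<gamma> :: "real \<Rightarrow> 'a::topological_space"
  assumes \<gamma>: "path \<gamma>" "path_image \<gamma> \<subseteq> X"
    and \<epsilon>: "\<And>N j. j < 2 ^ N \<Longrightarrow> \<epsilon> N j \<in> paths_between X (\<gamma> (real j / 2 ^ N)) (\<gamma> (real (Suc j) / 2 ^ N))"
    and conv: "\<And>W. openin (path_space X) W \<Longrightarrow> restrict \<gamma> {0..1} \<in> W \<Longrightarrow>
      \<exists>N0. \<forall>N\<ge>N0. restrict (glue (2 ^ N) (\<epsilon> N)) {0..1} \<in> W"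
  obtains f where "continuous_on dyadic_arc_space f" "f ` dyadic_arc_space \<subseteq> X"
    "\<And>x. x \<in> {0..1} \<Longrightarrow> f (x, 0) = \<gamma> x"
    "\<And>N j u. j < 2 ^ N \<Longrightarrow> u \<in> {0..1} \<Longrightarrow> f (arc_path (Suc N) (Suc j) u) = \<epsilon> N j u"
proof -
  let ?g = "\<lambda>N. glue (2 ^ N) (\<epsilon> N)"
  define f where "f z = (if snd z = 0 then \<gamma> (fst z) else ?g (SOME N. z \<in> arc_level N) (fst z))" for z
  have glue: "?g N ((real j + u) / 2 ^ N) = \<epsilon> N j u" if "j < 2 ^ N" "u \<in> {0..1}" for N j u
    using glue_at[where v = "\<lambda>j. \<gamma> (real j / 2 ^ N)" and m = "2 ^ N" and \<epsilon> = "\<epsilon> N" and X = X, OF \<epsilon> that] by simp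
  have g_path: "path (?g N)" "path_image (?g N) \<subseteq> X" for N
    by (intro path_glue[where v = "\<lambda>j. \<gamma> (real j / 2 ^ N)" and X = X] \<epsilon>; simp)+
  have g_dyadic: "?g N (real j / 2 ^ N) = \<gamma> (real j / 2 ^ N)" if "j \<le> 2 ^ N" for N j
  proof (cases "j < 2 ^ N")
    case True
    then show ?thesis
      using glue[OF True, of 0] paths_betweenD(3)[OF \<epsilon>[OF True]] by (simp add: pathstart_def)
  next
    case False
    moreover have "0 < (2::nat) ^ N" by simp
    ultimately have "j = Suc (j - 1)" "j - 1 < 2 ^ N" using that by linarith+
    then obtain i where i: "j = Suc i" "i < 2 ^ N" by blast
    then show ?thesis
      using glue[OF i(2), of 1] paths_betweenD(4)[OF \<epsilon>[OF i(2)]] by (simp add: pathfinish_def add.commute)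
  qed
  have f_level: "f z = ?g N (fst z)" if z: "z \<in> arc_level N" for z N
  proof (cases "snd z = 0")
    case True
    then obtain j where "j \<le> 2 ^ N" "z = (real j / 2 ^ N, 0)" using arc_level_base_point[OF z] by blast
    then show ?thesis using g_dyadic True by (simp add: f_def)
  next
    case False
    then have "snd z > 0" using arc_level_bounds(2)[OF z] by simp
    then have "(SOME N. z \<in> arc_level N) = N" using arc_level_unique z by (intro some_equality) auto
    then show ?thesis using False by (simp add: f_def)
  qed
  have in_X: "f z \<in> X" if "z \<in> dyadic_arc_space" for z
  proof -
    consider "fst z \<in> {0..1}" "snd z = 0" | N where "z \<in> arc_level N"
      using \<open>z \<in> dyadic_arc_space\<close> unfolding dyadic_arc_space_levels by auto
    then show ?thesis
    proof cases
      case 1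
      then show ?thesis using \<gamma>(2) by (auto simp: f_def path_image_def)
    next
      case (2 N)
      then show ?thesis using f_level[OF 2] g_path(2)[of N] arc_level_bounds(1)[OF 2] by (auto simp: path_image_def)
    qed
  qed
  have f_cont_level: "continuous_on (arc_level N) f" for N
  proof -
    have "continuous_on (arc_level N) (\<lambda>z. ?g N (fst z))"
    proof (rule continuous_on_compose2[of "{0..1}" "?g N" _ fst])
      show "continuous_on {0..1} (?g N)" using g_path(1)[of N] by (simp add: path_def)
      show "fst ` arc_level N \<subseteq> {0..1}" using arc_level_bounds(1) by blast
    qed (intro continuous_intros)
    then show ?thesis using continuous_on_cong f_level by (metis (no_types, lifting))
  qed
  \<comment> \<open>A single level, closed and with continuous restriction, cannot destroy continuity.\<close>
  have level_tendsto: "\<forall>\<^sub>F z in at z0 within dyadic_arc_space. z \<in> arc_level N \<longrightarrow> f z \<in> V"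
    if V: "open V" "f z0 \<in> V" for z0 N V
  proof (cases "z0 \<in> arc_level N")
    case True
    then have "\<forall>\<^sub>F z in at z0 within arc_level N. f z \<in> V"
      using f_cont_level V unfolding continuous_on_def tendsto_def by blast
    then show ?thesis unfolding eventually_at_filter by eventually_elim auto
  next
    case False
    then have "\<forall>\<^sub>F z in at z0 within dyadic_arc_space. z \<in> - arc_level N"
      using closed_arc_level[of N] unfolding eventually_at_topological by (intro exI[of _ "- arc_level N"]) auto
    then show ?thesis by eventually_elim auto
  qed
  \<comment> \<open>All but finitely many levels, and the base, are controlled simultaneously.\<close>
  have tail_tendsto: "\<exists>N0. \<forall>\<^sub>F z in at z0 within dyadic_arc_space.
      (\<forall>N\<ge>N0. z \<in> arc_level N \<longrightarrow> f z \<in> V) \<and> (z \<in> {0..1} \<times> {0} \<longrightarrow> f z \<in> V)"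
    if z0: "z0 \<in> dyadic_arc_space" and V: "open V" "f z0 \<in> V" for z0 V
  proof (cases "snd z0 = 0")
    case False
    have pos: "snd z0 > 0" using dyadic_arc_space_bounds(2)[OF z0] False by simp
    obtain N0 where "(1 / 2) ^ N0 < snd z0 / 2" using real_arch_pow_inv[of "snd z0 / 2" "1 / 2"] pos by auto
    then have N0: "1 / 2 ^ N0 < snd z0 / 2" by (simp add: power_one_over)
    have "((\<lambda>z. snd z) \<longlongrightarrow> snd z0) (at z0 within dyadic_arc_space)" by (intro tendsto_intros)
    then have "\<forall>\<^sub>F z in at z0 within dyadic_arc_space. snd z > snd z0 / 2"
      using pos by (intro order_tendstoD(1)) auto
    then have "\<forall>\<^sub>F z in at z0 within dyadic_arc_space.
      (\<forall>N\<ge>N0. z \<in> arc_level N \<longrightarrow> f z \<in> V) \<and> (z \<in> {0..1} \<times> {0} \<longrightarrow> f z \<in> V)"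
    proof eventually_elim
      case (elim z)
      have "z \<notin> arc_level N" if "N \<ge> N0" for N
      proof
        assume "z \<in> arc_level N"
        then have "snd z \<le> 1 / 2 ^ N" by (rule arc_level_bounds(3))
        also have "\<dots> \<le> 1 / 2 ^ N0" using that by (simp add: divide_simps)
        finally show False using N0 elim by simp
      qed
      then show ?case using elim pos by auto
    qed
    then show ?thesis by blast
  next
    case True
    define x where "x = fst z0"
    have x: "x \<in> {0..1}"
      using dyadic_arc_space_bounds(1)[OF z0] unfolding x_def .
    have gx: "\<gamma> x \<in> X \<inter> V" using V(2) True x \<gamma>(2) by (auto simp: f_def x_def path_image_def)
    have U: "openin (top_of_set X) (X \<inter> V)" using V(1) by (auto simp: openin_open)
    obtain d where d: "d > 0" "\<And>s. s \<in> {0..1} \<Longrightarrow> dist s x < d \<Longrightarrow> \<gamma> s \<in> X \<inter> V"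
      using path_near[OF \<gamma> x U gx] by blast
    let ?K = "{0..1} \<inter> cball x (d / 2)"
    let ?W = "{p \<in> topspace (path_space X). p ` ?K \<subseteq> X \<inter> V}"
    have "openin (path_space X) ?W"
      by (rule openin_path_space_subbasic[OF _ _ U]) (auto intro: compact_Int_closed)
    moreover have "restrict \<gamma> {0..1} \<in> ?W"
      using restrict_in_path_space[OF \<gamma>] d by (auto simp: dist_commute)
    ultimately obtain N0 where N0: "\<forall>N\<ge>N0. restrict (?g N) {0..1} \<in> ?W" using conv[of ?W] by blast
    have "((\<lambda>z. dist (fst z) x) \<longlongrightarrow> dist (fst z0) x) (at z0 within dyadic_arc_space)" by (intro tendsto_intros)
    then have "\<forall>\<^sub>F z in at z0 within dyadic_arc_space. dist (fst z) x < d / 2"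
      using d(1) by (intro order_tendstoD(2)) (auto simp: x_def)
    then have "\<forall>\<^sub>F z in at z0 within dyadic_arc_space.
      (\<forall>N\<ge>N0. z \<in> arc_level N \<longrightarrow> f z \<in> V) \<and> (z \<in> {0..1} \<times> {0} \<longrightarrow> f z \<in> V)"
    proof eventually_elim
      case (elim z)
      have "f z \<in> V" if "N \<ge> N0" "z \<in> arc_level N" for N
      proof -
        have "fst z \<in> ?K" using arc_level_bounds(1)[OF that(2)] elim by (simp add: dist_commute)
        moreover have "restrict (?g N) {0..1} ` ?K \<subseteq> V" using N0 that(1) by blast
        ultimately show ?thesis using f_level[OF that(2)] by auto
      qed
      moreover have "f z \<in> V" if "z \<in> {0..1} \<times> {0}"
        using that d(2)[of "fst z"] d(1) elim by (auto simp: f_def)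
      ultimately show ?case by blast
    qed
    then show ?thesis by blast
  qed
  have "continuous_on dyadic_arc_space f"
    unfolding continuous_on_def tendsto_def
  proof (intro ballI allI impI)
    fix z0 V assume z0: "z0 \<in> dyadic_arc_space" and V: "open V" "f z0 \<in> V"
    obtain N0 where tail: "\<forall>\<^sub>F z in at z0 within dyadic_arc_space.
      (\<forall>N\<ge>N0. z \<in> arc_level N \<longrightarrow> f z \<in> V) \<and> (z \<in> {0..1} \<times> {0} \<longrightarrow> f z \<in> V)"
      using tail_tendsto[OF z0 V] by blast
    have "\<forall>\<^sub>F z in at z0 within dyadic_arc_space. \<forall>N\<in>{..<N0}. z \<in> arc_level N \<longrightarrow> f z \<in> V"
      using level_tendsto[OF V] by (intro eventually_ball_finite) auto
    moreover have "\<forall>\<^sub>F z in at z0 within dyadic_arc_space. z \<in> dyadic_arc_space"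
      by (auto simp: eventually_at_filter)
    ultimately show "\<forall>\<^sub>F z in at z0 within dyadic_arc_space. f z \<in> V"
      using tail
    proof eventually_elim
      case (elim z)
      consider "z \<in> {0..1} \<times> {0}" | N where "z \<in> arc_level N"
        using elim(2) unfolding dyadic_arc_space_levels by blast
      then show ?case
      proof cases
        case 1 then show ?thesis using elim(3) by blast
      next
        case (2 N) then show ?thesis using elim(1,3) by (cases "N < N0") auto
      qed
    qed
  qed
  moreover have "f (arc_path (Suc N) (Suc j) u) = \<epsilon> N j u" if ju: "j < 2 ^ N" "u \<in> {0..1}" for N j u
    using f_level[OF arc_path_in_level[OF ju]] glue[OF ju] by (simp add: arc_path_eq)
  ultimately show thesis using in_X by (intro that) (auto simp: f_def)
qed

context subgroup_of_loops
begin

lemma loop_class_eq_const_iff: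
  assumes p: "p \<in> paths_between X x0 x0"
  shows "cl p = cl (\<lambda>_. x0) \<longleftrightarrow> path_class X p \<in> H"
proof -
  have "reversepath (\<lambda>_. x0) = (\<lambda>_::real. x0)" by (simp add: reversepath_def)
  then show ?thesis
    using class_eq_iff[OF p paths_between_const[OF base]] path_class_cong[OF homotopic_rid[OF p]] by simp
qed

lemma cover_proj_const: "cover_proj (cl (\<lambda>_. x0)) = x0"
  by (rule cover_proj_class[OF paths_between_const[OF base]])

text \<open>
  The paths chosen on the subdivisions transport \<open>c\<close>. The map \<open>f\<close> that they form with \<open>\<gamma>\<close> therefore
  carries \<open>D\<close> into \<open>H\<close>, and the largest arc goes to a path that represents \<open>c 1\<close>, while the base goes
  to \<open>\<gamma>\<close>.
\<close>

lemma lift_from_base: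
  assumes c: "pathin (cover_space X x0 H) c" and c0: "c 0 = cl (\<lambda>_. x0)"
    and fc: "first_countable (path_space X)"
    and closed: "closed_for dyadic_arc_space (0, 0) D_subgroup d_infinity X x0 H"
  shows "c 1 = cl (cover_proj \<circ> c)"
proof -
  define \<gamma> where "\<gamma> = cover_proj \<circ> c"
  have \<gamma>: "path \<gamma>" "path_image \<gamma> \<subseteq> X" unfolding \<gamma>_def by (rule path_cover_proj_lift[OF c])+
  have g0: "\<gamma> 0 = x0" unfolding \<gamma>_def using c0 cover_proj_const by simp
  have const: "(\<lambda>_. x0) \<in> paths_between X x0 x0" by (rule paths_between_const[OF base])
  let ?step = "\<lambda>N \<epsilon>. \<forall>j<2 ^ N. \<epsilon> j \<in> transporters c (real j / 2 ^ N) (real (Suc j) / 2 ^ N)"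
  \<comment> \<open>Possible paths on level \<open>N\<close>; the sequence \<open>z\<close> of chosen ones converges to \<open>\<gamma>\<close>.\<close>
  define P where "P N z \<longleftrightarrow> (\<exists>\<epsilon>. ?step N \<epsilon> \<and> z = restrict (glue (2 ^ N) \<epsilon>) {0..1})" for N z
  obtain z where z: "\<And>N. P N (z N)"
    "\<And>W. openin (path_space X) W \<Longrightarrow> restrict \<gamma> {0..1} \<in> W \<Longrightarrow> \<exists>N0. \<forall>N\<ge>N0. z N \<in> W"
  proof (rule first_countable_sequence[OF fc restrict_in_path_space[OF \<gamma>], of P])
    show "\<exists>N0. \<forall>N\<ge>N0. \<exists>z\<in>W. P N z" if "openin (path_space X) W" "restrict \<gamma> {0..1} \<in> W" for W
      using transporters_approximation[OF c that[unfolded \<gamma>_def]] unfolding P_def by blast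
    show "\<exists>z\<in>topspace (path_space X). P N z" for N
    proof -
      have "\<exists>\<epsilon>. \<epsilon> \<in> transporters c (real j / 2 ^ N) (real (Suc j) / 2 ^ N)" if "j < 2 ^ N" for j
        using that by (intro transporters_nonempty[OF c] dyadic_in_unit) auto
      then obtain \<epsilon> where \<epsilon>: "?step N \<epsilon>" by metis
      have "restrict (glue (2 ^ N) \<epsilon>) {0..1} \<in> topspace (path_space X)"
        using transportersD(1) \<epsilon>
        by (intro restrict_in_path_space path_glue[where v = "\<lambda>j. cover_proj (c (real j / 2 ^ N))" and X = X]) auto
      then show ?thesis unfolding P_def using \<epsilon> by blast
    qed
  qed blast
  obtain \<epsilon> where \<epsilon>: "\<And>N. ?step N (\<epsilon> N)" and z_eq: "\<And>N. z N = restrict (glue (2 ^ N) (\<epsilon> N)) {0..1}"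
    using z(1) unfolding P_def by metis
  obtain f where f: "continuous_on dyadic_arc_space f" "f ` dyadic_arc_space \<subseteq> X"
    "\<And>x. x \<in> {0..1} \<Longrightarrow> f (x, 0) = \<gamma> x"
    "\<And>N j u. j < 2 ^ N \<Longrightarrow> u \<in> {0..1} \<Longrightarrow> f (arc_path (Suc N) (Suc j) u) = \<epsilon> N j u"
  proof (rule continuous_arc_extension[OF \<gamma>, of \<epsilon>])
    show "\<epsilon> N j \<in> paths_between X (\<gamma> (real j / 2 ^ N)) (\<gamma> (real (Suc j) / 2 ^ N))" if "j < 2 ^ N" for N j
      using transportersD(1) \<epsilon> that unfolding \<gamma>_def by simp
    show "\<exists>N0. \<forall>N\<ge>N0. restrict (glue (2 ^ N) (\<epsilon> N)) {0..1} \<in> W"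
      if "openin (path_space X) W" "restrict \<gamma> {0..1} \<in> W" for W
      using z(2)[OF that] unfolding z_eq .
  qed blast
  have arc: "f \<circ> arc_path (Suc N) (Suc j) \<in> transporters c (real j / 2 ^ N) (real (Suc j) / 2 ^ N)" if j: "j < 2 ^ N" for N j
  proof (rule transporters_homotopic)
    show e: "\<epsilon> N j \<in> transporters c (real j / 2 ^ N) (real (Suc j) / 2 ^ N)" using \<epsilon> j by blast
    show "homotopic_paths X (\<epsilon> N j) (f \<circ> arc_path (Suc N) (Suc j))"
      using paths_betweenD[OF transportersD(1)[OF e]] f(4)[OF j] by (intro homotopic_paths_eq) auto
  qed
  have arc_ends: "pathstart (arc_path (Suc N) (Suc j)) = (real j / 2 ^ N, 0)"
      "pathfinish (arc_path (Suc N) (Suc j)) = (real (Suc j) / 2 ^ N, 0)" if j: "j < 2 ^ N" for N j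
    using paths_betweenD(3,4)[OF arc_path_between[OF j]] .
  have std: "\<exists>u\<in>{0..1}. \<exists>v\<in>{0..1}. pathstart p = (u, 0) \<and> pathfinish p = (v, 0) \<and> f \<circ> p \<in> transporters c u v"
    if "standard_path p" for p
    using that
  proof (cases rule: standard_path_cases)
    case (1 N j)
    then show ?thesis
      using arc[OF 1(1)] arc_ends[OF 1(1)] dyadic_in_unit[of j N] dyadic_in_unit[of "Suc j" N] by auto
  next
    case (2 N j)
    have "f \<circ> p \<in> transporters c (real (Suc j) / 2 ^ N) (real j / 2 ^ N)"
      unfolding 2(2) path_compose_reversepath
      using 2(1) by (intro transporters_reverse[OF c _ _ arc] dyadic_in_unit) auto
    then show ?thesis
      using 2 arc_ends[OF 2(1)] dyadic_in_unit[of j N] dyadic_in_unit[of "Suc j" N] by auto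
  qed
  \<comment> \<open>Concatenations of arcs move along \<open>c\<close>, so loops among them return to \<open>c 0\<close>, the class of the constant path.\<close>
  have concat: "\<exists>u\<in>{0..1}. \<exists>v\<in>{0..1}. pathstart p = (u, 0) \<and> pathfinish p = (v, 0) \<and> f \<circ> p \<in> transporters c u v"
    if "standard_concat p" for p
    using that
  proof induction
    case (1 p)
    then show ?case by (rule std)
  next
    case (2 p q)
    obtain u v where u: "u \<in> {0..1}" "v \<in> {0..1}" "pathstart p = (u, 0)" "pathfinish p = (v, 0)" "f \<circ> p \<in> transporters c u v"
      using std[OF 2(1)] by blast
    obtain v' w where w: "v' \<in> {0..1}" "w \<in> {0..1}" "pathstart q = (v', 0)" "pathfinish q = (w, 0)" "f \<circ> q \<in> transporters c v' w"
      using 2(4) by blast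
    have "v' = v" using 2(3) u(4) w(3) by simp
    then have "f \<circ> (p +++ q) \<in> transporters c u w"
      unfolding path_compose_join using transporters_join[OF u(5)] w(5) by blast
    then show ?case using u(1,3) w(2,4) by (metis pathstart_join pathfinish_join)
  qed
  have c0': "cover_proj (c 0) = x0" using g0 by (simp add: \<gamma>_def)
  have "induced_hom X f ` D_subgroup \<subseteq> H"
  proof
    fix h assume "h \<in> induced_hom X f ` D_subgroup"
    then obtain p where p: "standard_concat p" "pathstart p = (0, 0)" "pathfinish p = (0, 0)"
      and h: "h = induced_hom X f (path_class dyadic_arc_space p)"
      unfolding D_subgroup_def by blast
    have "f \<circ> p \<in> transporters c 0 0" using concat[OF p(1)] p(2,3) by auto
    then have fp: "f \<circ> p \<in> paths_between X x0 x0" "c 0 = cl ((\<lambda>_. x0) +++ (f \<circ> p))"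
      using transportersD[of "f \<circ> p" c 0 0] c0' c0 const by auto
    have "cl ((\<lambda>_. x0) +++ (f \<circ> p)) = cl (f \<circ> p)"
      by (rule class_homotopic[OF homotopic_lid[OF fp(1)] paths_between_join[OF const fp(1)]])
    then have "path_class X (f \<circ> p) \<in> H" using fp loop_class_eq_const_iff[OF fp(1)] c0 by simp
    moreover have "path p" "path_image p \<subseteq> dyadic_arc_space"
      using standard_concat_between[OF p(1)] by (auto simp: paths_between_def)
    ultimately show "h \<in> H" unfolding h using induced_hom_path_class[OF f(1,2)] by simp
  qed
  moreover have "f (0, 0) = x0" using f(3)[of 0] g0 by simp
  ultimately have "induced_hom X f d_infinity \<in> H"
    using closed f(1,2) unfolding closed_for_def by blast
  have arc11: "arc_path 1 1 \<in> paths_between dyadic_arc_space (0, 0) (1, 0)"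
    using arc_path_between[of 0 0] by simp
  have loop: "arc_path 1 1 +++ reversepath base_path \<in> paths_between dyadic_arc_space (0, 0) (0, 0)"
    by (rule paths_between_join[OF arc11 paths_between_reverse[OF base_path_between]])
  have "path_class X ((f \<circ> arc_path 1 1) +++ reversepath (f \<circ> base_path)) \<in> H"
    using \<open>induced_hom X f d_infinity \<in> H\<close> induced_hom_path_class[OF f(1,2) paths_betweenD(1,2)[OF loop]]
    by (simp add: d_infinity_def path_compose_join path_compose_reversepath)
  moreover have fa: "f \<circ> arc_path 1 1 \<in> paths_between X x0 (\<gamma> 1)"
    by (rule paths_between_compose[OF arc11 f(1,2)]) (simp_all add: f(3) g0)
  moreover have fb: "f \<circ> base_path \<in> paths_between X x0 (\<gamma> 1)"
    by (rule paths_between_compose[OF base_path_between f(1,2)]) (simp_all add: f(3) g0)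
  ultimately have "cl (f \<circ> arc_path 1 1) = cl (f \<circ> base_path)" by (simp add: class_eq_iff)
  moreover have "c 1 = cl (f \<circ> arc_path 1 1)"
  proof -
    have "f \<circ> arc_path 1 1 \<in> transporters c 0 1" using arc[of 0 0] by simp
    then have "c 1 = cl ((\<lambda>_. x0) +++ (f \<circ> arc_path 1 1))"
      using transportersD(2) c0' c0 const by metis
    also have "\<dots> = cl (f \<circ> arc_path 1 1)"
      by (rule class_homotopic[OF homotopic_lid[OF fa] paths_between_join[OF const fa]])
    finally show ?thesis .
  qed
  moreover have "cl (f \<circ> base_path) = cl \<gamma>"
  proof (rule class_homotopic[OF _ fb])
    show "homotopic_paths X (f \<circ> base_path) \<gamma>"
      using paths_betweenD(1,2)[OF fb] by (rule homotopic_paths_eq) (simp add: base_path_def f(3))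
  qed
  ultimately show ?thesis by (simp add: \<gamma>_def)
qed

text \<open>
  A lift starting anywhere becomes a lift starting at the constant path after prefixing the standard
  lift of a representative \<open>\<eta>\<close> of its initial point. Running it only up to parameter \<open>t\<close> places \<open>\<alpha> t\<close>
  at the end, where \<open>lift_from_base\<close> expresses it through the projection alone.
\<close>

lemma unique_path_lifting_if_closed:
  assumes fc: "first_countable (path_space X)"
    and closed: "closed_for dyadic_arc_space (0, 0) D_subgroup d_infinity X x0 H"
  shows "unique_path_lifting (cover_space X x0 H) cover_proj"
  unfolding unique_path_lifting_def
proof (intro allI impI ballI, elim conjE)
  fix \<alpha> \<beta> t
  assume \<alpha>: "pathin (cover_space X x0 H) \<alpha>" and \<beta>: "pathin (cover_space X x0 H) \<beta>" and start: "\<alpha> 0 = \<beta> 0"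
    and proj: "\<forall>t\<in>{0..1}. cover_proj (\<alpha> t) = cover_proj (\<beta> t)" and t: "t \<in> {0..1::real}"
  have const: "(\<lambda>_. x0) \<in> paths_between X x0 x0" by (rule paths_between_const[OF base])
  obtain \<eta> where \<eta>: "\<eta> \<in> paths_between X x0 (cover_proj (\<alpha> 0))" "\<alpha> 0 = cl \<eta>"
    using lift_value[OF \<alpha>, of 0] by auto
  have e0: "\<eta> 0 = x0" using paths_betweenD(3)[OF \<eta>(1)] by (simp add: pathstart_def)
  let ?prefix = "\<lambda>s. cl ((\<lambda>_. x0) +++ (\<eta> \<circ> linepath 0 s))"
  have prefix: "pathin (cover_space X x0 H) ?prefix"
    using const e0 by (intro pathin_standard_lift paths_betweenD(1,2)[OF \<eta>(1)]) simp
  have prefix1: "?prefix 1 = \<alpha> 0"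
    using class_homotopic[OF homotopic_lid[OF \<eta>(1)] paths_between_join[OF const \<eta>(1)]] \<eta>(2)
    by (simp add: path_as_segment)
  have prefix0: "?prefix 0 = cl (\<lambda>_. x0)"
    using class_homotopic[OF homotopic_lid[OF const] paths_between_join[OF const const]] e0
    by (simp add: const_as_segment)
  \<comment> \<open>The initial half is the lift of \<open>\<eta>\<close>, the second half is \<open>a\<close> on \<open>[0, t]\<close>.\<close>
  define ext where "ext a s = (if s \<le> 1 / 2 then (?prefix \<circ> (\<lambda>s. 2 * s)) s else (a \<circ> (\<lambda>s. t * (2 * s - 1))) s)"
    for a :: "real \<Rightarrow> (real \<Rightarrow> 'a) set" and s
  have ext_lift: "pathin (cover_space X x0 H) (ext a)"
    if a: "pathin (cover_space X x0 H) a" and a0: "a 0 = \<alpha> 0" for a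
    unfolding pathin_def ext_def
  proof (rule continuous_map_cases_le)
    show "continuous_map (subtopology (top_of_set {0..1}) {x \<in> topspace (top_of_set {0..1}). x \<le> 1 / 2})
        (cover_space X x0 H) (?prefix \<circ> (\<lambda>s. 2 * s))"
      by (rule continuous_map_compose[OF _ prefix[unfolded pathin_def]])
        (auto simp: subtopology_subtopology continuous_map_in_subtopology intro!: continuous_intros)
    have "t * (2 * s - 1) \<in> {0..1}" if "0 \<le> s" "s \<le> 1" "1 / 2 \<le> s" for s
      using that t by (auto intro: mult_le_one)
    then show "continuous_map (subtopology (top_of_set {0..1}) {x \<in> topspace (top_of_set {0..1}). 1 / 2 \<le> x})
        (cover_space X x0 H) (a \<circ> (\<lambda>s. t * (2 * s - 1)))"
      by (intro continuous_map_compose[OF _ a[unfolded pathin_def]])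
        (auto simp: subtopology_subtopology continuous_map_in_subtopology intro!: continuous_intros)
    fix s :: real assume "s = 1 / 2"
    then have "2 * s = 1" "2 * s - 1 = 0" by simp_all
    then show "(?prefix \<circ> (\<lambda>s. 2 * s)) s = (a \<circ> (\<lambda>s. t * (2 * s - 1))) s"
      using prefix1 a0 by (simp only: o_apply mult_zero_right)
  qed (auto intro: continuous_map_from_subtopology)
  have ext: "a t = cl (cover_proj \<circ> ext a)" if "pathin (cover_space X x0 H) a" "a 0 = \<alpha> 0" for a
    using lift_from_base[OF ext_lift[OF that] _ fc closed] prefix0 by (simp add: ext_def)
  have "cl (cover_proj \<circ> ext \<alpha>) = cl (cover_proj \<circ> ext \<beta>)"
  proof (rule class_homotopic)
    note path = path_cover_proj_lift[OF ext_lift[OF \<alpha> refl]]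
    show "homotopic_paths X (cover_proj \<circ> ext \<alpha>) (cover_proj \<circ> ext \<beta>)"
    proof (rule homotopic_paths_eq[OF path])
      fix s :: real assume s: "s \<in> {0..1}"
      have "t * (2 * s - 1) \<in> {0..1}" if "\<not> s \<le> 1 / 2"
        using that s t by (auto intro: mult_le_one)
      then show "(cover_proj \<circ> ext \<alpha>) s = (cover_proj \<circ> ext \<beta>) s"
        using proj by (simp add: ext_def)
    qed
    show "cover_proj \<circ> ext \<alpha> \<in> paths_between X x0 (cover_proj (ext \<alpha> 1))"
      using path prefix0 cover_proj_const
      by (intro paths_betweenI) (auto simp: pathstart_def pathfinish_def ext_def)
  qed
  then show "\<alpha> t = \<beta> t" using ext[OF \<alpha> refl] ext[OF \<beta>] start by simp
qed

end


section \<open>Unique path lifting implies closedness\<close>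

text \<open>
  For \<open>t \<in> [0, 1]\<close> and \<open>n > 0\<close> this is the largest multiple of \<open>1 / 2 ^ (n - 1)\<close> that is at most \<open>t\<close>.
  The index is shifted so that the value for \<open>n = 0\<close> is \<open>0\<close> even when \<open>t = 1\<close>; then the step from \<open>n\<close>
  to \<open>Suc n\<close> is either trivial or crosses exactly one dyadic interval of level \<open>n\<close>.
\<close>

definition dyadic_floor :: "nat \<Rightarrow> real \<Rightarrow> real" where
  "dyadic_floor n t = 2 * of_int \<lfloor>2 ^ n * t / 2\<rfloor> / 2 ^ n"

text \<open>
  The path over \<open>[0, t]\<close> that follows the arcs over the successive steps of \<open>dyadic_floor\<close>, as the graph
  of a function of the first coordinate. The steps have disjoint interiors, so at most one term of
  the series is nonzero (\<open>greedy_path_step\<close>); writing the height as the root of a series gives continuity,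
  also at the limit point \<open>t\<close>, by uniform convergence. After \<open>t\<close> the path stays on the base.
\<close>

definition greedy_path :: "real \<Rightarrow> real \<Rightarrow> real \<times> real" where
  "greedy_path t x = (x, sqrt (\<Sum>n. max 0 ((x - dyadic_floor n t) * (dyadic_floor (Suc n) t - x))))"

lemma dyadic_floor_0: "t \<in> {0..1} \<Longrightarrow> dyadic_floor 0 t = 0"
  by (simp add: dyadic_floor_def floor_eq_iff)

lemma dyadic_floor_Suc: "dyadic_floor (Suc n) t = of_int \<lfloor>2 ^ n * t\<rfloor> / 2 ^ n"
  by (simp add: dyadic_floor_def mult.assoc)

lemma dyadic_floor_le: "dyadic_floor n t \<le> t"
proof -
  have "2 * of_int \<lfloor>2 ^ n * t / 2\<rfloor> \<le> 2 ^ n * t" using of_int_floor_le[of "2 ^ n * t / 2"] by linarith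
  then show ?thesis by (simp add: dyadic_floor_def divide_simps mult.commute)
qed

lemma dyadic_floor_gt: "t < dyadic_floor n t + 2 / 2 ^ n"
proof -
  have "2 ^ n * t < 2 * of_int \<lfloor>2 ^ n * t / 2\<rfloor> + 2" by linarith
  then have "t < (2 * of_int \<lfloor>2 ^ n * t / 2\<rfloor> + 2) / 2 ^ n" by (simp add: divide_simps mult.commute)
  then show ?thesis by (simp add: dyadic_floor_def add_divide_distrib)
qed

lemma dyadic_floor_nonneg: "t \<in> {0..1} \<Longrightarrow> 0 \<le> dyadic_floor n t"
  by (simp add: dyadic_floor_def)

lemma dyadic_floor_in_unit: "t \<in> {0..1} \<Longrightarrow> dyadic_floor n t \<in> {0..1}"
  using dyadic_floor_nonneg[of t n] dyadic_floor_le[of n t] by auto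

lemma dyadic_floor_index:
  assumes "t \<in> {0..1}"
  obtains k where "k \<le> 2 ^ m" "dyadic_floor (Suc m) t = real k / 2 ^ m"
proof
  have "2 ^ m * t \<le> real (2 ^ m)" "0 \<le> 2 ^ m * t" using assms by (auto intro: mult_left_le)
  then have "\<lfloor>2 ^ m * t\<rfloor> \<le> int (2 ^ m)" by linarith
  then show "nat \<lfloor>2 ^ m * t\<rfloor> \<le> 2 ^ m" by (simp only: nat_le_iff)
  show "dyadic_floor (Suc m) t = real (nat \<lfloor>2 ^ m * t\<rfloor>) / 2 ^ m"
    using \<open>0 \<le> 2 ^ m * t\<close> by (simp add: dyadic_floor_Suc)
qed

lemma dyadic_floor_step:
  assumes t: "t \<in> {0..1}"
  obtains "dyadic_floor (Suc n) t = dyadic_floor n t"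
  | j where "j < 2 ^ n" "dyadic_floor n t = real j / 2 ^ n" "dyadic_floor (Suc n) t = real (Suc j) / 2 ^ n"
proof -
  define k where "k = \<lfloor>2 ^ n * t / 2\<rfloor>"
  have k: "0 \<le> k" unfolding k_def using t by simp
  have dn: "dyadic_floor n t = of_int (2 * k) / 2 ^ n" by (simp add: dyadic_floor_def k_def)
  have "\<lfloor>2 ^ n * t\<rfloor> = 2 * k \<or> \<lfloor>2 ^ n * t\<rfloor> = 2 * k + 1" unfolding k_def by linarith
  then show thesis
  proof
    \<comment> \<open>The next binary digit of \<open>t\<close> is 0.\<close>
    assume "\<lfloor>2 ^ n * t\<rfloor> = 2 * k"
    then show thesis using that(1) dn by (simp add: dyadic_floor_Suc)
  next
    \<comment> \<open>The next binary digit of \<open>t\<close> is 1.\<close>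
    assume *: "\<lfloor>2 ^ n * t\<rfloor> = 2 * k + 1"
    have dn': "dyadic_floor n t = real (nat (2 * k)) / 2 ^ n" using dn k by simp
    have dS: "dyadic_floor (Suc n) t = real (Suc (nat (2 * k))) / 2 ^ n"
      using * k by (simp add: dyadic_floor_Suc)
    have "dyadic_floor (Suc n) t \<le> 1" using dyadic_floor_in_unit[OF t] by auto
    then have "real (Suc (nat (2 * k))) \<le> 2 ^ n" unfolding dS by (simp add: divide_simps)
    then have "Suc (nat (2 * k)) \<le> 2 ^ n" by (metis of_nat_le_iff of_nat_numeral of_nat_power)
    then show thesis by (intro that(2)[OF Suc_le_lessD dn' dS])
  qed
qed

lemma dyadic_floor_mono_Suc:
  assumes "t \<in> {0..1}"
  shows "dyadic_floor n t \<le> dyadic_floor (Suc n) t" "dyadic_floor (Suc n) t \<le> dyadic_floor n t + 1 / 2 ^ n"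
  using dyadic_floor_step[OF assms, of n] by (cases; simp add: add_divide_distrib)+

lemma dyadic_floor_mono: "t \<in> {0..1} \<Longrightarrow> m \<le> n \<Longrightarrow> dyadic_floor m t \<le> dyadic_floor n t"
  by (rule lift_Suc_mono_le) (auto intro: dyadic_floor_mono_Suc)

lemma greedy_path_step:
  assumes t: "t \<in> {0..1}" and x: "dyadic_floor n t \<le> x" "x \<le> dyadic_floor (Suc n) t"
  shows "greedy_path t x = (x, sqrt ((x - dyadic_floor n t) * (dyadic_floor (Suc n) t - x)))"
proof -
  have "max 0 ((x - dyadic_floor m t) * (dyadic_floor (Suc m) t - x)) = 0" if "m \<notin> {n}" for m
  proof (cases "m < n")
    case True
    then have "dyadic_floor m t \<le> x" "dyadic_floor (Suc m) t \<le> x"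
      using dyadic_floor_mono[OF t, of m n] dyadic_floor_mono[OF t, of "Suc m" n] x(1) by auto
    then show ?thesis by (simp add: mult_nonneg_nonpos)
  next
    case False
    then have "x \<le> dyadic_floor m t" "x \<le> dyadic_floor (Suc m) t"
      using dyadic_floor_mono[OF t, of "Suc n" m] dyadic_floor_mono[OF t, of "Suc n" "Suc m"] x(2) that by auto
    then show ?thesis by (simp add: mult_nonpos_nonneg)
  qed
  then have "(\<Sum>m. max 0 ((x - dyadic_floor m t) * (dyadic_floor (Suc m) t - x)))
      = (\<Sum>m\<in>{n}. max 0 ((x - dyadic_floor m t) * (dyadic_floor (Suc m) t - x)))"
    by (intro suminf_finite) auto
  then show ?thesis using x by (simp add: greedy_path_def)
qed

lemma greedy_path_beyond:
  assumes "t \<le> x"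
  shows "greedy_path t x = (x, 0)"
proof -
  have "max 0 ((x - dyadic_floor m t) * (dyadic_floor (Suc m) t - x)) = 0" for m
    using dyadic_floor_le[of m t] dyadic_floor_le[of "Suc m" t] assms by (simp add: mult_nonneg_nonpos)
  then show ?thesis by (simp add: greedy_path_def)
qed

lemma greedy_path_arc:
  assumes t: "t \<in> {0..1}" and j: "dyadic_floor n t = real j / 2 ^ n" "dyadic_floor (Suc n) t = real (Suc j) / 2 ^ n"
    and u: "u \<in> {0..1}"
  shows "greedy_path t ((real j + u) / 2 ^ n) = arc_path (Suc n) (Suc j) u"
proof -
  have "real j / 2 ^ n \<le> (real j + u) / 2 ^ n" "(real j + u) / 2 ^ n \<le> real (Suc j) / 2 ^ n"
    using u by (auto simp: divide_right_mono)
  then have "greedy_path t ((real j + u) / 2 ^ n) = ((real j + u) / 2 ^ n,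
      sqrt (((real j + u) / 2 ^ n - real j / 2 ^ n) * (real (Suc j) / 2 ^ n - (real j + u) / 2 ^ n)))"
    using greedy_path_step[OF t, of n "(real j + u) / 2 ^ n", unfolded j] by blast
  also have "((real j + u) / 2 ^ n - real j / 2 ^ n) * (real (Suc j) / 2 ^ n - (real j + u) / 2 ^ n)
      = (u - u\<^sup>2) / (2 ^ n)\<^sup>2"
    by (simp add: diff_divide_distrib[symmetric] power2_eq_square algebra_simps)
  finally show ?thesis by (simp add: arc_path_eq real_sqrt_divide)
qed

lemma greedy_path_fst [simp]: "fst (greedy_path t x) = x"
  by (simp add: greedy_path_def)

text \<open>
  Before reaching \<open>t\<close>, the path is on an arc: the first \<open>dyadic_floor\<close> beyond \<open>x\<close> marks the end of a
  nontrivial step that contains \<open>x\<close>.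
\<close>

lemma greedy_path_level:
  assumes t: "t \<in> {0..1}" and x: "dyadic_floor m t \<le> x" "x < t"
  obtains n where "n \<ge> m" "greedy_path t x \<in> arc_level n"
proof -
  obtain k where "(1 / 2) ^ k < (t - x) / 2" using real_arch_pow_inv[of "(t - x) / 2" "1 / 2"] x by auto
  then have "2 / 2 ^ k < t - x" by (simp add: power_one_over)
  then have k: "x < dyadic_floor k t" using dyadic_floor_gt[of t k] by linarith
  define l where "l = (LEAST k. x < dyadic_floor k t)"
  have l: "x < dyadic_floor l t" unfolding l_def using k by (rule LeastI)
  have least: "dyadic_floor i t \<le> x" if "i < l" for i using not_less_Least[of i] that unfolding l_def by force
  have "m < l" using dyadic_floor_mono[OF t, of l m] x(1) l by force
  then obtain n where n: "l = Suc n" "m \<le> n" by (cases l) auto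
  have low: "dyadic_floor n t \<le> x" using least n by simp
  show thesis
    using t
  proof (cases rule: dyadic_floor_step[of t n])
    case 1
    then show thesis using low l n by simp
  next
    case (2 j)
    define u where "u = 2 ^ n * x - real j"
    have x_eq: "x = (real j + u) / 2 ^ n" by (simp add: u_def)
    have "real j / 2 ^ n \<le> x" "x < real (Suc j) / 2 ^ n" using low l n(1) 2 by simp_all
    then have "u \<in> {0..1}" by (auto simp: u_def divide_simps mult.commute)
    then have "greedy_path t x \<in> arc_level n"
      unfolding x_eq using greedy_path_arc[OF t 2(2,3)] arc_path_in_level[OF 2(1)] by simp
    then show thesis using that n(2) by blast
  qed
qed

lemma greedy_path_height:
  assumes t: "t \<in> {0..1}" and x: "dyadic_floor m t \<le> x" "x \<le> t"
  shows "snd (greedy_path t x) \<le> 1 / 2 ^ m"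
proof (cases "x < t")
  case True
  obtain n where n: "n \<ge> m" "greedy_path t x \<in> arc_level n" using greedy_path_level[OF t x(1) True] .
  have "snd (greedy_path t x) \<le> 1 / 2 ^ n" by (rule arc_level_bounds(3)[OF n(2)])
  also have "\<dots> \<le> 1 / 2 ^ m" using n(1) by (simp add: divide_simps)
  finally show ?thesis .
next
  case False
  then show ?thesis using greedy_path_beyond[of t x] by simp
qed

lemma greedy_path_in_space:
  assumes t: "t \<in> {0..1}" and x: "x \<in> {0..1}"
  shows "greedy_path t x \<in> dyadic_arc_space"
proof (cases "x < t")
  case True
  have "dyadic_floor 0 t \<le> x" using x dyadic_floor_0[OF t] by simp
  then show ?thesis using greedy_path_level[OF t _ True] unfolding dyadic_arc_space_levels by blast
next
  case False
  then show ?thesis using greedy_path_beyond[of t x] x unfolding dyadic_arc_space_levels by simp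
qed

lemma path_greedy_path:
  assumes t: "t \<in> {0..1}"
  shows "path (greedy_path t)" "path_image (greedy_path t) \<subseteq> dyadic_arc_space"
proof -
  let ?h = "\<lambda>n x. max 0 ((x - dyadic_floor n t) * (dyadic_floor (Suc n) t - x))"
  have bound: "norm (?h n x) \<le> (1 / 2) ^ n" for n x
  proof -
    define a b where "a = dyadic_floor n t" and "b = dyadic_floor (Suc n) t"
    have ab: "a \<le> b" "b - a \<le> 1 / 2 ^ n" using dyadic_floor_mono_Suc[OF t, of n] by (auto simp: a_def b_def)
    have "(x - a) * (b - x) \<le> 1 / 2 ^ n"
    proof (cases "a \<le> x \<and> x \<le> b")
      case True
      then have "(x - a) * (b - x) \<le> (b - a) * 1"
        using ab divide_le_eq_1_pos[of "2 ^ n" "1::real"] by (intro mult_mono) (auto intro: order_trans[of _ "1 / 2 ^ n"])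
      then show ?thesis using ab by simp
    next
      case False
      then have "(x - a) * (b - x) \<le> 0" using ab by (auto simp: mult_le_0_iff)
      then show ?thesis by (rule order_trans) simp
    qed
    then show ?thesis by (simp add: a_def b_def power_one_over)
  qed
  have "continuous_on UNIV (\<lambda>x. \<Sum>n. ?h n x)"
  proof (rule uniform_limit_theorem)
    show "uniform_limit UNIV (\<lambda>n x. \<Sum>i<n. ?h i x) (\<lambda>x. \<Sum>n. ?h n x) sequentially"
      by (rule Weierstrass_m_test[OF bound]) (auto intro: summable_geometric)
    show "\<forall>\<^sub>F n in sequentially. continuous_on UNIV (\<lambda>x. \<Sum>i<n. ?h i x)"
      by (intro always_eventually allI continuous_intros)
  qed auto
  then have "continuous_on {0..1} (\<lambda>x. \<Sum>n. ?h n x)" by (rule continuous_on_subset) auto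
  then show "path (greedy_path t)"
    unfolding path_def greedy_path_def by (intro continuous_intros)
  show "path_image (greedy_path t) \<subseteq> dyadic_arc_space"
    using greedy_path_in_space[OF t] by (auto simp: path_image_def)
qed

text \<open>
  Up to homotopy, finite concatenations of standard paths may be bracketed in any way and include the
  constant path at \<open>(0, 0)\<close>.
\<close>

definition essentially_standard :: "(real \<Rightarrow> real \<times> real) \<Rightarrow> bool" where
  "essentially_standard p \<longleftrightarrow> (\<exists>q. standard_concat q \<and> homotopic_paths dyadic_arc_space q p)"

lemma essentially_standard_arc:
  assumes "j < 2 ^ N"
  shows "essentially_standard (arc_path (Suc N) (Suc j))"
    "essentially_standard (reversepath (arc_path (Suc N) (Suc j)))"
proof -
  have "standard_concat (arc_path (Suc N) (Suc j))" "standard_concat (reversepath (arc_path (Suc N) (Suc j)))"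
    using assms by (auto intro!: standard_concat.intros(1) standard_path.intros)
  then show "essentially_standard (arc_path (Suc N) (Suc j))"
    "essentially_standard (reversepath (arc_path (Suc N) (Suc j)))"
    unfolding essentially_standard_def
    using homotopic_refl[OF arc_path_between[OF assms]]
      homotopic_refl[OF paths_between_reverse[OF arc_path_between[OF assms]]] by blast+
qed

lemma essentially_standard_homotopic:
  "essentially_standard p \<Longrightarrow> homotopic_paths dyadic_arc_space p q \<Longrightarrow> essentially_standard q"
  unfolding essentially_standard_def by (meson homotopic_paths_trans)

lemma standard_concat_append:
  assumes "standard_concat p" "standard_concat q" "pathfinish p = pathstart q"
  shows "\<exists>r. standard_concat r \<and> homotopic_paths dyadic_arc_space r (p +++ q)"
  using assms
proof (induction)
  case (1 p)
  have pq: "standard_concat (p +++ q)" using 1 by (intro standard_concat.intros(2))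
  then obtain u v where "p +++ q \<in> paths_between dyadic_arc_space (u, 0) (v, 0)"
    using standard_concat_between by blast
  then show ?case using pq homotopic_refl by blast
next
  case (2 p p')
  then obtain r where r: "standard_concat r" "homotopic_paths dyadic_arc_space r (p' +++ q)" by auto
  obtain u v where p: "p \<in> paths_between dyadic_arc_space u v"
    using standard_path_between[OF 2(1)] by metis
  obtain v' w where p': "p' \<in> paths_between dyadic_arc_space v' w"
    using standard_concat_between[OF 2(2)] by metis
  obtain w' x where q: "q \<in> paths_between dyadic_arc_space w' x"
    using standard_concat_between[OF 2(5)] by metis
  have eqs: "v' = v" "w' = w" using 2(3,6) p p' q by (simp_all add: paths_between_def)
  note p'' = p'[unfolded eqs] and q' = q[unfolded eqs]
  have r': "r \<in> paths_between dyadic_arc_space v x"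
    using homotopic_paths_between[OF homotopic_paths_sym[OF r(2)] paths_between_join[OF p'' q']] .
  have "homotopic_paths dyadic_arc_space (p +++ r) (p +++ (p' +++ q))"
    by (rule homotopic_join_cong[OF homotopic_refl[OF p] r(2) p r'])
  also have "homotopic_paths dyadic_arc_space \<dots> ((p +++ p') +++ q)"
    by (rule homotopic_assoc[OF p p'' q'])
  finally have "homotopic_paths dyadic_arc_space (p +++ r) ((p +++ p') +++ q)" .
  moreover have "standard_concat (p +++ r)"
    using 2(1) r(1) p r' by (intro standard_concat.intros(2)) (simp_all add: paths_between_def)
  ultimately show ?case by blast
qed

lemma essentially_standard_join:
  assumes "essentially_standard p" "essentially_standard q" "pathfinish p = pathstart q"
  shows "essentially_standard (p +++ q)"
proof -
  obtain p' q' where p': "standard_concat p'" "homotopic_paths dyadic_arc_space p' p"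
    and q': "standard_concat q'" "homotopic_paths dyadic_arc_space q' q"
    using assms(1,2) unfolding essentially_standard_def by blast
  have fs: "pathfinish p' = pathstart q'"
    using assms(3) homotopic_paths_imp_pathfinish[OF p'(2)] homotopic_paths_imp_pathstart[OF q'(2)] by simp
  obtain r where r: "standard_concat r" "homotopic_paths dyadic_arc_space r (p' +++ q')"
    using standard_concat_append[OF p'(1) q'(1) fs] by blast
  show ?thesis
    unfolding essentially_standard_def
    using r homotopic_paths_trans[OF r(2) homotopic_paths_join[OF p'(2) q'(2) fs]] by blast
qed

lemma essentially_standard_reverse:
  assumes "essentially_standard p"
  shows "essentially_standard (reversepath p)"
proof -
  have std: "essentially_standard (reversepath q)" if "standard_path q" for q
    using that by (cases rule: standard_path_cases) (simp_all add: essentially_standard_arc)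
  have "essentially_standard (reversepath q)" if "standard_concat q" for q
    using that
  proof induction
    case (1 p)
    then show ?case by (rule std)
  next
    case (2 p q)
    then show ?case
      using essentially_standard_join[OF 2(4) std[OF 2(1)]] by (simp add: reversepath_joinpaths)
  qed
  moreover obtain q where "standard_concat q" "homotopic_paths dyadic_arc_space q p"
    using assms unfolding essentially_standard_def by blast
  ultimately show ?thesis
    using essentially_standard_homotopic homotopic_paths_reversepath_D by blast
qed

text \<open>
  Finite concatenations are nonempty, so the constant path enters as an arc followed by its reverse.
\<close>

lemma essentially_standard_const: "essentially_standard (\<lambda>_. (0, 0))"
proof (rule essentially_standard_homotopic)
  have arc: "arc_path 1 1 \<in> paths_between dyadic_arc_space (0, 0) (1, 0)"
    using arc_path_between[of 0 0] by simp
  show "essentially_standard (arc_path 1 1 +++ reversepath (arc_path 1 1))"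
    using essentially_standard_arc[of 0 0] arc
    by (intro essentially_standard_join) (simp_all add: paths_between_def)
  show "homotopic_paths dyadic_arc_space (arc_path 1 1 +++ reversepath (arc_path 1 1)) (\<lambda>_. (0, 0))"
    by (rule homotopic_rinv[OF arc])
qed

lemma greedy_path_initial_standard:
  assumes t: "t \<in> {0..1}"
  shows "essentially_standard (greedy_path t \<circ> linepath 0 (dyadic_floor n t))"
proof (induction n)
  case 0
  have "greedy_path t 0 = (0, 0)"
    using greedy_path_step[OF t, of 0 0] dyadic_floor_0[OF t] dyadic_floor_nonneg[OF t] by simp
  then show ?case using essentially_standard_const by (simp add: dyadic_floor_0[OF t] const_as_segment)
next
  case (Suc n)
  show ?case
    using t
  proof (cases rule: dyadic_floor_step[of t n])
    case 1
    then show ?thesis using Suc by simp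
  next
    case (2 j)
    let ?a = "dyadic_floor n t" and ?b = "dyadic_floor (Suc n) t"
    have unit: "?a \<in> {0..1}" "?b \<in> {0..1}" "0 \<in> {0..1::real}" using dyadic_floor_in_unit[OF t] by auto
    note seg = segment_between[OF path_greedy_path[OF t]]
    have arc: "homotopic_paths dyadic_arc_space (arc_path (Suc n) (Suc j)) (greedy_path t \<circ> linepath ?a ?b)"
    proof (rule homotopic_paths_eq)
      fix u :: real assume u: "u \<in> {0..1}"
      have "linepath ?a ?b u = (real j + u) / 2 ^ n"
        unfolding 2 linepath_def by (simp add: field_simps)
      then show "arc_path (Suc n) (Suc j) u = (greedy_path t \<circ> linepath ?a ?b) u"
        using greedy_path_arc[OF t 2(2,3) u] by simp
    qed (use paths_betweenD[OF arc_path_between[OF 2(1)]] in auto)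
    have "essentially_standard ((greedy_path t \<circ> linepath 0 ?a) +++ (greedy_path t \<circ> linepath ?a ?b))"
      using Suc essentially_standard_homotopic[OF essentially_standard_arc(1)[OF 2(1)] arc]
      using paths_betweenD(4)[OF seg[OF unit(3,1)]] paths_betweenD(3)[OF seg[OF unit(1,2)]]
      by (intro essentially_standard_join) (simp_all only:)
    then show ?thesis
      using segment_join[OF path_greedy_path[OF t] unit(3,1,2)] by (rule essentially_standard_homotopic)
  qed
qed

text \<open>
  When \<open>t\<close> moves by less than the mesh of a grid, the grid point below it moves by at most one step;
  the arc over that step, or a constant path, connects the two.
\<close>

lemma neighbouring_grid_points_joined:
  assumes k: "k \<le> 2 ^ m" "l \<le> 2 ^ m" "k = l \<or> l = Suc k \<or> k = Suc l"
  obtains e where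
    "e \<in> paths_between {z \<in> dyadic_arc_space. \<bar>fst z - real k / 2 ^ m\<bar> \<le> 1 / 2 ^ m \<and> snd z \<le> 1 / 2 ^ m}
      (real k / 2 ^ m, 0) (real l / 2 ^ m, 0)"
    "\<And>p. essentially_standard p \<Longrightarrow> pathfinish p = (real k / 2 ^ m, 0) \<Longrightarrow> essentially_standard (p +++ e)"
proof -
  let ?S = "{z \<in> dyadic_arc_space. \<bar>fst z - real k / 2 ^ m\<bar> \<le> 1 / 2 ^ m \<and> snd z \<le> 1 / 2 ^ m}"
  have image: "path_image (arc_path (Suc m) (Suc i)) \<subseteq> ?S" if i: "i < 2 ^ m" "k = i \<or> k = Suc i" for i
  proof
    fix z assume "z \<in> path_image (arc_path (Suc m) (Suc i))"
    then obtain u where u: "u \<in> {0..1}" "z = arc_path (Suc m) (Suc i) u" by (auto simp: path_image_def)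
    have "z \<in> arc_level m" unfolding u(2) by (rule arc_path_in_level[OF i(1) u(1)])
    moreover have "\<bar>fst z - real k / 2 ^ m\<bar> \<le> 1 / 2 ^ m"
      using i(2) u by (auto simp: arc_path_eq diff_divide_distrib[symmetric] abs_divide divide_right_mono)
    ultimately show "z \<in> ?S" using arc_level_bounds(3) unfolding dyadic_arc_space_levels by blast
  qed
  consider "k = l" | "l = Suc k" | "k = Suc l" using k(3) by blast
  then show thesis
  proof cases
    case 1
    have "real k / 2 ^ m \<in> {0..1}" by (rule dyadic_in_unit[OF k(1)])
    then have z: "(real k / 2 ^ m, 0) \<in> ?S" unfolding dyadic_arc_space_levels by auto
    show thesis
    proof (rule that)
      show "(\<lambda>_. (real k / 2 ^ m, 0)) \<in> paths_between ?S (real k / 2 ^ m, 0) (real l / 2 ^ m, 0)"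
        using paths_between_const[OF z] 1 by simp
      fix p assume p: "essentially_standard p" "pathfinish p = (real k / 2 ^ m, 0)"
      then obtain q where h: "homotopic_paths dyadic_arc_space q p" unfolding essentially_standard_def by blast
      have "p \<in> paths_between dyadic_arc_space (pathstart p) (real k / 2 ^ m, 0)"
        using p(2) homotopic_paths_imp_path[OF h] homotopic_paths_imp_subset[OF h] by (intro paths_betweenI) auto
      from homotopic_paths_sym[OF homotopic_rid[OF this]]
      show "essentially_standard (p +++ (\<lambda>_. (real k / 2 ^ m, 0)))"
        by (rule essentially_standard_homotopic[OF p(1)])
    qed
  next
    case 2
    have i: "k < 2 ^ m" using 2 k by simp
    note arc = arc_path_between[OF i]
    show thesis
    proof (rule that)
      show "arc_path (Suc m) (Suc k) \<in> paths_between ?S (real k / 2 ^ m, 0) (real l / 2 ^ m, 0)"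
        using arc image[OF i] 2 by (simp add: paths_between_def)
      show "essentially_standard (p +++ arc_path (Suc m) (Suc k))"
        if "essentially_standard p" "pathfinish p = (real k / 2 ^ m, 0)" for p
        using that paths_betweenD(3)[OF arc] by (intro essentially_standard_join essentially_standard_arc i) simp_all
    qed
  next
    case 3
    have i: "l < 2 ^ m" using 3 k by simp
    note arc = arc_path_between[OF i]
    show thesis
    proof (rule that)
      show "reversepath (arc_path (Suc m) (Suc l)) \<in> paths_between ?S (real k / 2 ^ m, 0) (real l / 2 ^ m, 0)"
        using arc image[OF i] 3 by (simp add: paths_between_def)
      show "essentially_standard (p +++ reversepath (arc_path (Suc m) (Suc l)))"
        if "essentially_standard p" "pathfinish p = (real k / 2 ^ m, 0)" for p
        using that paths_betweenD(4)[OF arc] 3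
        by (intro essentially_standard_join essentially_standard_arc i) simp_all
    qed
  qed
qed

context subgroup_of_loops
begin

lemma class_image_homotopic:
  assumes f: "continuous_on S f" "f ` S \<subseteq> X" "f s0 = x0"
    and pq: "homotopic_paths S p q" and p: "p \<in> paths_between S s0 z"
  shows "cl (f \<circ> p) = cl (f \<circ> q)"
proof (rule class_homotopic)
  show "homotopic_paths X (f \<circ> p) (f \<circ> q)"
    using homotopic_paths_continuous_image[OF pq f(1)] f(2) by blast
  show "f \<circ> p \<in> paths_between X x0 (f z)"
    by (rule paths_between_compose[OF p f(1,2)]) (simp_all add: f(3))
qed

text \<open>
  The loop formed by \<open>p\<close> and the reverse of \<open>q\<close> represents an element of \<open>D\<close>.
\<close>

lemma class_essentially_standard:
  assumes f: "continuous_on dyadic_arc_space f" "f ` dyadic_arc_space \<subseteq> X" "f (0, 0) = x0"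
    and D: "induced_hom X f ` D_subgroup \<subseteq> H"
    and p: "essentially_standard p" "p \<in> paths_between dyadic_arc_space (0, 0) z"
    and q: "essentially_standard q" "q \<in> paths_between dyadic_arc_space (0, 0) z"
  shows "cl (f \<circ> p) = cl (f \<circ> q)"
proof -
  note q' = paths_between_reverse[OF q(2)]
  have "essentially_standard (p +++ reversepath q)"
    using p q by (intro essentially_standard_join essentially_standard_reverse) (auto simp: paths_between_def)
  then obtain r where r: "standard_concat r" "homotopic_paths dyadic_arc_space r (p +++ reversepath q)"
    unfolding essentially_standard_def by blast
  have r': "r \<in> paths_between dyadic_arc_space (0, 0) (0, 0)"
    using homotopic_paths_between[OF homotopic_paths_sym[OF r(2)] paths_between_join[OF p(2) q']] .
  have "path_class dyadic_arc_space r \<in> D_subgroup"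
    using r(1) r' unfolding D_subgroup_def paths_between_def by blast
  then have "induced_hom X f (path_class dyadic_arc_space r) \<in> H" using D by blast
  moreover have "induced_hom X f (path_class dyadic_arc_space r) = path_class X (f \<circ> (p +++ reversepath q))"
    using induced_hom_path_class[OF f(1,2) paths_betweenD(1,2)[OF paths_between_join[OF p(2) q']]]
      path_class_cong[OF r(2)] by simp
  ultimately have "path_class X ((f \<circ> p) +++ reversepath (f \<circ> q)) \<in> H"
    by (simp add: path_compose_join path_compose_reversepath)
  moreover have "f \<circ> p \<in> paths_between X x0 (f z)" "f \<circ> q \<in> paths_between X x0 (f z)"
    using f(3) by (intro paths_between_compose[OF p(2) f(1,2)] paths_between_compose[OF q(2) f(1,2)]; simp)+
  ultimately show ?thesis by (simp add: class_eq_iff)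
qed

text \<open>
  For \<open>s\<close> near \<open>t\<close>, the greedy path to \<open>t\<close> splits at the grid point below \<open>t\<close> into an initial part
  \<open>?Q t\<close> and a tail \<open>?T t\<close>. The small path from \<open>(t, 0)\<close> to \<open>(s, 0)\<close> goes back along the tail of \<open>t\<close>, over
  at most one arc \<open>e\<close> to the grid point below \<open>s\<close>, and out along the tail of \<open>s\<close>. The
  initial parts \<open>?Q t +++ e\<close> and \<open>?Q s\<close> are finite concatenations with the same end, so they define the
  same point of the cover space.
\<close>

lemma pathin_greedy_lift:
  assumes f: "continuous_on dyadic_arc_space f" "f ` dyadic_arc_space \<subseteq> X" "f (0, 0) = x0"
    and D: "induced_hom X f ` D_subgroup \<subseteq> H"
  shows "pathin (cover_space X x0 H) (\<lambda>t. cl (f \<circ> (greedy_path t \<circ> linepath 0 t)))"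
proof (rule pathin_class)
  have whole: "greedy_path t \<circ> linepath 0 t \<in> paths_between dyadic_arc_space (0, 0) (t, 0)"
    if t: "t \<in> {0..1}" for t
  proof -
    have "greedy_path t 0 = (0, 0)"
      using greedy_path_step[OF t, of 0 0] dyadic_floor_0[OF t] dyadic_floor_nonneg[OF t] by simp
    then show ?thesis
      using segment_between[OF path_greedy_path[OF t], of 0 t] t greedy_path_beyond[of t t] by simp
  qed
  show "f \<circ> (greedy_path t \<circ> linepath 0 t) \<in> paths_between X x0 (f (t, 0))" if "t \<in> {0..1}" for t
    by (rule paths_between_compose[OF whole[OF that] f(1,2)]) (simp_all add: f(3))
  fix t U assume t: "t \<in> {0..1}" and U: "openin (top_of_set X) U" "f (t, 0) \<in> U"
  have tD: "(t, 0) \<in> dyadic_arc_space" using t unfolding dyadic_arc_space_levels by simp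
  obtain V where V: "open V" "U = X \<inter> V" using U(1) by (auto simp: openin_open)
  have "f (t, 0) \<in> V" using U(2) V(2) by blast
  from f(1)[unfolded continuous_on_topological, rule_format, OF tD V(1) this]
  obtain A where A: "open A" "(t, 0) \<in> A" "\<And>z. z \<in> dyadic_arc_space \<Longrightarrow> z \<in> A \<Longrightarrow> f z \<in> V"
    by metis
  obtain \<rho> where \<rho>: "\<rho> > 0" "ball (t, 0) \<rho> \<subseteq> A" using A(1,2) open_contains_ball by blast
  obtain m where "(1 / 2) ^ m < \<rho> / 3" using real_arch_pow_inv[of "\<rho> / 3" "1 / 2"] \<rho>(1) by auto
  then have m: "3 / 2 ^ m < \<rho>" by (simp add: power_one_over)
  \<comment> \<open>All pieces of the small path stay in this box: two steps of the \<open>1 / 2 ^ m\<close>-grid horizontally, one vertically.\<close>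
  let ?B = "{z \<in> dyadic_arc_space. \<bar>fst z - t\<bar> \<le> 2 / 2 ^ m \<and> snd z \<le> 1 / 2 ^ m}"
  have BU: "f ` ?B \<subseteq> U"
  proof (rule image_subsetI)
    fix z assume z: "z \<in> ?B"
    have "dist (t, 0) z \<le> \<bar>fst z - t\<bar> + \<bar>snd z\<bar>"
      using sqrt_sum_squares_le_sum_abs[of "fst z - t" "snd z"]
      by (simp add: dist_prod_def dist_real_def power2_commute)
    also have "\<dots> \<le> 2 / 2 ^ m + 1 / 2 ^ m"
      using z dyadic_arc_space_bounds(2)[of z] by (intro add_mono) auto
    also have "\<dots> < \<rho>" using m by (simp add: add_divide_distrib[symmetric])
    finally have "z \<in> A" using \<rho>(2) by auto
    then show "f z \<in> U" using A(3)[of z] z f(2) V(2) by auto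
  qed
  have BD: "?B \<subseteq> dyadic_arc_space" by blast
  let ?a = "\<lambda>s. dyadic_floor (Suc m) s"
  let ?Q = "\<lambda>s. greedy_path s \<circ> linepath 0 (?a s)"
  let ?T = "\<lambda>s. greedy_path s \<circ> linepath (?a s) s"
  have grid: "greedy_path s (?a s) = (?a s, 0)" if s: "s \<in> {0..1}" for s
    using greedy_path_step[OF s dyadic_floor_mono_Suc(1)[OF s] order_refl, of m] by simp
  have Q: "?Q s \<in> paths_between dyadic_arc_space (0, 0) (?a s, 0)" if s: "s \<in> {0..1}" for s
  proof -
    have "greedy_path s 0 = (0, 0)" using paths_betweenD(3)[OF whole[OF s]] by (simp add: pathstart_compose)
    then show ?thesis
      using segment_between[OF path_greedy_path[OF s], of 0 "?a s"] dyadic_floor_in_unit[OF s] grid[OF s] by simp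
  qed
  have T: "?T s \<in> paths_between ?B (?a s, 0) (s, 0)" if s: "s \<in> {0..1}" "dist s t < 1 / 2 ^ m" for s
  proof (rule paths_betweenI)
    note seg = segment_between[OF path_greedy_path[OF s(1)] dyadic_floor_in_unit[OF s(1)] s(1), of "Suc m"]
    show "path (?T s)" by (rule paths_betweenD(1)[OF seg])
    show "pathstart (?T s) = (?a s, 0)" "pathfinish (?T s) = (s, 0)"
      using paths_betweenD(3,4)[OF seg] grid[OF s(1)] greedy_path_beyond[of s s] by simp_all
    show "path_image (?T s) \<subseteq> ?B"
    proof
      fix z assume z: "z \<in> path_image (?T s)"
      have zD: "z \<in> dyadic_arc_space" using z paths_betweenD(2)[OF seg] by blast
      have "path_image (?T s) = greedy_path s ` {?a s..s}"
        unfolding path_image_compose using dyadic_floor_le[of "Suc m" s]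
        by (simp add: closed_segment_eq_real_ivl)
      then obtain x where x: "z = greedy_path s x" "?a s \<le> x" "x \<le> s" using z by auto
      have "\<bar>x - s\<bar> \<le> 1 / 2 ^ m" using x dyadic_floor_gt[of s "Suc m"] by simp
      then have "\<bar>x - t\<bar> \<le> 2 / 2 ^ m" using s(2) by (simp add: dist_real_def)
      moreover have "snd z \<le> 1 / 2 ^ m"
      proof (rule order_trans)
        show "snd z \<le> 1 / 2 ^ Suc m" unfolding x(1) by (rule greedy_path_height[OF s(1) x(2,3)])
      qed (simp add: divide_simps)
      ultimately show "z \<in> ?B" using zD x(1) by simp
    qed
  qed
  have split: "homotopic_paths dyadic_arc_space (?Q s +++ ?T s) (greedy_path s \<circ> linepath 0 s)" if s: "s \<in> {0..1}" for s
    using s dyadic_floor_in_unit[OF s] by (intro segment_join path_greedy_path) auto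
  have "\<exists>\<epsilon>\<in>paths_between U (f (t, 0)) (f (s, 0)). cl (f \<circ> (greedy_path s \<circ> linepath 0 s)) =
      cl ((f \<circ> (greedy_path t \<circ> linepath 0 t)) +++ \<epsilon>)" if s: "s \<in> {0..1}" "dist s t < 1 / 2 ^ m" for s
  proof -
    obtain k where k: "k \<le> 2 ^ m" "?a t = real k / 2 ^ m" using dyadic_floor_index[OF t] .
    obtain l where l: "l \<le> 2 ^ m" "?a s = real l / 2 ^ m" using dyadic_floor_index[OF s(1)] .
    have kl: "k = l \<or> l = Suc k \<or> k = Suc l"
    proof -
      have "\<bar>2 ^ m * s - 2 ^ m * t\<bar> = 2 ^ m * dist s t"
        by (simp add: dist_real_def right_diff_distrib[symmetric] abs_mult)
      also have "\<dots> < 1" using s(2) by (simp add: pos_less_divide_eq mult.commute)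
      finally have "\<bar>2 ^ m * s - 2 ^ m * t\<bar> < 1" .
      then have "\<bar>\<lfloor>2 ^ m * s\<rfloor> - \<lfloor>2 ^ m * t\<rfloor>\<bar> \<le> 1" by linarith
      moreover have "real_of_int \<lfloor>2 ^ m * t\<rfloor> = real k" "real_of_int \<lfloor>2 ^ m * s\<rfloor> = real l"
        using k(2) l(2) by (simp_all add: dyadic_floor_Suc)
      then have "\<lfloor>2 ^ m * t\<rfloor> = int k" "\<lfloor>2 ^ m * s\<rfloor> = int l" by linarith+
      ultimately show ?thesis by linarith
    qed
    obtain e where e: "e \<in> paths_between {z \<in> dyadic_arc_space. \<bar>fst z - real k / 2 ^ m\<bar> \<le> 1 / 2 ^ m \<and> snd z \<le> 1 / 2 ^ m}
        (real k / 2 ^ m, 0) (real l / 2 ^ m, 0)"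
      "\<And>p. essentially_standard p \<Longrightarrow> pathfinish p = (real k / 2 ^ m, 0) \<Longrightarrow> essentially_standard (p +++ e)"
      using neighbouring_grid_points_joined[OF k(1) l(1) kl] by blast
    have "\<bar>real k / 2 ^ m - t\<bar> \<le> 1 / 2 ^ m"
      using dyadic_floor_le[of "Suc m" t] dyadic_floor_gt[of t "Suc m"] unfolding k(2) by simp
    then have "{z \<in> dyadic_arc_space. \<bar>fst z - real k / 2 ^ m\<bar> \<le> 1 / 2 ^ m \<and> snd z \<le> 1 / 2 ^ m} \<subseteq> ?B"
      by (auto; linarith)
    then have eB: "e \<in> paths_between ?B (?a t, 0) (?a s, 0)"
      unfolding k(2) l(2) by (rule paths_between_subset[OF e(1)])
    have Tt: "?T t \<in> paths_between ?B (?a t, 0) (t, 0)" using T[OF t] by simp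
    have Ts: "?T s \<in> paths_between ?B (?a s, 0) (s, 0)" by (rule T[OF s])
    note eD = paths_between_subset[OF eB BD] and TtD = paths_between_subset[OF Tt BD]
      and TsD = paths_between_subset[OF Ts BD]
    define \<delta> where "\<delta> = reversepath (?T t) +++ (e +++ ?T s)"
    have \<delta>: "\<delta> \<in> paths_between ?B (t, 0) (s, 0)"
      unfolding \<delta>_def by (rule paths_between_join[OF paths_between_reverse[OF Tt] paths_between_join[OF eB Ts]])
    have \<delta>D: "\<delta> \<in> paths_between dyadic_arc_space (t, 0) (s, 0)" by (rule paths_between_subset[OF \<delta> BD])
    have Qe: "?Q t +++ e \<in> paths_between dyadic_arc_space (0, 0) (?a s, 0)" by (rule paths_between_join[OF Q[OF t] eD])
    have "homotopic_paths dyadic_arc_space ((greedy_path t \<circ> linepath 0 t) +++ \<delta>) ((?Q t +++ ?T t) +++ \<delta>)"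
      by (rule homotopic_join_cong[OF homotopic_paths_sym[OF split[OF t]] homotopic_refl[OF \<delta>D] whole[OF t] \<delta>D])
    also have "homotopic_paths dyadic_arc_space \<dots> (?Q t +++ (e +++ ?T s))"
      unfolding \<delta>_def by (rule homotopic_cancel_middle[OF Q[OF t] TtD paths_between_join[OF eD TsD]])
    also have "homotopic_paths dyadic_arc_space \<dots> ((?Q t +++ e) +++ ?T s)"
      by (rule homotopic_assoc[OF Q[OF t] eD TsD])
    finally have "cl (f \<circ> ((greedy_path t \<circ> linepath 0 t) +++ \<delta>)) = cl (f \<circ> ((?Q t +++ e) +++ ?T s))"
      using class_image_homotopic[OF f _ paths_between_join[OF whole[OF t] \<delta>D]] by blast
    also have "\<dots> = cl ((f \<circ> (?Q t +++ e)) +++ (f \<circ> ?T s))" by (simp only: path_compose_join)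
    also have "\<dots> = cl ((f \<circ> ?Q s) +++ (f \<circ> ?T s))"
    proof (rule class_append)
      show "f \<circ> (?Q t +++ e) \<in> paths_between X x0 (f (?a s, 0))"
        by (rule paths_between_compose[OF Qe f(1,2)]) (simp_all add: f(3))
      show "f \<circ> ?Q s \<in> paths_between X x0 (f (?a s, 0))"
        by (rule paths_between_compose[OF Q[OF s(1)] f(1,2)]) (simp_all add: f(3))
      show "f \<circ> ?T s \<in> paths_between X (f (?a s, 0)) (f (s, 0))"
        by (rule paths_between_compose[OF TsD f(1,2)]) simp_all
      show "cl (f \<circ> (?Q t +++ e)) = cl (f \<circ> ?Q s)"
      proof (rule class_essentially_standard[OF f D _ Qe _ Q[OF s(1)]])
        show "essentially_standard (?Q t +++ e)"
          using paths_betweenD(4)[OF Q[OF t]] k(2) by (intro e(2) greedy_path_initial_standard t) simp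
      qed (rule greedy_path_initial_standard[OF s(1)])
    qed
    also have "\<dots> = cl (f \<circ> (?Q s +++ ?T s))" by (simp only: path_compose_join)
    also have "\<dots> = cl (f \<circ> (greedy_path s \<circ> linepath 0 s))"
      by (rule class_image_homotopic[OF f split[OF s(1)] paths_between_join[OF Q[OF s(1)] TsD]])
    finally have "cl (f \<circ> (greedy_path s \<circ> linepath 0 s)) = cl ((f \<circ> (greedy_path t \<circ> linepath 0 t)) +++ (f \<circ> \<delta>))"
      by (simp only: path_compose_join)
    moreover have "f \<circ> \<delta> \<in> paths_between U (f (t, 0)) (f (s, 0))"
      using continuous_on_subset[OF f(1) BD] BU by (intro paths_between_compose[OF \<delta>]) auto
    ultimately show ?thesis by blast
  qed
  then show "\<exists>d>0. \<forall>s\<in>{0..1}. dist s t < d \<longrightarrow> (\<exists>\<epsilon>\<in>paths_between U (f (t, 0)) (f (s, 0)).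
      cl (f \<circ> (greedy_path s \<circ> linepath 0 s)) = cl ((f \<circ> (greedy_path t \<circ> linepath 0 t)) +++ \<epsilon>))"
    by (intro exI[of _ "1 / 2 ^ m"]) auto
qed

text \<open>
  Both the standard lift of the base path and the greedy lift project to \<open>f (t, 0)\<close> and start at the class
  of the constant path. At \<open>t = 1\<close> they are the classes of the two paths that make up \<open>d_infinity\<close>.
\<close>

lemma closed_if_unique_path_lifting:
  assumes upl: "unique_path_lifting (cover_space X x0 H) cover_proj"
  shows "closed_for dyadic_arc_space (0, 0) D_subgroup d_infinity X x0 H"
  unfolding closed_for_def
proof (intro allI impI, elim conjE)
  fix f assume f: "continuous_on dyadic_arc_space f" "f ` dyadic_arc_space \<subseteq> X" "f (0, 0) = x0"
    and D: "induced_hom X f ` D_subgroup \<subseteq> H"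
  have const: "(\<lambda>_. x0) \<in> paths_between X x0 x0" by (rule paths_between_const[OF base])
  let ?b = "f \<circ> base_path"
  have b: "?b \<in> paths_between X x0 (f (1, 0))"
    by (rule paths_between_compose[OF base_path_between f(1,2)]) (simp_all add: f(3))
  have b0: "?b 0 = x0" using f(3) by (simp add: base_path_def)
  let ?\<alpha> = "\<lambda>t. cl ((\<lambda>_. x0) +++ (?b \<circ> linepath 0 t))" and ?\<beta> = "\<lambda>t. cl (f \<circ> (greedy_path t \<circ> linepath 0 t))"
  have "?\<alpha> 1 = ?\<beta> 1"
  proof -
    have "pathin (cover_space X x0 H) ?\<alpha>"
      using const b0 by (intro pathin_standard_lift paths_betweenD(1,2)[OF b]) simp
    moreover have "pathin (cover_space X x0 H) ?\<beta>" by (rule pathin_greedy_lift[OF f D])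
    moreover have "?\<alpha> 0 = ?\<beta> 0"
    proof -
      have "?\<alpha> 0 = cl (\<lambda>_. x0)"
        using class_homotopic[OF homotopic_lid[OF const] paths_between_join[OF const const]] b0
        by (simp add: const_as_segment)
      moreover have "f \<circ> (greedy_path 0 \<circ> linepath 0 0) = (\<lambda>_. x0)"
        using greedy_path_beyond[of 0 0] f(3) by (simp add: const_as_segment fun_eq_iff)
      ultimately show ?thesis by simp
    qed
    moreover have "cover_proj (?\<alpha> t) = cover_proj (?\<beta> t)" if t: "t \<in> {0..1}" for t
    proof -
      have "(\<lambda>_. x0) +++ (?b \<circ> linepath 0 t) \<in> paths_between X x0 (f (t, 0))"
        using segment_between[OF paths_betweenD(1,2)[OF b], of 0 t] t b0
        by (intro paths_between_join[OF const]) (simp add: base_path_def)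
      moreover have "f \<circ> (greedy_path t \<circ> linepath 0 t) \<in> paths_between X x0 (f (t, 0))"
      proof (rule paths_between_compose[OF segment_between[OF path_greedy_path[OF t]] f(1,2)])
        show "x0 = f (greedy_path t 0)"
          using greedy_path_step[OF t, of 0 0] dyadic_floor_0[OF t] dyadic_floor_nonneg[OF t] f(3) by simp
        show "f (t, 0) = f (greedy_path t t)" using greedy_path_beyond[of t t] by simp
      qed (use t in auto)
      ultimately show ?thesis using cover_proj_class by metis
    qed
    ultimately show ?thesis
      using upl[unfolded unique_path_lifting_def, rule_format, of ?\<alpha> ?\<beta> 1] by simp
  qed
  moreover have "?\<alpha> 1 = cl ?b"
    using class_homotopic[OF homotopic_lid[OF b] paths_between_join[OF const b]] by (simp add: path_as_segment)
  moreover have arc: "arc_path 1 1 \<in> paths_between dyadic_arc_space (0, 0) (1, 0)"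
    using arc_path_between[of 0 0] by simp
  moreover have "?\<beta> 1 = cl (f \<circ> arc_path 1 1)"
  proof -
    have "dyadic_floor 0 1 = real 0 / 2 ^ 0" "dyadic_floor (Suc 0) 1 = real (Suc 0) / 2 ^ 0"
      using dyadic_floor_0[of 1] by (simp_all add: dyadic_floor_Suc)
    then have "greedy_path 1 u = arc_path 1 1 u" if "u \<in> {0..1}" for u
      using greedy_path_arc[of 1 0 0 u] that by simp
    then have "homotopic_paths dyadic_arc_space (arc_path 1 1) (greedy_path 1)"
      using paths_betweenD[OF arc] by (intro homotopic_paths_eq) auto
    from class_image_homotopic[OF f this arc] show ?thesis by (simp add: path_as_segment)
  qed
  moreover have fa: "f \<circ> arc_path 1 1 \<in> paths_between X x0 (f (1, 0))"
    by (rule paths_between_compose[OF arc f(1,2)]) (simp_all add: f(3))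
  ultimately have "path_class X ((f \<circ> arc_path 1 1) +++ reversepath ?b) \<in> H"
    using class_eq_iff[OF fa b] by simp
  moreover have "arc_path 1 1 +++ reversepath base_path \<in> paths_between dyadic_arc_space (0, 0) (0, 0)"
    by (rule paths_between_join[OF arc paths_between_reverse[OF base_path_between]])
  ultimately show "induced_hom X f d_infinity \<in> H"
    using induced_hom_path_class[OF f(1,2)] unfolding d_infinity_def
    by (simp add: path_compose_join path_compose_reversepath paths_between_def)
qed

end


section \<open>Path spaces of metrizable spaces\<close>

lemma compact_interval_finite_cover:
  assumes "\<And>t. t \<in> {0..1::real} \<Longrightarrow> \<delta> t > 0"
  obtains C where "C \<subseteq> {0..1}" "finite C" "\<And>s. s \<in> {0..1} \<Longrightarrow> \<exists>t\<in>C. dist s t < \<delta> t"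
proof -
  have cover: "{0..1} \<subseteq> (\<Union>t\<in>{0..1}. ball t (\<delta> t))" using assms by force
  obtain C where C: "C \<subseteq> {0..1}" "finite C" "{0..1} \<subseteq> (\<Union>t\<in>C. ball t (\<delta> t))"
    using compactE_image[OF compact_Icc _ cover] by auto
  show thesis
  proof (rule that[OF C(1,2)])
    fix s :: real assume "s \<in> {0..1}"
    then have "s \<in> (\<Union>t\<in>C. ball t (\<delta> t))" using C(3) by blast
    then show "\<exists>t\<in>C. dist s t < \<delta> t" by (auto simp: dist_commute)
  qed
qed

text \<open>
  Finitely many subbasic conditions, one for each ball of a finite cover of the unit interval, force
  uniform closeness to \<open>\<gamma>\<close> (\<open>inside\<close>). Conversely, a finite subcover of the boxes inside an open
  neighbourhood of the graph of \<open>\<gamma>\<close> gives a uniform distance that keeps a graph inside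
  that neighbourhood (\<open>outside\<close>).
\<close>

lemma first_countable_path_space:
  assumes "metrizable_space (top_of_set X)"
  shows "first_countable (path_space X)"
proof -
  obtain M d where M: "Metric_space M d" and eq: "top_of_set X = Metric_space.mtopology M d"
    using assms unfolding metrizable_space_def by blast
  interpret Metric_space M d by (rule M)
  have MX: "M = X" using arg_cong[OF eq, of topspace] by simp
  let ?near = "\<lambda>\<gamma> r. {p \<in> topspace (path_space X). \<forall>s\<in>{0..1}. d (\<gamma> s) (p s) < r}"
  have radius: "\<exists>\<delta>>0. \<forall>s\<in>{0..1}. dist s t < \<delta> \<longrightarrow> d (\<gamma> t) (\<gamma> s) < r"
    if \<gamma>: "\<gamma> \<in> topspace (path_space X)" and t: "t \<in> {0..1}" and r: "r > 0" for \<gamma> t r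
  proof -
    have g: "path \<gamma>" "path_image \<gamma> \<subseteq> X" using \<gamma> by (auto simp: topspace_path_space)
    have "\<gamma> t \<in> M" using g(2) t unfolding MX path_image_def by blast
    then have "openin (top_of_set X) (mball (\<gamma> t) r)" "\<gamma> t \<in> mball (\<gamma> t) r"
      using r unfolding eq by auto
    from path_near[OF g t this] obtain \<delta> where \<delta>: "\<delta> > 0" "\<And>s. s \<in> {0..1} \<Longrightarrow> dist s t < \<delta> \<Longrightarrow> \<gamma> s \<in> mball (\<gamma> t) r"
      by blast
    then show ?thesis by (intro exI[of _ \<delta>]) auto
  qed
  have in_M: "p s \<in> M" if "p \<in> topspace (path_space X)" "s \<in> {0..1}" for p s
    using that unfolding MX topspace_path_space path_image_def by blast
  have inside: "\<exists>W. openin (path_space X) W \<and> \<gamma> \<in> W \<and> W \<subseteq> ?near \<gamma> r"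
    if \<gamma>: "\<gamma> \<in> topspace (path_space X)" and r: "r > 0" for \<gamma> r
  proof -
    have "\<forall>t\<in>{0..1}. \<exists>\<delta>>0. \<forall>s\<in>{0..1}. dist s t < \<delta> \<longrightarrow> d (\<gamma> t) (\<gamma> s) < r / 2"
      using radius[OF \<gamma> _ half_gt_zero[OF r]] by blast
    then obtain \<delta> where \<delta>: "\<And>t. t \<in> {0..1} \<Longrightarrow> \<delta> t > 0"
      "\<And>t s. t \<in> {0..1} \<Longrightarrow> s \<in> {0..1} \<Longrightarrow> dist s t < \<delta> t \<Longrightarrow> d (\<gamma> t) (\<gamma> s) < r / 2" by metis
    obtain C where C: "C \<subseteq> {0..1}" "finite C" "\<And>s. s \<in> {0..1} \<Longrightarrow> \<exists>t\<in>C. dist s t < \<delta> t / 2"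
      using compact_interval_finite_cover[of "\<lambda>t. \<delta> t / 2"] \<delta>(1) by auto
    let ?S = "\<lambda>t. {p \<in> topspace (path_space X). p ` ({0..1} \<inter> cball t (\<delta> t / 2)) \<subseteq> mball (\<gamma> t) (r / 2)}"
    let ?W = "(\<Inter>t\<in>C. ?S t) \<inter> topspace (path_space X)"
    have "openin (path_space X) (?S t)" for t
      by (rule openin_path_space_subbasic) (auto simp: eq intro: compact_Int_closed)
    then have "openin (path_space X) ?W" using C(2) by (intro openin_INT) auto
    moreover have "\<gamma> \<in> ?W"
    proof -
      have "\<gamma> s \<in> mball (\<gamma> t) (r / 2)" if t: "t \<in> C" and s: "s \<in> {0..1}" "s \<in> cball t (\<delta> t / 2)" for s t
      proof -
        have t': "t \<in> {0..1}" using t C(1) by blast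
        have "dist s t < \<delta> t" using s(2) \<delta>(1)[OF t'] by (simp add: dist_commute)
        then show ?thesis using \<delta>(2)[OF t' s(1)] in_M[OF \<gamma>] t' s(1) by simp
      qed
      then show ?thesis using \<gamma> by blast
    qed
    moreover have "p \<in> ?near \<gamma> r" if p: "p \<in> ?W" for p
    proof -
      have pt: "p \<in> topspace (path_space X)" using p by blast
      have "d (\<gamma> s) (p s) < r" if s: "s \<in> {0..1}" for s
      proof -
        obtain t where t: "t \<in> C" "dist s t < \<delta> t / 2" using C(3)[OF s] by blast
        have t': "t \<in> {0..1}" using t(1) C(1) by blast
        have "p \<in> ?S t" using p t(1) by blast
        moreover have "s \<in> {0..1} \<inter> cball t (\<delta> t / 2)" using s t(2) by (simp add: dist_commute)
        ultimately have "p s \<in> mball (\<gamma> t) (r / 2)" by blast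
        then have "d (\<gamma> t) (p s) < r / 2" by simp
        moreover have "dist s t < \<delta> t" using t(2) zero_le_dist[of s t] by linarith
        then have "d (\<gamma> s) (\<gamma> t) < r / 2" using \<delta>(2)[OF t' s] by (simp add: commute)
        ultimately show ?thesis
          using triangle[OF in_M[OF \<gamma> s] in_M[OF \<gamma> t'] in_M[OF pt s]] by linarith
      qed
      then show ?thesis using pt by blast
    qed
    ultimately show ?thesis by (intro exI[of _ ?W] conjI subsetI)
  qed
  have outside: "\<exists>r>0. ?near \<gamma> r \<subseteq> V" if V: "openin (path_space X) V" "\<gamma> \<in> V" for \<gamma> V
  proof -
    have \<gamma>: "\<gamma> \<in> topspace (path_space X)" using V openin_subset by blast
    obtain G where G: "open G" "\<And>t. t \<in> {0..1} \<Longrightarrow> (t, \<gamma> t) \<in> G"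
      "\<And>p. p \<in> topspace (path_space X) \<Longrightarrow> (\<And>t. t \<in> {0..1} \<Longrightarrow> (t, p t) \<in> G) \<Longrightarrow> p \<in> V"
      using path_space_graph_nbhd[OF V] by blast
    define good where "good t \<delta> r \<longleftrightarrow> (\<forall>s\<in>{0..1}. dist s t < \<delta> \<longrightarrow>
      d (\<gamma> t) (\<gamma> s) < r / 2 \<and> (\<forall>x\<in>X. d (\<gamma> t) x < r \<longrightarrow> (s, x) \<in> G))" for t \<delta> r
    have "\<exists>\<delta> r. \<delta> > 0 \<and> r > 0 \<and> good t \<delta> r" if t: "t \<in> {0..1}" for t
    proof -
      obtain A U where AU: "open A" "open U" "t \<in> A" "\<gamma> t \<in> U" "A \<times> U \<subseteq> G"
        using open_prod_elim[OF G(1) G(2)[OF t]] by (metis mem_Times_iff fst_conv snd_conv)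
      have "openin mtopology (X \<inter> U)" using AU(2) unfolding eq[symmetric] by (auto simp: openin_open)
      moreover have "\<gamma> t \<in> X \<inter> U" using in_M[OF \<gamma> t] MX AU(4) by simp
      ultimately obtain r where r: "r > 0" "mball (\<gamma> t) r \<subseteq> X \<inter> U"
        unfolding openin_mtopology by blast
      obtain \<delta>1 where d1: "\<delta>1 > 0" "ball t \<delta>1 \<subseteq> A" using AU(1,3) open_contains_ball by blast
      obtain \<delta>2 where d2: "\<delta>2 > 0" "\<forall>s\<in>{0..1}. dist s t < \<delta>2 \<longrightarrow> d (\<gamma> t) (\<gamma> s) < r / 2"
        using radius[OF \<gamma> t half_gt_zero[OF r(1)]] by blast
      have "(s, x) \<in> G" if "dist s t < \<delta>1" "x \<in> X" "d (\<gamma> t) x < r" for s x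
      proof -
        have "s \<in> A" using that(1) d1(2) by (auto simp: dist_commute)
        moreover have "x \<in> mball (\<gamma> t) r" using that(2,3) in_M[OF \<gamma> t] unfolding MX[symmetric] by simp
        then have "x \<in> U" using r(2) by blast
        ultimately show ?thesis using AU(5) by blast
      qed
      then show ?thesis
        using d1(1) d2 r(1) unfolding good_def by (intro exI[of _ "min \<delta>1 \<delta>2"] conjI exI[of _ r]) auto
    qed
    then obtain \<delta> r where \<delta>: "\<And>t. t \<in> {0..1} \<Longrightarrow> \<delta> t > 0" and r: "\<And>t. t \<in> {0..1} \<Longrightarrow> r t > 0"
      and "\<And>t. t \<in> {0..1} \<Longrightarrow> good t (\<delta> t) (r t)" by metis
    then have close: "\<And>t s. t \<in> {0..1} \<Longrightarrow> s \<in> {0..1} \<Longrightarrow> dist s t < \<delta> t \<Longrightarrow> d (\<gamma> t) (\<gamma> s) < r t / 2"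
        "\<And>t s x. t \<in> {0..1} \<Longrightarrow> s \<in> {0..1} \<Longrightarrow> dist s t < \<delta> t \<Longrightarrow> x \<in> X \<Longrightarrow> d (\<gamma> t) x < r t \<Longrightarrow> (s, x) \<in> G"
      unfolding good_def by blast+
    obtain C where C: "C \<subseteq> {0..1}" "finite C" "\<And>s. s \<in> {0..1} \<Longrightarrow> \<exists>t\<in>C. dist s t < \<delta> t"
      using compact_interval_finite_cover[of \<delta>] \<delta> by auto
    have C0: "C \<noteq> {}" using C(3)[of 0] by auto
    define e where "e = Min ((\<lambda>t. r t / 2) ` C)"
    have e: "e \<le> r t / 2" if "t \<in> C" for t
      unfolding e_def by (rule Min_le) (use C(2) that in auto)
    have "e > 0" unfolding e_def using C(1,2) C0 r by (subst Min_gr_iff) auto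
    have "p \<in> V" if p: "p \<in> ?near \<gamma> e" for p
    proof (rule G(3))
      show pt: "p \<in> topspace (path_space X)" using p by blast
      fix s :: real assume s: "s \<in> {0..1}"
      obtain t where t: "t \<in> C" "dist s t < \<delta> t" using C(3)[OF s] by blast
      have t': "t \<in> {0..1}" using t(1) C(1) by blast
      have "d (\<gamma> s) (p s) < r t / 2" using p s e[OF t(1)] by force
      then have "d (\<gamma> t) (p s) < r t"
        using triangle[OF in_M[OF \<gamma> t'] in_M[OF \<gamma> s] in_M[OF pt s]] close(1)[OF t' s t(2)] by linarith
      then show "(s, p s) \<in> G" using close(2)[OF t' s t(2)] in_M[OF pt s] MX by blast
    qed
    then show ?thesis using \<open>e > 0\<close> by blast
  qed
  show ?thesis
    unfolding first_countable_def
  proof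
    fix \<gamma> assume \<gamma>: "\<gamma> \<in> topspace (path_space X)"
    have "\<forall>k::nat. \<exists>W. openin (path_space X) W \<and> \<gamma> \<in> W \<and> W \<subseteq> ?near \<gamma> (inverse (real (Suc k)))"
      using inside[OF \<gamma>] by simp
    from choice[OF this] obtain W where "\<forall>k::nat. openin (path_space X) (W k) \<and> \<gamma> \<in> W k \<and>
      W k \<subseteq> ?near \<gamma> (inverse (real (Suc k)))" ..
    then have W: "openin (path_space X) (W k)" "\<gamma> \<in> W k" "W k \<subseteq> ?near \<gamma> (inverse (real (Suc k)))" for k
      by simp_all
    have "\<exists>k. W k \<subseteq> V" if V: "openin (path_space X) V" "\<gamma> \<in> V" for V
    proof -
      obtain r where r: "r > 0" "?near \<gamma> r \<subseteq> V" using outside[OF V] by blast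
      obtain k where k: "inverse (real (Suc k)) < r" using reals_Archimedean[OF r(1)] by blast
      have "p \<in> V" if "p \<in> W k" for p
        using W(3)[of k] that k r(2) by (force intro: less_trans)
      then show ?thesis by blast
    qed
    then show "\<exists>\<B>. countable \<B> \<and> (\<forall>V\<in>\<B>. openin (path_space X) V) \<and>
        (\<forall>U. openin (path_space X) U \<and> \<gamma> \<in> U \<longrightarrow> (\<exists>V\<in>\<B>. \<gamma> \<in> V \<and> V \<subseteq> U))"
      using W(1,2) by (intro exI[of _ "range W"]) auto
  qed
qed

theorem theorem4p13:
  fixes X :: "'a::topological_space set" and x0 :: 'a and H :: "(real \<Rightarrow> 'a) set set"
  assumes "path_connected X"
    and "x0 \<in> X"
    and "subgroup H (fundamental_group X x0)"
  shows "(unique_path_lifting (cover_space X x0 H) cover_proj \<longrightarrow>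
            closed_for dyadic_arc_space (0, 0) D_subgroup d_infinity X x0 H) \<and>
         (first_countable (path_space X) \<longrightarrow>
            closed_for dyadic_arc_space (0, 0) D_subgroup d_infinity X x0 H \<longrightarrow>
            unique_path_lifting (cover_space X x0 H) cover_proj) \<and>
         (metrizable_space (top_of_set X) \<longrightarrow> first_countable (path_space X))"
proof -
  interpret subgroup_of_loops X x0 H
    by (rule subgroup_of_loops.intro[OF assms(2,3)])
  show ?thesis
    using closed_if_unique_path_lifting unique_path_lifting_if_closed first_countable_path_space by blast
qed


end
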